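(* Let $1<p_1<2$ and $\alpha=\frac1{p_1}-\frac12$. Let $0\le\rho,\delta\le1$ and $k\in\mathbb{N}$ with $k>\frac n2$, and let $a\in S^m_{\rho,\delta,0,2k}(\mathbb{T}^n\times\mathbb{Z}^n)$. Assume $0<w_1=\alpha n<2k-n$ and $m<-n-w_1-2k\delta$. Then $T_a$ is nuclear on $B^{w_1}_{p_1,2}(\mathbb{T}^n)$ and $\mathrm{Tr}(T_a)=\sum_{\xi\in\mathbb{Z}^n}\int_{\mathbb{T}^n}a(x,\xi)dx=\sum_n\lambda_n(T_a)$, where $(\lambda_n(T_a))$ is the sequence of eigenvalues of $T_a$ with multiplicities counted.
   Context: $\widehat f(\xi)=\int_{\mathbb{T}^n}e^{-i2\pi x\cdot\xi}f(x)dx$, $\langle\xi\rangle=(1+|\xi|^2)^{1/2}$. $S^m_{\rho,\delta,0,\mu}(\mathbb{T}^n\times\mathbb{Z}^n)$: functions $a(x,\xi)$ smooth in $x$ for each $\xi\in\mathbb{Z}^n$ with $|\partial_x^\beta a(x,\xi)|\le C_\beta\langle\xi\rangle^{m+\delta|\beta|}$ for $|\beta|\le\mu$. $T_au(x)=\sum_{\xi\in\mathbb{Z}^n}e^{i2\pi x\cdot\xi}a(x,\xi)\widehat u(\xi)$. Periodic Besov spaces: $\|f\|_{B^w_{p,q}}=\big(\sum_{m\ge0}2^{mwq}\|\sum_{2^m\le|\xi|<2^{m+1}}e^{i2\pi x\cdot\xi}\widehat f(\xi)\|^q_{L^p(\mathbb{T}^n)}\big)^{1/q}$. $T:E\to E$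 is nuclear if $T=\sum_ne'_n(\cdot)y_n$ with $\sum_n\|e'_n\|_{E'}\|y_n\|_E<\infty$; its nuclear trace is $\sum_ne'_n(y_n)$.
   Formalization: The Besov norm's first block is taken over all |ξ|<2, so that ξ=0 is included; as written the sum over 2^m≤|ξ|<2^{m+1} omits ξ=0, giving only a seminorm that kills constants, for which the trace formula fails (take a(x,0)=1 and a(x,ξ)=0 for all other ξ). *)

theory Defs
  imports "HOL-Analysis.Analysis"
begin

text \<open>The torus T^n is modelled by 1-periodic functions on real^'n, with n = CARD('n);
  integration over T^n is integration over the unit cube [0,1]^n. Frequencies are in int^'n.\<close>

definition unit_cube :: "(real ^ 'n) set" where
  "unit_cube = cbox 0 One"

definition int_vec :: "int ^ 'n \<Rightarrow> real ^ 'n" where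
  "int_vec k = (\<chi> j. of_int (k $ j))"

definition dotZ :: "real ^ 'n \<Rightarrow> int ^ 'n \<Rightarrow> real" where
  "dotZ x \<xi> = (\<Sum>j\<in>UNIV. x $ j * of_int (\<xi> $ j))"

definition normZ :: "int ^ 'n \<Rightarrow> real" where
  "normZ \<xi> = sqrt (\<Sum>j\<in>UNIV. (of_int (\<xi> $ j))^2)"

definition jbr :: "int ^ 'n \<Rightarrow> real" where
  "jbr \<xi> = sqrt (1 + (normZ \<xi>)^2)"

definition periodic_fun :: "(real ^ 'n \<Rightarrow> 'a) \<Rightarrow> bool" where
  "periodic_fun f \<longleftrightarrow> (\<forall>x k. f (x + int_vec k) = f x)"

definition fhat :: "(real ^ 'n \<Rightarrow> complex) \<Rightarrow> int ^ 'n \<Rightarrow> complex" where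
  "fhat f \<xi> = integral unit_cube (\<lambda>x. cis (- 2 * pi * dotZ x \<xi>) * f x)"

definition pdx :: "'n \<Rightarrow> (real ^ 'n \<Rightarrow> complex) \<Rightarrow> real ^ 'n \<Rightarrow> complex" where
  "pdx i f x = vector_derivative (\<lambda>t::real. f (x + t *\<^sub>R axis i 1)) (at 0)"

fun pdiffs :: "'n list \<Rightarrow> (real ^ 'n \<Rightarrow> complex) \<Rightarrow> real ^ 'n \<Rightarrow> complex" where
  "pdiffs [] f = f"
| "pdiffs (i # is) f = pdx i (pdiffs is f)"

definition smooth_fun :: "(real ^ 'n \<Rightarrow> complex) \<Rightarrow> bool" where
  "smooth_fun f \<longleftrightarrow> (\<forall>is. continuous_on UNIV (pdiffs is f) \<and>
      (\<forall>i x. (\<lambda>t::real. pdiffs is f (x + t *\<^sub>R axis i 1)) differentiable (at 0)))"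

text \<open>Symbol class S^m_{\<rho>,\<delta>,0,\<mu>}(T^n x Z^n): only x-derivatives of order \<le> \<mu> are
  estimated (\<rho> plays no role when the number of \<xi>-differences is 0).  For smooth functions
  the iterated partial derivative along a list of directions is the multi-index derivative
  \<partial>_x^\<beta> with |\<beta>| = length of the list.\<close>
definition symbol_class ::
  "real \<Rightarrow> real \<Rightarrow> real \<Rightarrow> nat \<Rightarrow> (real ^ 'n \<Rightarrow> int ^ 'n \<Rightarrow> complex) \<Rightarrow> bool" where
  "symbol_class m \<rho> \<delta> \<mu> a \<longleftrightarrow>
     (\<forall>\<xi>. periodic_fun (\<lambda>x. a x \<xi>) \<and> smooth_fun (\<lambda>x. a x \<xi>)) \<and>
     (\<forall>is. length is \<le> \<mu> \<longrightarrow>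
        (\<exists>C. \<forall>x \<xi>. cmod (pdiffs is (\<lambda>y. a y \<xi>) x) \<le> C * jbr \<xi> powr (m + \<delta> * real (length is))))"

definition pdo :: "(real ^ 'n \<Rightarrow> int ^ 'n \<Rightarrow> complex) \<Rightarrow> (real ^ 'n \<Rightarrow> complex) \<Rightarrow> real ^ 'n \<Rightarrow> complex" where
  "pdo a u x = (\<Sum>\<^sub>\<infinity>\<xi>. cis (2 * pi * dotZ x \<xi>) * a x \<xi> * fhat u \<xi>)"

definition dyadic :: "nat \<Rightarrow> (int ^ 'n) set" where
  "dyadic m = (if m = 0 then {\<xi>. normZ \<xi> < 2} else {\<xi>. 2 ^ m \<le> normZ \<xi> \<and> normZ \<xi> < 2 ^ (m + 1)})"

definition block :: "(real ^ 'n \<Rightarrow> complex) \<Rightarrow> nat \<Rightarrow> real ^ 'n \<Rightarrow> complex" where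
  "block f m x = (\<Sum>\<xi>\<in>dyadic m. cis (2 * pi * dotZ x \<xi>) * fhat f \<xi>)"

definition Lp_norm :: "real \<Rightarrow> (real ^ 'n \<Rightarrow> complex) \<Rightarrow> real" where
  "Lp_norm p g = (integral unit_cube (\<lambda>x. cmod (g x) powr p)) powr (1 / p)"

definition besov_norm :: "real \<Rightarrow> real \<Rightarrow> real \<Rightarrow> (real ^ 'n \<Rightarrow> complex) \<Rightarrow> real" where
  "besov_norm w p q f = (\<Sum>m. (2 powr (real m * w) * Lp_norm p (block f m)) powr q) powr (1 / q)"

definition besov_space :: "real \<Rightarrow> real \<Rightarrow> real \<Rightarrow> (real ^ 'n \<Rightarrow> complex) set" where
  "besov_space w p q = {f. periodic_fun f \<and> f absolutely_integrable_on unit_cube \<and>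
      summable (\<lambda>m. (2 powr (real m * w) * Lp_norm p (block f m)) powr q)}"

text \<open>Nuclear operators on a normed function space (E, N); elements with N u = 0 are identified
  with 0.\<close>
type_synonym 'n tfun = "real ^ 'n \<Rightarrow> complex"

definition bounded_linear_functional ::
  "'n tfun set \<Rightarrow> ('n tfun \<Rightarrow> real) \<Rightarrow> ('n tfun \<Rightarrow> complex) \<Rightarrow> bool" where
  "bounded_linear_functional E N \<phi> \<longleftrightarrow>
     (\<forall>u\<in>E. \<forall>v\<in>E. \<phi> (\<lambda>x. u x + v x) = \<phi> u + \<phi> v) \<and>
     (\<forall>u\<in>E. \<forall>c. \<phi> (\<lambda>x. c * u x) = c * \<phi> u) \<and>
     (\<exists>C. \<forall>u\<in>E. cmod (\<phi> u) \<le> C * N u)"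

definition dual_norm :: "'n tfun set \<Rightarrow> ('n tfun \<Rightarrow> real) \<Rightarrow> ('n tfun \<Rightarrow> complex) \<Rightarrow> real" where
  "dual_norm E N \<phi> = Sup {cmod (\<phi> u) | u. u \<in> E \<and> N u \<le> 1}"

definition nuclear_repr ::
  "'n tfun set \<Rightarrow> ('n tfun \<Rightarrow> real) \<Rightarrow> ('n tfun \<Rightarrow> 'n tfun)
    \<Rightarrow> (nat \<Rightarrow> 'n tfun \<Rightarrow> complex) \<Rightarrow> (nat \<Rightarrow> 'n tfun) \<Rightarrow> bool" where
  "nuclear_repr E N T e y \<longleftrightarrow>
     (\<forall>j. bounded_linear_functional E N (e j) \<and> y j \<in> E) \<and>
     summable (\<lambda>j. dual_norm E N (e j) * N (y j)) \<and>
     (\<forall>u\<in>E. T u \<in> E \<and>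
        (\<lambda>k. N (\<lambda>x. T u x - (\<Sum>j<k. e j u * y j x))) \<longlonglongrightarrow> 0)"

definition nuclear :: "'n tfun set \<Rightarrow> ('n tfun \<Rightarrow> real) \<Rightarrow> ('n tfun \<Rightarrow> 'n tfun) \<Rightarrow> bool" where
  "nuclear E N T \<longleftrightarrow> (\<exists>e y. nuclear_repr E N T e y)"

text \<open>Eigenvalues (nonzero) and algebraic multiplicities, equality in E being N-equality.\<close>
definition eigenvalue_on :: "'n tfun set \<Rightarrow> ('n tfun \<Rightarrow> real) \<Rightarrow> ('n tfun \<Rightarrow> 'n tfun) \<Rightarrow> complex \<Rightarrow> bool" where
  "eigenvalue_on E N T z \<longleftrightarrow> (\<exists>u\<in>E. N u \<noteq> 0 \<and> N (\<lambda>x. T u x - z * u x) = 0)"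

definition gen_eigvec :: "'n tfun set \<Rightarrow> ('n tfun \<Rightarrow> real) \<Rightarrow> ('n tfun \<Rightarrow> 'n tfun) \<Rightarrow> complex \<Rightarrow> 'n tfun \<Rightarrow> bool" where
  "gen_eigvec E N T z u \<longleftrightarrow> u \<in> E \<and> (\<exists>k. N (((\<lambda>v x. T v x - z * v x) ^^ k) u) = 0)"

definition alg_mult :: "'n tfun set \<Rightarrow> ('n tfun \<Rightarrow> real) \<Rightarrow> ('n tfun \<Rightarrow> 'n tfun) \<Rightarrow> complex \<Rightarrow> nat" where
  "alg_mult E N T z = (GREATEST d. \<exists>v :: nat \<Rightarrow> 'n tfun.
      (\<forall>i<d. gen_eigvec E N T z (v i)) \<and>
      (\<forall>c :: nat \<Rightarrow> complex. N (\<lambda>x. \<Sum>i<d. c i * v i x) = 0 \<longrightarrow> (\<forall>i<d. c i = 0)))"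

end

theory Submission
  imports Defs "HOL-Complex_Analysis.Complex_Analysis" "Jordan_Normal_Form.Determinant"
    "HOL-Library.Function_Algebras"
begin

text \<open>On the Fourier side \<open>T\<^sub>a\<close> is the matrix \<open>A\<close> whose entry \<open>A(\<eta>, \<xi>)\<close> is the Fourier coefficient of
  \<open>a(\<cdot>, \<xi>)\<close> at \<open>\<eta> - \<xi>\<close>. Integration by parts bounds \<open>|A(\<eta>, \<xi>)|\<close> by a multiple of
  \<open>jbr (\<eta> - \<xi>) powr (- 2k) * jbr \<xi> powr (- s)\<close> with \<open>s = - (m + 2k\<delta>) > n + w\<^sub>1\<close>. So \<open>A\<close> maps bounded sequences
  to sequences that are summable with the weight \<open>jbr \<eta> powr w\<^sub>1\<close>, and the columns of \<open>A\<close> give a nuclear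
  representation of \<open>T\<^sub>a\<close>. The generalised eigenvectors of \<open>T\<^sub>a\<close> in the Besov space are therefore
  the bounded ones of \<open>A\<close>, for nonzero eigenvalues. The dyadic truncations are contractions for the
  Besov norm and converge strongly, so every nuclear representation has the trace \<open>\<Sum>\<^sub>\<xi> A(\<xi>, \<xi>)\<close>.

  For the eigenvalues, the Fredholm determinant \<open>D(z)\<close> of \<open>I - z A\<close> is entire with \<open>D(0) = 1\<close>, \<open>D'(0) = - tr A\<close>,
  and \<open>|D(z)| \<le> \<Prod>\<^sub>\<xi> (1 + |z| c\<^sub>\<xi>)\<close>, where the column norms satisfy \<open>\<Sum>\<^sub>\<xi> c\<^sub>\<xi>\<^sup>\<sigma> < \<infinity>\<close> for some \<open>\<sigma> < 1\<close>. Deflating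
  an eigenvalue \<open>\<mu>\<close> divides \<open>D\<close> by \<open>1 - z \<mu>\<close> and lowers the multiplicity of \<open>\<mu>\<close> by one. By the maximum
  principle the number of eigenvalues of modulus at least \<open>\<epsilon>\<close> is at most a multiple of \<open>\<epsilon> powr (- \<sigma>)\<close>, hence they are absolutely summable.
  Once these are deflated the determinant has no zero of modulus less than \<open>1/\<epsilon>\<close>, and a Borel-Caratheodory estimate
  shows that the remaining trace tends to \<open>0\<close> with \<open>\<epsilon>\<close>.\<close>

section \<open>Perturbation bounds for finite determinants\<close>

text \<open>The Besov space is not a Hilbert space for p < 2, so Lidskii's theorem does not apply,
  and on a general Banach space the eigenvalues of a nuclear operator need only be square summable
  and the trace formula can fail. What saves it is that the column norms of A are summable to a
  power below 1: the determinant then has order below 1, and no exponential factor can separate its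
  zeros from its derivative at 0. Column sums keep all estimates in l1 geometry, where the Leibniz
  expansion is dominated by a product of column sums. Orders of zeros of D are never matched with
  multiplicities directly: removing one eigenvector changes the determinant by a linear factor and
  one generalised eigenspace by one dimension, and afterwards only the absence of zeros in a disc is
  used. Bounded sequences are a convenient common domain, since the Besov norm lies between the
  supremum norm and a weighted l1 norm of the Fourier coefficients.\<close>

definition minor_det :: "nat \<Rightarrow> (nat \<Rightarrow> nat \<Rightarrow> complex) \<Rightarrow> complex" where
  "minor_det N U = det (mat N N (\<lambda>(i, j). U i j))"

definition id_minus :: "(nat \<Rightarrow> nat \<Rightarrow> complex) \<Rightarrow> nat \<Rightarrow> nat \<Rightarrow> complex" where
  "id_minus K i j = (if i = j then 1 else 0) - K i j"

lemma permutes_less: "p permutes {0..<N} \<Longrightarrow> j < N \<Longrightarrow> p j < (N::nat)"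
  using permutes_in_image[of p "{0..<N}" j] by auto

text \<open>Injectivity forbids a permutation to move a single point. In a Leibniz sum every
  permutation but \<open>id\<close> therefore meets an off-diagonal entry outside a prescribed
  column \<open>k\<close>.\<close>

lemma permutes_moves_other:
  fixes N :: nat
  assumes "p permutes {0..<N}" "p \<noteq> id"
  shows "\<exists>j<N. j \<noteq> k \<and> p j \<noteq> j"
proof (rule ccontr)
  assume *: "\<not> ?thesis"
  then have "p j = j" if "j \<noteq> k" for j
    using assms that by (cases "j < N") (auto simp: permutes_def)
  moreover from this have "p k = k"
    using assms by (metis permutes_inj injD)
  ultimately have "p = id" by (metis eq_id_iff)
  then show False using assms by simp
qed

text \<open>The product runs over columns because all later estimates are in terms of column
  sums.\<close>

lemma minor_det_col:
  "minor_det N U = (\<Sum>p | p permutes {0..<N}. signof p * (\<Prod>j<N. U (p j) j))"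
proof -
  have "(\<Prod>j<N. mat N N (\<lambda>(i, j). U i j) $$ (p j, j)) = (\<Prod>j<N. U (p j) j)" if "p permutes {0..<N}" for p
    using that by (intro prod.cong) (auto simp: permutes_less)
  then show ?thesis
    unfolding minor_det_def by (subst det_col[where n = N]) auto
qed

lemma minor_det_mult:
  "minor_det N U * minor_det N V = minor_det N (\<lambda>i j. \<Sum>k<N. U i k * V k j)"
proof -
  have "mat N N (\<lambda>(i, j). U i j) * mat N N (\<lambda>(i, j). V i j)
      = mat N N (\<lambda>(i, j). \<Sum>k<N. U i k * V k j)"
    by (rule eq_matI) (auto simp: scalar_prod_def lessThan_atLeast0)
  then show ?thesis
    unfolding minor_det_def by (subst det_mult[symmetric, where n = N]) auto
qed

lemma minor_det_zero_kernel:
  assumes "minor_det N U = 0"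
  obtains w where "\<exists>i<N. w i \<noteq> 0" "\<And>i. i < N \<Longrightarrow> (\<Sum>j<N. U i j * w j) = 0"
proof -
  obtain v where v: "v \<in> carrier_vec N" "v \<noteq> 0\<^sub>v N"
    "mat N N (\<lambda>(i, j). U i j) *\<^sub>v v = 0\<^sub>v N"
    using assms unfolding minor_det_def by (subst (asm) det_0_iff_vec_prod_zero[where n = N]) auto
  have "\<exists>i<N. vec_index v i \<noteq> 0"
  proof (rule ccontr)
    assume "\<not> ?thesis"
    then have "v = 0\<^sub>v N" using v(1) by (intro eq_vecI) auto
    then show False using v(2) by simp
  qed
  moreover have "(\<Sum>j<N. U i j * vec_index v j) = 0" if "i < N" for i
  proof -
    have "vec_index (mat N N (\<lambda>(i, j). U i j) *\<^sub>v v) i = 0" using v(3) that by simp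
    then show ?thesis using that v(1) by (simp add: scalar_prod_def lessThan_atLeast0)
  qed
  ultimately show ?thesis using that by blast
qed

text \<open>A permutation that moves \<open>N\<close> meets an off-diagonal zero of the unit column
  \<open>N\<close>, so the expansion for \<open>Suc N\<close> collapses to that for
  \<open>N\<close>. The unit columns disappear one by one, whatever stands below row
  \<open>J\<close> in the others.\<close>

lemma minor_det_finite_columns:
  assumes "\<And>i j. J \<le> j \<Longrightarrow> U i j = (if i = j then 1 else 0)" and "J \<le> N"
  shows "minor_det N U = minor_det J U"
  using assms(2)
proof (induction N rule: dec_induct)
  case (step N)
  have "minor_det (Suc N) U = (\<Sum>p | p permutes {0..<N}. signof p * (\<Prod>j<Suc N. U (p j) j))"
    unfolding minor_det_col
  proof (rule sum.mono_neutral_right)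
    show "{p. p permutes {0..<N}} \<subseteq> {p. p permutes {0..<Suc N}}"
      by (auto intro: permutes_subset)
    show "\<forall>p\<in>{p. p permutes {0..<Suc N}} - {p. p permutes {0..<N}}.
        signof p * (\<Prod>j<Suc N. U (p j) j) = 0"
    proof
      fix p assume p: "p \<in> {p. p permutes {0..<Suc N}} - {p. p permutes {0..<N}}"
      then have "p N \<noteq> N"
        using permutes_superset[of p "{0..<Suc N}" "{0..<N}"] by (auto simp: less_Suc_eq)
      then have "U (p N) N = 0" using assms(1)[of N "p N"] step(1) by simp
      then show "signof p * (\<Prod>j<Suc N. U (p j) j) = 0" by simp
    qed
  qed (auto simp: finite_permutations)
  also have "\<dots> = minor_det N U"
    unfolding minor_det_col
  proof (rule sum.cong[OF refl])
    fix p assume "p \<in> {p. p permutes {0..<N}}"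
    then have "p N = N" by (auto simp: permutes_def)
    then show "signof p * (\<Prod>j<Suc N. U (p j) j) = signof p * (\<Prod>j<N. U (p j) j)"
      using assms(1)[of N N] step(1) by simp
  qed
  finally show ?case using step by simp
qed simp

lemma minor_det_id: "minor_det N (\<lambda>i j. if i = j then 1 else 0) = 1"
  using minor_det_finite_columns[of 0 "\<lambda>i j. if i = j then 1 else 0" N]
  by (simp add: minor_det_def)

text \<open>Only the identity avoids the zeros of the unit columns, by
  \<open>permutes_moves_other\<close>.\<close>

lemma minor_det_single_column:
  assumes "\<And>i j. j \<noteq> k \<Longrightarrow> U i j = (if i = j then 1 else 0)" and "k < N"
  shows "minor_det N U = U k k"
proof -
  have "minor_det N U = (\<Sum>p\<in>{id}. signof p * (\<Prod>j<N. U (p j) j))"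
    unfolding minor_det_col
  proof (rule sum.mono_neutral_right)
    show "\<forall>p\<in>{p. p permutes {0..<N}} - {id}. signof p * (\<Prod>j<N. U (p j) j) = 0"
    proof
      fix p assume p: "p \<in> {p. p permutes {0..<N}} - {id}"
      have "\<exists>j<N. j \<noteq> k \<and> p j \<noteq> j" using p by (intro permutes_moves_other) auto
      then obtain j where "j < N" "j \<noteq> k" "p j \<noteq> j" by auto
      then have "U (p j) j = 0" using assms(1)[of j "p j"] by simp
      then show "signof p * (\<Prod>j<N. U (p j) j) = 0"
        using \<open>j < N\<close> by (auto simp: prod_zero_iff)
    qed
  qed (auto simp: finite_permutations permutes_id)
  also have "\<dots> = (\<Prod>j<N. U j j)" by simp
  also have "\<dots> = (\<Prod>j\<in>{k}. U j j)"
    by (rule prod.mono_neutral_right) (use assms in auto)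
  finally show ?thesis by simp
qed

text \<open>Telescoping. The right-hand side is the expansion of the product of |y| + |x - y|
  without its difference-free term, a form that can be summed over all choice functions and
  factorised.\<close>

lemma prod_diff_le:
  fixes x y :: "'a \<Rightarrow> complex"
  assumes "finite A"
  shows "norm (prod x A - prod y A) \<le> (\<Prod>j\<in>A. norm (y j) + norm (x j - y j)) - (\<Prod>j\<in>A. norm (y j))"
  using assms
proof (induction A rule: finite_induct)
  case (insert a A)
  define P where "P = (\<Prod>j\<in>A. norm (y j) + norm (x j - y j))"
  define Q where "Q = (\<Prod>j\<in>A. norm (y j))"
  have "norm (prod x A) \<le> P"
    unfolding P_def prod_norm[symmetric] 
    by (rule prod_mono) (metis norm_ge_zero add.commute norm_triangle_sub)
  have "prod x (insert a A) - prod y (insert a A) = (x a - y a) * prod x A + y a * (prod x A - prod y A)"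
    using insert by (simp add: algebra_simps)
  also have "norm \<dots> \<le> norm (x a - y a) * P + norm (y a) * (P - Q)"
    using insert.IH \<open>norm (prod x A) \<le> P\<close>
    by (intro order.trans[OF norm_triangle_ineq] add_mono) (auto simp: norm_mult P_def Q_def intro!: mult_left_mono)
  also have "\<dots> = (norm (y a) + norm (x a - y a)) * P - norm (y a) * Q" by (simp add: algebra_simps)
  finally show ?case using insert by (simp add: P_def Q_def)
qed simp

text \<open>Expanded, the increment is a sum over nonempty subsets of products of \<open>d\<close>
  over the subset and \<open>s\<close> over its complement: a polynomial in \<open>s\<close> with
  nonnegative coefficients, hence monotone.\<close>

lemma prod_increment_mono:
  fixes s t d e :: "'a \<Rightarrow> real"
  assumes "finite A" "\<And>j. j \<in> A \<Longrightarrow> 0 \<le> s j \<and> s j \<le> t j \<and> 0 \<le> d j"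
  shows "(\<Prod>j\<in>A. s j + d j) - (\<Prod>j\<in>A. s j) \<le> (\<Prod>j\<in>A. t j + d j) - (\<Prod>j\<in>A. t j)"
  using assms
proof (induction A rule: finite_induct)
  case (insert a A)
  define P Q P' Q' where "P = (\<Prod>j\<in>A. s j + d j)" "Q = (\<Prod>j\<in>A. s j)"
    "P' = (\<Prod>j\<in>A. t j + d j)" "Q' = (\<Prod>j\<in>A. t j)"
  note defs = this
  have IH: "P - Q \<le> P' - Q'" using insert by (auto simp: defs)
  have "Q \<le> P" "0 \<le> Q" "Q \<le> Q'" using insert by (auto simp: defs intro!: prod_mono prod_nonneg)
  have a: "0 \<le> s a" "s a \<le> t a" "0 \<le> d a" using insert by auto
  have "(s a + d a) * P - s a * Q = (s a + d a) * (P - Q) + d a * Q" by (simp add: algebra_simps)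
  also have "\<dots> \<le> (t a + d a) * (P' - Q') + d a * Q'"
    using a IH \<open>Q \<le> P\<close> \<open>0 \<le> Q\<close> \<open>Q \<le> Q'\<close> by (intro add_mono mult_mono) auto
  also have "\<dots> = (t a + d a) * P' - t a * Q'" by (simp add: algebra_simps)
  finally show ?case using insert by (simp add: defs)
qed simp

text \<open>Restricted to \<open>{..<N}\<close>, the permutations are among all maps of that set to
  itself; the terms are nonnegative, and over all maps the sum of products is the product of the
  column sums. The factorially many permutations thus cost nothing, and a bound uniform in
  \<open>N\<close> becomes possible.\<close>

lemma norm_minor_det_diff:
  "norm (minor_det N U - minor_det N V) \<le>
     (\<Prod>j<N. (\<Sum>i<N. norm (V i j)) + (\<Sum>i<N. norm (U i j - V i j))) - (\<Prod>j<N. \<Sum>i<N. norm (V i j))"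
proof -
  let ?P = "{p. p permutes {0..<N}}" and ?F = "Pi\<^sub>E {..<N} (\<lambda>_. {..<N})"
  let ?g = "\<lambda>f. (\<Prod>j<N. norm (V (f j) j) + norm (U (f j) j - V (f j) j)) - (\<Prod>j<N. norm (V (f j) j))"
  have "norm (minor_det N U - minor_det N V) \<le> (\<Sum>p\<in>?P. ?g p)"
    unfolding minor_det_col sum_subtractf[symmetric]
  proof (rule sum_norm_le)
    fix p
    have "norm ((signof p :: complex) * (\<Prod>j<N. U (p j) j) - signof p * (\<Prod>j<N. V (p j) j))
        = norm ((\<Prod>j<N. U (p j) j) - (\<Prod>j<N. V (p j) j))"
      by (simp add: sign_def norm_minus_commute)
    then show "norm ((signof p :: complex) * (\<Prod>j<N. U (p j) j) - signof p * (\<Prod>j<N. V (p j) j)) \<le> ?g p"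
      using prod_diff_le[of "{..<N}" "\<lambda>j. U (p j) j" "\<lambda>j. V (p j) j"] by simp
  qed
  also have "\<dots> = (\<Sum>f\<in>(\<lambda>p. restrict p {..<N}) ` ?P. ?g f)"
  proof (subst sum.reindex)
    show "inj_on (\<lambda>p. restrict p {..<N}) ?P"
    proof (rule inj_onI)
      fix p q assume pq: "p \<in> ?P" "q \<in> ?P" "restrict p {..<N} = restrict q {..<N}"
      show "p = q"
      proof
        fix x show "p x = q x"
          using pq(1,2) fun_cong[OF pq(3), of x] by (cases "x < N") (auto simp: permutes_def restrict_def)
      qed
    qed
    show "sum ?g ?P = sum (?g \<circ> (\<lambda>p. restrict p {..<N})) ?P"
      by (rule sum.cong) auto
  qed
  also have "\<dots> \<le> (\<Sum>f\<in>?F. ?g f)"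
  proof (rule sum_mono2)
    show "finite ?F" by (simp add: finite_PiE)
    show "(\<lambda>p. restrict p {..<N}) ` ?P \<subseteq> ?F" by (auto simp: permutes_less split: if_splits)
    show "0 \<le> ?g f" for f by (auto intro!: prod_mono)
  qed
  also have "\<dots> = (\<Prod>j<N. (\<Sum>i<N. norm (V i j) + norm (U i j - V i j))) - (\<Prod>j<N. \<Sum>i<N. norm (V i j))"
    by (simp add: sum_subtractf prod_sum_PiE)
  finally show ?thesis by (simp add: sum.distrib)
qed

lemma prod_one_plus_le_exp:
  fixes c :: "'a \<Rightarrow> real"
  assumes "\<And>j. j \<in> A \<Longrightarrow> 0 \<le> c j"
  shows "(\<Prod>j\<in>A. 1 + c j) \<le> exp (sum c A)"
proof (cases "finite A")
  case True
  then show ?thesis unfolding exp_sum[OF True]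
    using assms by (intro prod_mono) (auto simp: add_nonneg_nonneg)
qed simp

text \<open>The bound involves only the total mass of \<open>L\<close> and of \<open>K - L\<close>,
  not \<open>N\<close>; this uniformity carries the determinant over to infinite matrices.\<close>

lemma norm_minor_det_id_minus_diff:
  fixes K L :: "nat \<Rightarrow> nat \<Rightarrow> complex"
  assumes L: "(\<Sum>j<N. \<Sum>i<N. norm (L i j)) \<le> l" and D: "(\<Sum>j<N. \<Sum>i<N. norm (K i j - L i j)) \<le> d"
  shows "norm (minor_det N (id_minus K) - minor_det N (id_minus L)) \<le> exp l * (exp d - 1)"
proof -
  define l' where "l' j = (\<Sum>i<N. norm (L i j))" for j
  define d' where "d' j = (\<Sum>i<N. norm (K i j - L i j))" for j
  have l0: "0 \<le> l' j" and d0: "0 \<le> d' j" for j by (auto simp: l'_def d'_def intro!: sum_nonneg)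
  have "norm (minor_det N (id_minus K) - minor_det N (id_minus L)) \<le>
      (\<Prod>j<N. (\<Sum>i<N. norm (id_minus L i j)) + d' j) - (\<Prod>j<N. \<Sum>i<N. norm (id_minus L i j))"
    using norm_minor_det_diff[of N "id_minus K" "id_minus L"]
    by (simp add: id_minus_def d'_def norm_minus_commute)
  also have "\<dots> \<le> (\<Prod>j<N. (1 + l' j) + d' j) - (\<Prod>j<N. 1 + l' j)"
  proof (rule prod_increment_mono)
    fix j assume j: "j \<in> {..<N}"
    have "(\<Sum>i<N. norm (id_minus L i j)) \<le> (\<Sum>i<N. norm ((if i = j then 1 else 0)::complex) + norm (L i j))"
      unfolding id_minus_def by (intro sum_mono norm_triangle_ineq4)
    also have "\<dots> = 1 + l' j" using j by (simp add: sum.distrib l'_def if_distrib[of norm] sum.delta cong: if_cong)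
    finally show "0 \<le> (\<Sum>i<N. norm (id_minus L i j)) \<and> (\<Sum>i<N. norm (id_minus L i j)) \<le> 1 + l' j \<and> 0 \<le> d' j"
      using d0 by (auto intro: sum_nonneg)
  qed simp
  \<comment> \<open>The larger product separates the unperturbed mass from the perturbation.\<close>
  also have "\<dots> \<le> (\<Prod>j<N. (1 + l' j) * (1 + d' j)) - (\<Prod>j<N. 1 + l' j)"
    using l0 d0 by (intro diff_right_mono prod_mono) (auto simp: algebra_simps add_nonneg_nonneg)
  also have "\<dots> = (\<Prod>j<N. 1 + l' j) * ((\<Prod>j<N. 1 + d' j) - 1)"
    unfolding prod.distrib by (simp only: right_diff_distrib mult_1_right)
  also have "\<dots> \<le> exp l * (exp d - 1)"
  proof (rule mult_mono)
    show "(\<Prod>j<N. 1 + l' j) \<le> exp l"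
      using prod_one_plus_le_exp[of "{..<N}" l'] l0 L unfolding l'_def by (meson exp_le_cancel_iff order.trans)
    show "(\<Prod>j<N. 1 + d' j) - 1 \<le> exp d - 1"
      using prod_one_plus_le_exp[of "{..<N}" d'] d0 D unfolding d'_def by (smt (verit, best) exp_le_cancel_iff)
    show "0 \<le> (\<Prod>j<N. 1 + d' j) - 1" using d0 by (simp add: prod_ge_1)
  qed simp
  finally show ?thesis .
qed

text \<open>Comparison with the zero matrix, whose determinant vanishes as soon as N > 0; the
  perturbation bound is then the product of the column sums. The empty determinant is 1 and has its
  own case.\<close>

lemma norm_minor_det_id_minus_le:
  assumes "\<And>j. j < N \<Longrightarrow> (\<Sum>i<N. norm (K i j)) \<le> c j"
  shows "norm (minor_det N (id_minus K)) \<le> (\<Prod>j<N. 1 + c j)"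
proof -
  define l' where "l' j = (\<Sum>i<N. norm (K i j))" for j
  have l0: "0 \<le> l' j" for j by (auto simp: l'_def intro!: sum_nonneg)
  have z: "minor_det N (\<lambda>i j. 0) \<noteq> 0 \<Longrightarrow> N = 0"
    unfolding minor_det_col by (cases N) auto
  show ?thesis
  proof (cases "N = 0")
    case True then show ?thesis by (simp add: minor_det_def)
  next
    case False
    then have "minor_det N (\<lambda>i j. 0) = 0" using z by blast
    then have "norm (minor_det N (id_minus K)) \<le> (\<Prod>j<N. (\<Sum>i<N. norm (id_minus K i j)))"
      using norm_minor_det_diff[of N "id_minus K" "\<lambda>i j. 0"] False by (simp add: power_0_left)
    also have "\<dots> \<le> (\<Prod>j<N. 1 + c j)"
    proof (rule prod_mono)
      fix j assume j: "j \<in> {..<N}"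
      have "(\<Sum>i<N. norm (id_minus K i j)) \<le> (\<Sum>i<N. norm ((if i = j then 1 else 0)::complex) + norm (K i j))"
        unfolding id_minus_def by (intro sum_mono norm_triangle_ineq4)
      also have "\<dots> = 1 + l' j" using j by (simp add: sum.distrib l'_def if_distrib[of norm] sum.delta cong: if_cong)
      finally show "0 \<le> (\<Sum>i<N. norm (id_minus K i j)) \<and> (\<Sum>i<N. norm (id_minus K i j)) \<le> 1 + c j"
        using assms[of j] j by (auto intro: sum_nonneg simp: l'_def)
    qed
    finally show ?thesis .
  qed
qed

text \<open>At z = 0 the undifferentiated columns are unit vectors, so by
  \<open>permutes_moves_other\<close> only the identity contributes to the derivative.\<close>

lemma minor_det_derivative_0:
  "((\<lambda>z. minor_det N (id_minus (\<lambda>i j. z * K i j))) has_field_derivative (- (\<Sum>i<N. K i i))) (at 0)"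
proof -
  have 1: "((\<lambda>z. \<Prod>j<N. id_minus (\<lambda>i j. z * K i j) (p j) j) has_field_derivative
       (\<Sum>k<N. - K (p k) k * (\<Prod>j\<in>{..<N} - {k}. if p j = j then 1 else 0))) (at 0)" for p
  proof -
    have "((\<lambda>z. \<Prod>j<N. id_minus (\<lambda>i j. z * K i j) (p j) j) has_field_derivative
       (\<Sum>k<N. - K (p k) k * (\<Prod>j\<in>{..<N} - {k}. id_minus (\<lambda>i j. 0 * K i j) (p j) j))) (at 0)"
      by (rule has_field_derivative_prod) (auto simp: id_minus_def intro!: derivative_eq_intros)
    then show ?thesis by (simp add: id_minus_def)
  qed
  have "((\<lambda>z. minor_det N (id_minus (\<lambda>i j. z * K i j))) has_field_derivative
     (\<Sum>p | p permutes {0..<N}. signof p * (\<Sum>k<N. - K (p k) k * (\<Prod>j\<in>{..<N} - {k}. if p j = j then 1 else 0)))) (at 0)"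
    unfolding minor_det_col by (intro DERIV_sum DERIV_cmult 1)
  also have "(\<Sum>p | p permutes {0..<N}. signof p * (\<Sum>k<N. - K (p k) k * (\<Prod>j\<in>{..<N} - {k}. if p j = j then 1 else 0)))
     = (\<Sum>p\<in>{id}. signof p * (\<Sum>k<N. - K (p k) k * (\<Prod>j\<in>{..<N} - {k}. if p j = j then 1 else 0)))"
  proof (rule sum.mono_neutral_right)
    show "\<forall>p\<in>{p. p permutes {0..<N}} - {id}.
        signof p * (\<Sum>k<N. - K (p k) k * (\<Prod>j\<in>{..<N} - {k}. if p j = j then 1 else 0)) = 0"
    proof
      fix p assume p: "p \<in> {p. p permutes {0..<N}} - {id}"
      have "(\<Prod>j\<in>{..<N} - {k}. if p j = j then 1 else 0) = (0::complex)" if "k < N" for k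
      proof -
        have "\<exists>j<N. j \<noteq> k \<and> p j \<noteq> j" using p by (intro permutes_moves_other) auto
        then show ?thesis by (auto simp: prod_zero_iff)
      qed
      then show "signof p * (\<Sum>k<N. - K (p k) k * (\<Prod>j\<in>{..<N} - {k}. if p j = j then 1 else 0)) = 0"
        by (simp add: sum.neutral)
    qed
  qed (auto simp: finite_permutations permutes_id)
  also have "\<dots> = - (\<Sum>i<N. K i i)" by (simp add: sum_negf)
  finally show ?thesis .
qed

section \<open>The Fredholm determinant of an absolutely summable matrix\<close>

lemma minor_det_cong:
  assumes "\<And>i j. i < N \<Longrightarrow> j < N \<Longrightarrow> U i j = V i j"
  shows "minor_det N U = minor_det N V"
  unfolding minor_det_def using assms by (intro arg_cong[where f = det] eq_matI) auto

text \<open>All moduli have a finite sum: these are the matrices of nuclear maps from c_0 to l1.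
  Summability of each column is stated separately since \<open>suminf\<close> tells nothing about a
  divergent series.\<close>

definition l1_matrix :: "(nat \<Rightarrow> nat \<Rightarrow> complex) \<Rightarrow> bool" where
  "l1_matrix K \<longleftrightarrow> (\<forall>j. summable (\<lambda>i. norm (K i j))) \<and> summable (\<lambda>j. \<Sum>i. norm (K i j))"

definition col_norm :: "(nat \<Rightarrow> nat \<Rightarrow> complex) \<Rightarrow> nat \<Rightarrow> real" where
  "col_norm K j = (\<Sum>i. norm (K i j))"

text \<open>Finite sections take the place of Fredholm's series of principal minors, so that
  algebraic identities such as the product rule can be taken over from finite determinants.\<close>

definition fredholm :: "(nat \<Rightarrow> nat \<Rightarrow> complex) \<Rightarrow> complex" where
  "fredholm K = lim (\<lambda>N. minor_det N (id_minus K))"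

lemma l1_matrix_altdef:
  "l1_matrix K \<longleftrightarrow> (\<forall>j. summable (\<lambda>i. norm (K i j))) \<and> summable (col_norm K)"
  by (simp add: l1_matrix_def col_norm_def[abs_def])

lemma col_norm_nonneg: "l1_matrix K \<Longrightarrow> 0 \<le> col_norm K j"
  unfolding col_norm_def l1_matrix_def by (intro suminf_nonneg) auto

lemma sum_le_col_norm: "l1_matrix K \<Longrightarrow> finite I \<Longrightarrow> (\<Sum>i\<in>I. norm (K i j)) \<le> col_norm K j"
  unfolding col_norm_def l1_matrix_def by (intro sum_le_suminf) auto

lemma norm_le_col_norm: "l1_matrix K \<Longrightarrow> norm (K i j) \<le> col_norm K j"
  using sum_le_col_norm[of K "{i}" j] by simp

lemma summable_col_norm: "l1_matrix K \<Longrightarrow> summable (col_norm K)"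
  by (simp add: l1_matrix_altdef)

lemma summable_row: "l1_matrix K \<Longrightarrow> summable (\<lambda>k. norm (K i k))"
  by (rule summable_comparison_test'[OF summable_col_norm]) (auto simp: norm_le_col_norm)

lemma col_norm_le_suminf: "l1_matrix K \<Longrightarrow> col_norm K j \<le> suminf (col_norm K)"
  using sum_le_suminf[of "col_norm K" "{j}"] by (simp add: summable_col_norm col_norm_nonneg)

lemma l1_matrix_cmult:
  assumes "l1_matrix K"
  shows "l1_matrix (\<lambda>i j. z * K i j)" and "col_norm (\<lambda>i j. z * K i j) = (\<lambda>j. norm z * col_norm K j)"
proof -
  have "summable (\<lambda>i. norm (K i j))" for j using assms by (simp add: l1_matrix_def)
  then show *: "col_norm (\<lambda>i j. z * K i j) = (\<lambda>j. norm z * col_norm K j)"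
    unfolding col_norm_def by (simp add: norm_mult suminf_mult)
  show "l1_matrix (\<lambda>i j. z * K i j)"
    unfolding l1_matrix_altdef * using assms
    by (auto simp: norm_mult l1_matrix_altdef intro!: summable_mult)
qed

text \<open>Deleting the columns from \<open>N\<close> on leaves the \<open>N\<close>-th section
  unchanged and, by \<open>minor_det_finite_columns\<close>, makes the \<open>N'\<close>-th section
  equal to it. What remains is a perturbation by the tail of the column norms.\<close>

lemma minor_det_tail:
  assumes K: "l1_matrix K" and "N \<le> N'"
  defines "M \<equiv> suminf (col_norm K)"
  shows "norm (minor_det N' (id_minus K) - minor_det N (id_minus K)) \<le> exp M * (exp (M - (\<Sum>j<N. col_norm K j)) - 1)"
proof -
  define L where "L i j = (if j < N then K i j else 0)" for i j
  have "minor_det N' (id_minus L) = minor_det N (id_minus L)"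
    using assms by (intro minor_det_finite_columns) (auto simp: L_def id_minus_def)
  also have "\<dots> = minor_det N (id_minus K)"
    by (rule minor_det_cong) (auto simp: L_def id_minus_def)
  finally have eq: "minor_det N' (id_minus L) = minor_det N (id_minus K)" .
  have sM: "sum (col_norm K) {..<n} \<le> M" for n
    unfolding M_def by (intro sum_le_suminf summable_col_norm K) (auto simp: col_norm_nonneg K)
  have "norm (minor_det N' (id_minus K) - minor_det N' (id_minus L)) \<le> exp M * (exp (M - (\<Sum>j<N. col_norm K j)) - 1)"
  proof (rule norm_minor_det_id_minus_diff)
    have "(\<Sum>j<N'. \<Sum>i<N'. norm (L i j)) \<le> (\<Sum>j<N'. col_norm K j)"
    proof (rule sum_mono)
      fix j
      have "(\<Sum>i<N'. norm (L i j)) \<le> (\<Sum>i<N'. norm (K i j))" by (intro sum_mono) (simp add: L_def)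
      also have "\<dots> \<le> col_norm K j" by (rule sum_le_col_norm[OF K]) simp
      finally show "(\<Sum>i<N'. norm (L i j)) \<le> col_norm K j" .
    qed
    also have "\<dots> \<le> M" by (rule sM)
    finally show "(\<Sum>j<N'. \<Sum>i<N'. norm (L i j)) \<le> M" .
    have "(\<Sum>j<N'. \<Sum>i<N'. norm (K i j - L i j)) \<le> (\<Sum>j<N'. if j < N then 0 else col_norm K j)"
      by (intro sum_mono) (auto simp: L_def intro: sum_le_col_norm[OF K])
    also have "\<dots> = (\<Sum>j\<in>{..<N'} - {..<N}. col_norm K j)"
      by (rule sum.mono_neutral_cong_right) auto
    also have "\<dots> = (\<Sum>j<N'. col_norm K j) - (\<Sum>j<N. col_norm K j)"
      using assms by (subst sum_diff) auto
    also have "\<dots> \<le> M - (\<Sum>j<N. col_norm K j)" using sM by simp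
    finally show "(\<Sum>j<N'. \<Sum>i<N'. norm (K i j - L i j)) \<le> M - (\<Sum>j<N. col_norm K j)" .
  qed
  then show ?thesis by (simp add: eq)
qed

lemma col_norm_tail_tendsto:
  assumes "l1_matrix K"
  shows "(\<lambda>N. suminf (col_norm K) - (\<Sum>j<N. col_norm K j)) \<longlonglongrightarrow> 0"
  using tendsto_diff[OF tendsto_const summable_LIMSEQ[OF summable_col_norm[OF assms]], of "suminf (col_norm K)"] by simp

lemma fredholm_LIMSEQ:
  assumes K: "l1_matrix K"
  shows "(\<lambda>N. minor_det N (id_minus K)) \<longlonglongrightarrow> fredholm K"
proof -
  define M where "M = suminf (col_norm K)"
  define r where "r N = exp M * (exp (M - (\<Sum>j<N. col_norm K j)) - 1)" for N
  have "r \<longlonglongrightarrow> exp M * (exp 0 - 1)"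
    unfolding r_def M_def by (intro tendsto_intros col_norm_tail_tendsto K)
  then have r0: "r \<longlonglongrightarrow> 0" by simp
  have "Cauchy (\<lambda>N. minor_det N (id_minus K))"
  proof (rule CauchyI')
    fix e :: real assume "0 < e"
    then obtain N0 where N0: "\<And>N. N \<ge> N0 \<Longrightarrow> norm (r N) < e"
      using r0 unfolding LIMSEQ_iff by auto
    show "\<exists>M. \<forall>m\<ge>M. \<forall>n>m. dist (minor_det m (id_minus K)) (minor_det n (id_minus K)) < e"
    proof (intro exI allI impI)
      fix m n assume "N0 \<le> m" "m < n"
      then show "dist (minor_det m (id_minus K)) (minor_det n (id_minus K)) < e"
        using minor_det_tail[OF K, of m n] N0[of m] unfolding r_def M_def
        by (simp add: dist_norm norm_minus_commute)
    qed
  qed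
  then show ?thesis
    unfolding fredholm_def by (simp add: Cauchy_convergent_iff convergent_LIMSEQ_iff)
qed

lemma norm_fredholm_minus_minor_det:
  assumes K: "l1_matrix K"
  defines "M \<equiv> suminf (col_norm K)"
  shows "norm (fredholm K - minor_det N (id_minus K)) \<le> exp M * (exp (M - (\<Sum>j<N. col_norm K j)) - 1)"
proof (rule tendsto_upperbound)
  show "(\<lambda>N'. norm (minor_det N' (id_minus K) - minor_det N (id_minus K))) \<longlonglongrightarrow> norm (fredholm K - minor_det N (id_minus K))"
    by (intro tendsto_intros fredholm_LIMSEQ K)
  show "\<forall>\<^sub>F N' in sequentially. norm (minor_det N' (id_minus K) - minor_det N (id_minus K)) \<le> exp M * (exp (M - (\<Sum>j<N. col_norm K j)) - 1)"
    unfolding M_def by (rule eventually_sequentiallyI[of N]) (rule minor_det_tail[OF K])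
qed simp

lemma fredholm_finite_columns:
  assumes "\<And>i j. J \<le> j \<Longrightarrow> K i j = 0"
  shows "fredholm K = minor_det J (id_minus K)"
proof -
  have "minor_det N (id_minus K) = minor_det J (id_minus K)" if "J \<le> N" for N
    using that by (intro minor_det_finite_columns) (simp_all add: id_minus_def assms)
  then have "(\<lambda>N. minor_det N (id_minus K)) \<longlonglongrightarrow> minor_det J (id_minus K)"
    by (intro tendsto_eventually eventually_sequentiallyI[of J])
  then show ?thesis unfolding fredholm_def by (rule limI)
qed

lemma fredholm_single_column:
  assumes "\<And>i j. j \<noteq> k \<Longrightarrow> K i j = 0"
  shows "fredholm K = 1 - K k k"
proof -
  have "fredholm K = minor_det (Suc k) (id_minus K)"
    by (rule fredholm_finite_columns) (simp add: assms)
  also have "\<dots> = id_minus K k k"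
    by (rule minor_det_single_column[of k]) (simp_all add: assms id_minus_def)
  finally show ?thesis by (simp add: id_minus_def)
qed

text \<open>The hypothesis says (I - K)(I - L) = I - H. The product of two sections is the section
  of the product up to the entries formed by the sum over k >= N of \<open>K i k * L k j\<close>;
  their total mass is at most the column tail of \<open>K\<close> times the mass of
  \<open>L\<close>, so it vanishes in the limit.\<close>

lemma fredholm_mult:
  assumes K: "l1_matrix K" and L: "l1_matrix L" and H: "l1_matrix H"
    and HKL: "\<And>i j. H i j = K i j + L i j - (\<Sum>k. K i k * L k j)"
  shows "fredholm K * fredholm L = fredholm H"
proof -
  define H' where "H' N i j = K i j + L i j - (\<Sum>k<N. K i k * L k j)" for N i j
  define nH where "nH = suminf (col_norm H)"
  define nL where "nL = suminf (col_norm L)"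
  define nK where "nK = suminf (col_norm K)"
  define r where "r N = exp nH * (exp ((nK - (\<Sum>j<N. col_norm K j)) * nL) - 1)" for N
  have "r \<longlonglongrightarrow> exp nH * (exp (0 * nL) - 1)"
    unfolding r_def nK_def by (intro tendsto_intros col_norm_tail_tendsto K)
  then have r0: "r \<longlonglongrightarrow> 0" by simp
  have prod: "minor_det N (id_minus K) * minor_det N (id_minus L) = minor_det N (id_minus (H' N))" for N
  proof -
    have "(\<Sum>k<N. id_minus K i k * id_minus L k j) = id_minus (H' N) i j" if ij: "i < N" "j < N" for i j
    proof -
      have "(\<Sum>k<N. id_minus K i k * id_minus L k j) = (\<Sum>k<N. (if k = i then (if i = j then 1 else 0) else 0)
         - (if k = i then L k j else 0) - (if k = j then K i k else 0) + K i k * L k j)"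
        by (rule sum.cong) (auto simp: id_minus_def algebra_simps)
      also have "\<dots> = id_minus (H' N) i j"
        using ij by (simp add: sum.distrib sum_subtractf id_minus_def H'_def)
      finally show ?thesis .
    qed
    then show ?thesis unfolding minor_det_mult by (intro minor_det_cong) auto
  qed
  have bound: "norm (minor_det N (id_minus (H' N)) - minor_det N (id_minus H)) \<le> r N" for N
    unfolding r_def
  proof (rule norm_minor_det_id_minus_diff)
    have "(\<Sum>j<N. \<Sum>i<N. norm (H i j)) \<le> (\<Sum>j<N. col_norm H j)"
      by (intro sum_mono sum_le_col_norm H) simp
    also have "\<dots> \<le> nH"
      unfolding nH_def by (intro sum_le_suminf summable_col_norm H) (auto simp: col_norm_nonneg H)
    finally show "(\<Sum>j<N. \<Sum>i<N. norm (H i j)) \<le> nH" .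
    define t where "t i = (\<Sum>k. norm (K i (k + N)))" for i
    have sK: "summable (\<lambda>k. norm (K i (k + N)))" for i
      using summable_row[OF K] by (subst summable_iff_shift)
    have diff: "norm (H' N i j - H i j) \<le> t i * col_norm L j" for i j
    proof -
      have s: "summable (\<lambda>k. norm (K i k * L k j))"
      proof (rule summable_comparison_test')
        show "summable (\<lambda>k. norm (K i k) * nL)" by (intro summable_mult2 summable_row K)
        show "norm (norm (K i k * L k j)) \<le> norm (K i k) * nL" for k
          using norm_le_col_norm[OF L, of k j] col_norm_le_suminf[OF L, of j]
          by (auto simp: norm_mult nL_def intro!: mult_left_mono)
      qed
      have "H' N i j - H i j = (\<Sum>k. K i (k + N) * L (k + N) j)"
        unfolding H'_def HKL using suminf_split_initial_segment[OF summable_norm_cancel[OF s], of N] by simp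
      also have "norm \<dots> \<le> (\<Sum>k. norm (K i (k + N) * L (k + N) j))"
        using s by (intro summable_norm) (subst summable_iff_shift[where f = "\<lambda>k. norm (K i k * L k j)"])
      also have "\<dots> \<le> (\<Sum>k. norm (K i (k + N)) * col_norm L j)"
        using s by (intro suminf_le summable_mult2 sK)
          (auto simp: norm_mult summable_iff_shift[where f = "\<lambda>k. norm (K i k) * norm (L k j)"] intro!: mult_left_mono norm_le_col_norm L)
      also have "\<dots> = t i * col_norm L j" unfolding t_def by (simp add: suminf_mult2[OF sK])
      finally show ?thesis .
    qed
    \<comment> \<open>After the sums are exchanged, the tails of the first \<open>N\<close> rows are
      part of the columns from \<open>N\<close> on.\<close>
    have tsum: "(\<Sum>i<N. t i) \<le> nK - (\<Sum>j<N. col_norm K j)"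
    proof -
      have "(\<Sum>i<N. t i) = (\<Sum>k. \<Sum>i<N. norm (K i (k + N)))"
        unfolding t_def by (rule suminf_sum[symmetric]) (rule sK)
      also have "\<dots> \<le> (\<Sum>k. col_norm K (k + N))"
        using summable_col_norm[OF K]
        by (intro suminf_le sum_le_col_norm K summable_sum sK) (auto simp: summable_iff_shift)
      also have "\<dots> = nK - (\<Sum>j<N. col_norm K j)"
        unfolding nK_def by (rule suminf_minus_initial_segment[OF summable_col_norm[OF K]])
      finally show ?thesis .
    qed
    have "(\<Sum>j<N. \<Sum>i<N. norm (H' N i j - H i j)) \<le> (\<Sum>j<N. \<Sum>i<N. t i * col_norm L j)"
      by (intro sum_mono diff)
    also have "\<dots> = (\<Sum>i<N. t i) * (\<Sum>j<N. col_norm L j)"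
      by (subst sum.swap) (simp add: sum_product)
    also have "\<dots> \<le> (nK - (\<Sum>j<N. col_norm K j)) * nL"
    proof (rule mult_mono[OF tsum])
      show "(\<Sum>j<N. col_norm L j) \<le> nL"
        unfolding nL_def by (intro sum_le_suminf summable_col_norm L) (auto simp: col_norm_nonneg L)
      have "0 \<le> (\<Sum>i<N. t i)" unfolding t_def by (intro sum_nonneg suminf_nonneg sK) auto
      then show "0 \<le> nK - (\<Sum>j<N. col_norm K j)" using tsum by simp
      show "0 \<le> (\<Sum>j<N. col_norm L j)" by (intro sum_nonneg col_norm_nonneg L)
    qed
    finally show "(\<Sum>j<N. \<Sum>i<N. norm (H' N i j - H i j)) \<le> (nK - (\<Sum>j<N. col_norm K j)) * nL" .
  qed
  have "(\<lambda>N. minor_det N (id_minus (H' N)) - minor_det N (id_minus H)) \<longlonglongrightarrow> 0"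
    by (rule Lim_null_comparison[OF _ r0]) (auto intro: always_eventually bound)
  from tendsto_add[OF this fredholm_LIMSEQ[OF H]]
  have "(\<lambda>N. minor_det N (id_minus K) * minor_det N (id_minus L)) \<longlonglongrightarrow> fredholm H"
    by (simp add: prod)
  moreover have "(\<lambda>N. minor_det N (id_minus K) * minor_det N (id_minus L)) \<longlonglongrightarrow> fredholm K * fredholm L"
    by (intro tendsto_mult fredholm_LIMSEQ K L)
  ultimately show ?thesis by (rule LIMSEQ_unique[symmetric])
qed

section \<open>Growth and holomorphy of the Fredholm determinant\<close>

text \<open>After taking logarithms this is (1 + x)^s <= 1 + x^s <= exp (x^s). It trades summability
  of the column norms to the power s for growth of order s.\<close>

lemma one_plus_le_exp_powr:
  fixes x s :: real
  assumes "0 \<le> x" "0 < s" "s \<le> 1"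
  shows "1 + x \<le> exp (x powr s / s)"
proof -
  have p: "t \<le> t powr s" if "0 \<le> t" "t \<le> 1" for t
    using powr_mono'[of s 1 t] that assms by simp
  \<comment> \<open>Both fractions lie in [0, 1], where t <= t^s; multiplying by (1 + x)^s gives the
    subadditivity of the power.\<close>
  have "1 = 1 / (1 + x) + x / (1 + x)" using assms by (simp add: field_simps)
  also have "\<dots> \<le> (1 / (1 + x)) powr s + (x / (1 + x)) powr s"
    using assms by (intro add_mono p) auto
  also have "\<dots> = (1 + x powr s) / (1 + x) powr s" using assms by (simp add: powr_divide add_divide_distrib)
  finally have "(1 + x) powr s \<le> 1 + x powr s" using assms by (simp add: field_simps)
  also have "\<dots> \<le> exp (x powr s)" by (rule exp_ge_add_one_self)
  finally have "s * ln (1 + x) \<le> x powr s"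
    using assms by (simp add: powr_def)
  then have "ln (1 + x) \<le> x powr s / s" using assms by (simp add: field_simps)
  then have "exp (ln (1 + x)) \<le> exp (x powr s / s)" by simp
  then show ?thesis using assms by simp
qed

lemma norm_fredholm_cmult_le:
  assumes K: "l1_matrix K" and s: "0 < s" "s \<le> 1" and sum: "summable (\<lambda>j. col_norm K j powr s)"
  shows "norm (fredholm (\<lambda>i j. z * K i j)) \<le> exp (norm z powr s * ((\<Sum>j. col_norm K j powr s) / s))"
proof (rule tendsto_upperbound)
  note zK = l1_matrix_cmult[OF K, of z]
  show "(\<lambda>N. norm (minor_det N (id_minus (\<lambda>i j. z * K i j)))) \<longlonglongrightarrow> norm (fredholm (\<lambda>i j. z * K i j))"
    by (intro tendsto_intros fredholm_LIMSEQ zK)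
  show "\<forall>\<^sub>F N in sequentially. norm (minor_det N (id_minus (\<lambda>i j. z * K i j))) \<le> exp (norm z powr s * ((\<Sum>j. col_norm K j powr s) / s))"
  proof (rule always_eventually, rule allI)
    fix N
    have "norm (minor_det N (id_minus (\<lambda>i j. z * K i j))) \<le> (\<Prod>j<N. 1 + norm z * col_norm K j)"
      using sum_le_col_norm[OF zK(1)] zK(2) by (intro norm_minor_det_id_minus_le) auto
    also have "\<dots> \<le> (\<Prod>j<N. exp ((norm z * col_norm K j) powr s / s))"
      using s col_norm_nonneg[OF K] by (intro prod_mono conjI one_plus_le_exp_powr) auto
    also have "\<dots> = exp (norm z powr s * ((\<Sum>j<N. col_norm K j powr s) / s))"
      using col_norm_nonneg[OF K]
      by (simp add: exp_sum[symmetric] powr_mult sum_distrib_left sum_divide_distrib)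
    also have "\<dots> \<le> exp (norm z powr s * ((\<Sum>j. col_norm K j powr s) / s))"
      using s sum by (simp add: divide_right_mono mult_left_mono sum_le_suminf)
    finally show "norm (minor_det N (id_minus (\<lambda>i j. z * K i j))) \<le> exp (norm z powr s * ((\<Sum>j. col_norm K j powr s) / s))" .
  qed
qed simp

text \<open>The sections are polynomials in \<open>z\<close> that converge uniformly on discs, since
  the tail bound depends only on |z|. By Weierstrass the limit is entire and the derivatives
  converge too, so the derivative at 0 is minus the limit of the truncated traces.\<close>

lemma fredholm_cmult_has_derivative:
  assumes K: "l1_matrix K"
  shows "(\<lambda>z. fredholm (\<lambda>i j. z * K i j)) holomorphic_on UNIV"
    and "((\<lambda>z. fredholm (\<lambda>i j. z * K i j)) has_field_derivative - (\<Sum>i. K i i)) (at 0)"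
proof -
  define f where "f N z = minor_det N (id_minus (\<lambda>i j. z * K i j))" for N z
  define g where "g z = fredholm (\<lambda>i j. z * K i j)" for z
  have hol: "f N holomorphic_on UNIV" for N
    unfolding f_def minor_det_col id_minus_def by (intro holomorphic_intros)
  have der: "(f N has_field_derivative deriv (f N) x) (at x)" for N x
    using hol[of N] by (simp add: holomorphic_derivI)
  have ulim: "\<exists>d>0. cball x d \<subseteq> UNIV \<and> uniform_limit (cball x d) f g sequentially" for x
  proof (intro exI conjI)
    define R where "R = norm x + 1"
    define M where "M = suminf (col_norm K)"
    define r where "r N = exp (R * M) * (exp (R * (M - (\<Sum>j<N. col_norm K j))) - 1)" for N
    have "r \<longlonglongrightarrow> exp (R * M) * (exp (R * 0) - 1)"
      unfolding r_def M_def by (intro tendsto_intros col_norm_tail_tendsto K)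
    then have r0: "r \<longlonglongrightarrow> 0" by simp
    have b: "dist (f N z) (g z) \<le> r N" if "z \<in> cball x 1" for z N
    proof -
      note zK = l1_matrix_cmult[OF K, of z]
      have "norm z \<le> R" using that norm_triangle_sub[of z x] by (simp add: R_def dist_norm norm_minus_commute)
      have M0: "0 \<le> M" "0 \<le> M - (\<Sum>j<N. col_norm K j)"
        unfolding M_def using summable_col_norm[OF K] col_norm_nonneg[OF K]
        by (auto intro!: suminf_nonneg sum_le_suminf)
      have "dist (f N z) (g z) \<le> exp (norm z * M) * (exp (norm z * M - norm z * (\<Sum>j<N. col_norm K j)) - 1)"
        using norm_fredholm_minus_minor_det[OF zK(1), of N] summable_col_norm[OF K]
        by (simp add: f_def g_def dist_norm norm_minus_commute zK(2) suminf_mult M_def sum_distrib_left)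
      also have "\<dots> = exp (norm z * M) * (exp (norm z * (M - (\<Sum>j<N. col_norm K j))) - 1)"
        by (simp add: algebra_simps)
      also have "\<dots> \<le> r N"
        unfolding r_def using M0 \<open>norm z \<le> R\<close> by (intro mult_mono) (auto intro: mult_right_mono)
      finally show ?thesis .
    qed
    show "uniform_limit (cball x 1) f g sequentially"
      unfolding uniform_limit_iff
    proof (intro allI impI)
      fix e :: real assume "0 < e"
      with r0 have "\<forall>\<^sub>F N in sequentially. r N < e" by (simp add: order_tendstoD)
      then show "\<forall>\<^sub>F N in sequentially. \<forall>z\<in>cball x 1. dist (f N z) (g z) < e"
        proof (rule eventually_mono)
        fix N assume "r N < e"
        then show "\<forall>z\<in>cball x 1. dist (f N z) (g z) < e"
          using order.strict_trans1[OF b] by blast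
      qed
    qed
  qed auto
  have "\<exists>g'. \<forall>x\<in>UNIV. (g has_field_derivative g' x) (at x) \<and> (\<lambda>N. deriv (f N) x) \<longlonglongrightarrow> g' x"
    by (rule has_complex_derivative_uniform_sequence[OF open_UNIV]) (rule der, rule ulim)
  then obtain g' where "\<forall>x\<in>UNIV. (g has_field_derivative g' x) (at x) \<and> (\<lambda>N. deriv (f N) x) \<longlonglongrightarrow> g' x" ..
  then have g': "\<And>x. (g has_field_derivative g' x) (at x)" "\<And>x. (\<lambda>N. deriv (f N) x) \<longlonglongrightarrow> g' x"
    by auto
  show "(\<lambda>z. fredholm (\<lambda>i j. z * K i j)) holomorphic_on UNIV"
    using g'(1) unfolding g_def[abs_def] by (auto simp: holomorphic_on_def field_differentiable_def)
  have "deriv (f N) 0 = - (\<Sum>i<N. K i i)" for N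
    unfolding f_def[abs_def] by (rule DERIV_imp_deriv[OF minor_det_derivative_0])
  then have "(\<lambda>N. - (\<Sum>i<N. K i i)) \<longlonglongrightarrow> g' 0" using g'(2)[of 0] by simp
  moreover have "summable (\<lambda>i. K i i)"
    by (rule summable_comparison_test'[OF summable_col_norm[OF K]]) (rule norm_le_col_norm[OF K])
  then have "(\<lambda>N. - (\<Sum>i<N. K i i)) \<longlonglongrightarrow> - (\<Sum>i. K i i)"
    by (intro tendsto_intros summable_LIMSEQ)
  ultimately have "g' 0 = - (\<Sum>i. K i i)" by (rule LIMSEQ_unique)
  then show "((\<lambda>z. fredholm (\<lambda>i j. z * K i j)) has_field_derivative - (\<Sum>i. K i i)) (at 0)"
    using g'(1)[of 0] unfolding g_def[abs_def] by simp
qed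

section \<open>Kernel vectors and deflation\<close>

text \<open>Coefficient sequences of Besov functions are bounded, and an \<open>l1_matrix\<close>
  maps bounded sequences to summable ones. On this domain the spectral theory makes no reference to
  the Besov norm.\<close>

definition bounded_seqs :: "(nat \<Rightarrow> complex) set" where
  "bounded_seqs = {v. \<exists>C. \<forall>i. norm (v i) \<le> C}"

definition mat_app :: "(nat \<Rightarrow> nat \<Rightarrow> complex) \<Rightarrow> (nat \<Rightarrow> complex) \<Rightarrow> nat \<Rightarrow> complex" where
  "mat_app K v i = (\<Sum>k. K i k * v k)"

lemma bounded_seqsE:
  assumes "v \<in> bounded_seqs"
  obtains C where "0 \<le> C" "\<And>i. norm (v i) \<le> C"
proof -
  obtain C where "\<And>i. norm (v i) \<le> C" using assms by (auto simp: bounded_seqs_def)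
  moreover from this[of 0] have "0 \<le> C" using norm_ge_zero order.trans by blast
  ultimately show ?thesis using that by blast
qed

lemma bounded_seqsI: "(\<And>i. norm (v i) \<le> C) \<Longrightarrow> v \<in> bounded_seqs"
  by (auto simp: bounded_seqs_def)

lemma bounded_seqs_lincomb:
  assumes "u \<in> bounded_seqs" "v \<in> bounded_seqs"
  shows "(\<lambda>i. b * u i + c * v i) \<in> bounded_seqs"
proof -
  obtain C D where "\<And>i. norm (u i) \<le> C" "\<And>i. norm (v i) \<le> D"
    using assms by (auto simp: bounded_seqs_def)
  then have "norm (b * u i + c * v i) \<le> norm b * C + norm c * D" for i
    by (intro order.trans[OF norm_triangle_ineq] add_mono) (auto simp: norm_mult intro!: mult_left_mono)
  then show ?thesis by (rule bounded_seqsI)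
qed

lemma bounded_seqs_cmult: "v \<in> bounded_seqs \<Longrightarrow> (\<lambda>i. c * v i) \<in> bounded_seqs"
  using bounded_seqs_lincomb[of v v 0 c] by simp

lemma bounded_seqs_sum:
  "(\<And>j. j \<in> J \<Longrightarrow> f j \<in> bounded_seqs) \<Longrightarrow> (\<lambda>i. \<Sum>j\<in>J. c j * f j i) \<in> bounded_seqs"
proof (induction J rule: infinite_finite_induct)
  case (insert j J)
  then show ?case using bounded_seqs_lincomb[of "f j" "\<lambda>i. \<Sum>j\<in>J. c j * f j i" "c j" 1] by simp
qed (auto intro: bounded_seqsI)

lemma summable_mat_app:
  assumes K: "l1_matrix K" and "v \<in> bounded_seqs"
  shows "summable (\<lambda>k. norm (K i k * v k))"
proof -
  obtain C where C: "\<And>i. norm (v i) \<le> C" using assms(2) by (rule bounded_seqsE) auto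
  show ?thesis
  proof (rule summable_comparison_test')
    show "summable (\<lambda>k. norm (K i k) * C)" by (intro summable_mult2 summable_row K)
  qed (auto simp: norm_mult intro!: mult_left_mono C)
qed

lemma mat_app_lincomb:
  assumes "l1_matrix K" "u \<in> bounded_seqs" "v \<in> bounded_seqs"
  shows "mat_app K (\<lambda>i. b * u i + c * v i) = (\<lambda>i. b * mat_app K u i + c * mat_app K v i)"
proof
  fix i
  have "mat_app K (\<lambda>i. b * u i + c * v i) i = (\<Sum>k. b * (K i k * u k) + c * (K i k * v k))"
    unfolding mat_app_def by (simp add: algebra_simps)
  also have "\<dots> = b * mat_app K u i + c * mat_app K v i"
    unfolding mat_app_def using assms
    by (subst suminf_add[symmetric]) (auto simp: suminf_mult summable_norm_cancel summable_mat_app intro!: summable_mult)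
  finally show "mat_app K (\<lambda>i. b * u i + c * v i) i = b * mat_app K u i + c * mat_app K v i" .
qed

lemma mat_app_sum:
  assumes K: "l1_matrix K" and "\<And>j. j \<in> J \<Longrightarrow> f j \<in> bounded_seqs"
  shows "mat_app K (\<lambda>i. \<Sum>j\<in>J. c j * f j i) = (\<lambda>i. \<Sum>j\<in>J. c j * mat_app K (f j) i)"
  using assms(2)
proof (induction J rule: infinite_finite_induct)
  case (insert j J)
  then show ?case
    using mat_app_lincomb[OF K, of "f j" "\<lambda>i. \<Sum>j\<in>J. c j * f j i" "c j" 1] bounded_seqs_sum[of J f c] by simp
qed (auto simp: mat_app_def)

text \<open>One estimate, uniform in \<open>n\<close>: a single term gives the supremum bound, and
  letting \<open>n\<close> grow gives summability of the image.\<close>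

lemma norm_mat_app_sum_le:
  assumes K: "l1_matrix K" and C: "\<And>i. norm (v i) \<le> C"
  shows "(\<Sum>i<n. norm (mat_app K v i)) \<le> C * suminf (col_norm K)"
proof -
  have v: "v \<in> bounded_seqs" using C by (rule bounded_seqsI)
  have C0: "0 \<le> C" using C[of 0] norm_ge_zero order.trans by blast
  have "(\<Sum>i<n. norm (mat_app K v i)) \<le> (\<Sum>i<n. \<Sum>k. norm (K i k * v k))"
    unfolding mat_app_def by (intro sum_mono summable_norm summable_mat_app K v)
  also have "\<dots> = (\<Sum>k. \<Sum>i<n. norm (K i k * v k))"
    by (rule suminf_sum[symmetric]) (intro summable_mat_app K v)
  also have "\<dots> \<le> (\<Sum>k. C * col_norm K k)"
  proof (rule suminf_le)
    fix k
    have "(\<Sum>i<n. norm (K i k * v k)) \<le> (\<Sum>i<n. C * norm (K i k))"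
      using C by (intro sum_mono) (auto simp: norm_mult mult.commute intro!: mult_right_mono)
    also have "\<dots> \<le> C * col_norm K k"
      unfolding sum_distrib_left[symmetric] by (intro mult_left_mono sum_le_col_norm K C0) simp
    finally show "(\<Sum>i<n. norm (K i k * v k)) \<le> C * col_norm K k" .
    show "summable (\<lambda>k. \<Sum>i<n. norm (K i k * v k))" by (intro summable_sum summable_mat_app K v)
    show "summable (\<lambda>k. C * col_norm K k)" by (intro summable_mult summable_col_norm K)
  qed
  also have "\<dots> = C * suminf (col_norm K)" by (rule suminf_mult[OF summable_col_norm[OF K]])
  finally show ?thesis .
qed

lemma norm_mat_app_le:
  assumes K: "l1_matrix K" and C: "\<And>i. norm (v i) \<le> C"
  shows "norm (mat_app K v i) \<le> C * suminf (col_norm K)"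
proof -
  have "norm (mat_app K v i) \<le> (\<Sum>i<Suc i. norm (mat_app K v i))" by (simp add: sum_nonneg)
  also have "\<dots> \<le> C * suminf (col_norm K)" using assms by (rule norm_mat_app_sum_le)
  finally show ?thesis .
qed

lemma mat_app_bounded: "l1_matrix K \<Longrightarrow> v \<in> bounded_seqs \<Longrightarrow> mat_app K v \<in> bounded_seqs"
  by (elim bounded_seqsE) (metis bounded_seqsI norm_mat_app_le)

lemma mat_app_summable:
  assumes "l1_matrix K" "v \<in> bounded_seqs"
  shows "summable (\<lambda>i. norm (mat_app K v i))"
proof -
  obtain C where C: "\<And>i. norm (v i) \<le> C" using assms(2) by (rule bounded_seqsE) auto
  show ?thesis by (rule summableI_nonneg_bounded) (rule norm_ge_zero, rule norm_mat_app_sum_le[OF assms(1) C])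
qed

text \<open>The operator norm on bounded sequences is at most the sum of the column norms, so the
  Neumann series converges geometrically.\<close>

lemma neumann_solution:
  assumes T: "l1_matrix T" and small: "suminf (col_norm T) < 1" and b: "b \<in> bounded_seqs"
  obtains r where "r \<in> bounded_seqs" "\<And>i. r i = b i + mat_app T r i"
proof -
  define c where "c = suminf (col_norm T)"
  have c: "0 \<le> c" "c < 1"
    using small unfolding c_def by (auto intro!: suminf_nonneg summable_col_norm T simp: col_norm_nonneg T)
  obtain C where C: "0 \<le> C" "\<And>i. norm (b i) \<le> C" using bounded_seqsE[OF b] by metis
  define d where "d n = (mat_app T ^^ n) b" for n
  have d_le: "norm (d n i) \<le> C * c ^ n" for n i
  proof (induction n arbitrary: i)
    case (Suc n)
    have "norm (mat_app T (d n) i) \<le> C * c ^ n * suminf (col_norm T)"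
      by (rule norm_mat_app_le[OF T Suc.IH])
    then show ?case by (simp add: d_def c_def mult_ac)
  qed (simp add: d_def C)
  have d_bd: "d n \<in> bounded_seqs" for n using d_le by (rule bounded_seqsI)
  have geo: "summable (\<lambda>n. C * c ^ n)" using c by (intro summable_mult summable_geometric) simp
  have d_sum: "summable (\<lambda>n. norm (d n i))" for i
    by (rule summable_comparison_test'[OF geo]) (use d_le in simp)
  define r where "r i = (\<Sum>n. d n i)" for i
  define R where "R n i = (\<Sum>m<n. 1 * d m i)" for n i
  have R_bd: "R n \<in> bounded_seqs" for n unfolding R_def[abs_def] by (rule bounded_seqs_sum) (rule d_bd)
  have rR: "norm (r i - R n i) \<le> C * c ^ n / (1 - c)" for n i
  proof -
    have "r i - R n i = (\<Sum>m. d (m + n) i)"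
      unfolding r_def R_def using suminf_split_initial_segment[OF summable_norm_cancel[OF d_sum], of i n] by simp
    also have "norm \<dots> \<le> (\<Sum>m. norm (d (m + n) i))"
      by (rule summable_norm) (subst summable_iff_shift[where f = "\<lambda>m. norm (d m i)"], rule d_sum)
    also have "\<dots> \<le> (\<Sum>m. (C * c ^ n) * c ^ m)"
    proof (rule suminf_le)
      show "norm (d (m + n) i) \<le> C * c ^ n * c ^ m" for m using d_le[of "m + n" i] by (simp add: power_add mult_ac)
      show "summable (\<lambda>m. norm (d (m + n) i))"
        by (subst summable_iff_shift[where f = "\<lambda>m. norm (d m i)"], rule d_sum)
      show "summable (\<lambda>m. C * c ^ n * c ^ m)" using c by (intro summable_mult summable_geometric) simp
    qed
    also have "\<dots> = C * c ^ n / (1 - c)"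
      using c by (subst suminf_mult) (auto simp: suminf_geometric intro!: summable_geometric)
    finally show ?thesis .
  qed
  have r_bd: "r \<in> bounded_seqs" using rR[of _ 0] by (intro bounded_seqsI) (auto simp: R_def)
  have R_step: "R (Suc n) i = b i + mat_app T (R n) i" for n i
    unfolding R_def[abs_def]
    by (subst mat_app_sum[OF T]) (simp_all only: d_bd sum.lessThan_Suc_shift, simp add: d_def)
  have "r i = b i + mat_app T r i" for i
  proof -
    have "norm (r i - (b i + mat_app T r i)) \<le> C * c ^ n / (1 - c) * (1 + c)" for n
    proof -
      \<comment> \<open>Passage to the limit under \<open>mat_app\<close>: the defect of
        \<open>r\<close> is expressed by the errors of two successive partial sums, both
        geometrically small in \<open>n\<close>.\<close>
      have "r i - (b i + mat_app T r i) = (r i - R (Suc n) i) - mat_app T (\<lambda>k. 1 * r k + (-1) * R n k) i"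
        by (simp only: mat_app_lincomb[OF T r_bd R_bd] R_step) simp
      also have "norm \<dots> \<le> norm (r i - R (Suc n) i) + norm (mat_app T (\<lambda>k. 1 * r k + (-1) * R n k) i)"
        by (rule norm_triangle_ineq4)
      also have "\<dots> \<le> C * c ^ n / (1 - c) + C * c ^ n / (1 - c) * suminf (col_norm T)"
      proof (rule add_mono)
        have "C * c ^ Suc n / (1 - c) \<le> C * c ^ n / (1 - c)"
          using c C by (intro divide_right_mono mult_left_mono power_decreasing) auto
        then show "norm (r i - R (Suc n) i) \<le> C * c ^ n / (1 - c)" using rR[of i "Suc n"] by simp
        show "norm (mat_app T (\<lambda>k. 1 * r k + (-1) * R n k) i) \<le> C * c ^ n / (1 - c) * suminf (col_norm T)"
          by (rule norm_mat_app_le[OF T]) (use rR in simp)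
      qed
      finally show ?thesis unfolding c_def[symmetric] by (simp only: distrib_left mult_1_right)
    qed
    moreover have "(\<lambda>n. C * c ^ n / (1 - c) * (1 + c)) \<longlonglongrightarrow> C * 0 / (1 - c) * (1 + c)"
      using c by (intro tendsto_intros LIMSEQ_realpow_zero) auto
    ultimately have "norm (r i - (b i + mat_app T r i)) \<le> 0"
      by (intro LIMSEQ_le_const) auto
    then show ?thesis by simp
  qed
  then show ?thesis using that r_bd by blast
qed

text \<open>The tail columns of \<open>B\<close> are inverted by a Neumann series, which leaves the determinant of a
  matrix with finitely many nonzero columns.\<close>
lemma fredholm_zero_imp_fixed_point:
  assumes B: "l1_matrix B" and zero: "fredholm B = 0"
  obtains v where "v \<in> bounded_seqs" "v \<noteq> (\<lambda>_. 0)" "mat_app B v = v"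
proof -
  have "\<forall>\<^sub>F J in sequentially. suminf (col_norm B) - (\<Sum>j<J. col_norm B j) < 1/2"
    using col_norm_tail_tendsto[OF B] by (rule order_tendstoD) simp
  \<comment> \<open>The threshold 1/2 serves twice: it is below 1 for the Neumann series, and exp
    (1/2) < 2 keeps the determinant of I - T away from 0.\<close>
  then obtain J where J: "suminf (col_norm B) - (\<Sum>j<J. col_norm B j) < 1/2"
    by (auto simp: eventually_sequentially)
  define T where "T i j = (if j < J then 0 else B i j)" for i j
  have cT: "col_norm T j = (if j < J then 0 else col_norm B j)" for j
    by (simp add: col_norm_def T_def)
  have T: "l1_matrix T"
    unfolding l1_matrix_altdef
  proof
    show "\<forall>j. summable (\<lambda>i. norm (T i j))"
    proof
      fix j show "summable (\<lambda>i. norm (T i j))"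
        using B by (cases "j < J") (simp_all add: T_def l1_matrix_def)
    qed
    show "summable (col_norm T)"
      by (rule summable_comparison_test'[OF summable_col_norm[OF B]]) (auto simp: cT col_norm_nonneg[OF B])
  qed
  have "suminf (col_norm T) = (\<Sum>j. col_norm T (j + J)) + (\<Sum>j<J. col_norm T j)"
    by (rule suminf_split_initial_segment[OF summable_col_norm[OF T]])
  also have "\<dots> = (\<Sum>j. col_norm B (j + J))" by (simp add: cT)
  also have "\<dots> = suminf (col_norm B) - (\<Sum>j<J. col_norm B j)"
    by (rule suminf_minus_initial_segment[OF summable_col_norm[OF B]])
  finally have small: "suminf (col_norm T) < 1/2" using J by simp
  then have small1: "suminf (col_norm T) < 1" by simp
  have fT: "fredholm T \<noteq> 0"
  proof
    assume "fredholm T = 0"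
    have "norm (fredholm T - 1) \<le> exp 0 * (exp (1/2) - 1)"
    proof (rule tendsto_upperbound)
      show "(\<lambda>N. norm (minor_det N (id_minus T) - 1)) \<longlonglongrightarrow> norm (fredholm T - 1)"
        by (intro tendsto_intros fredholm_LIMSEQ T)
      show "\<forall>\<^sub>F N in sequentially. norm (minor_det N (id_minus T) - 1) \<le> exp 0 * (exp (1/2) - 1)"
      proof (rule always_eventually, rule allI)
        fix N
        have "norm (minor_det N (id_minus T) - minor_det N (id_minus (\<lambda>i j. 0))) \<le> exp 0 * (exp (1/2) - 1)"
        proof (rule norm_minor_det_id_minus_diff)
          have "(\<Sum>j<N. \<Sum>i<N. norm (T i j)) \<le> (\<Sum>j<N. col_norm T j)"
            by (intro sum_mono sum_le_col_norm T) simp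
          also have "\<dots> \<le> suminf (col_norm T)"
            by (intro sum_le_suminf summable_col_norm T) (auto simp: col_norm_nonneg T)
          finally show "(\<Sum>j<N. \<Sum>i<N. norm (T i j - 0)) \<le> 1/2" using small by simp
        qed simp
        then show "norm (minor_det N (id_minus T) - 1) \<le> exp 0 * (exp (1/2) - 1)"
          using minor_det_id[of N] by (simp add: id_minus_def[abs_def])
      qed
    qed simp
    \<comment> \<open>A zero would force 1 <= exp (1/2) - 1, hence 4 <= e.\<close>
    then have "(2::real) \<le> exp (1/2)" using \<open>fredholm T = 0\<close> by simp
    then have "(2::real) ^ 2 \<le> exp (1/2) ^ 2" by (intro power_mono) auto
    also have "(exp (1/2) ^ 2 :: real) = exp 1" by (simp add: exp_of_nat_mult[symmetric])
    finally show False using exp_le by simp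
  qed
  have "\<exists>r. r \<in> bounded_seqs \<and> (\<forall>i. r i = B i j + mat_app T r i)" for j
  proof -
    have "(\<lambda>i. B i j) \<in> bounded_seqs" using norm_le_col_norm[OF B] by (rule bounded_seqsI)
    then show ?thesis using neumann_solution[OF T, of "\<lambda>i. B i j"] small by (metis small1)
  qed
  then obtain r where r: "\<And>j. r j \<in> bounded_seqs" "\<And>i j. r j i = B i j + mat_app T (r j) i" by metis
  \<comment> \<open>\<open>r j\<close> is the inverse of I - T applied to column \<open>j\<close> of
    \<open>B\<close>; with these columns for j < J one has (I - T)(I - L) = I - B.\<close>
  define L where "L i j = (if j < J then r j i else 0)" for i j
  have L: "l1_matrix L"
    unfolding l1_matrix_altdef
  proof
    show "\<forall>j. summable (\<lambda>i. norm (L i j))"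
    proof
      fix j
      have "summable (\<lambda>i. norm (B i j) + norm (mat_app T (r j) i))"
        using B by (intro summable_add mat_app_summable T r) (simp add: l1_matrix_def)
      then have "summable (\<lambda>i. norm (r j i))"
        by (rule summable_comparison_test'[where N = 0]) (subst r(2), simp add: norm_triangle_ineq)
      then show "summable (\<lambda>i. norm (L i j))" by (cases "j < J") (simp_all add: L_def)
    qed
    show "summable (col_norm L)"
      by (rule summable_finite[of "{..<J}"]) (auto simp: col_norm_def L_def)
  qed
  have "fredholm T * fredholm L = fredholm B"
  proof (rule fredholm_mult[OF T L B])
    fix i j
    show "B i j = T i j + L i j - (\<Sum>k. T i k * L k j)"
      using r(2)[of j i] by (auto simp: T_def[of i j] L_def mat_app_def)
  qed
  then have "fredholm L = 0" using zero fT by simp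
  moreover have "fredholm L = minor_det J (id_minus L)"
    by (rule fredholm_finite_columns) (simp add: L_def)
  ultimately obtain w where w: "\<exists>i<J. w i \<noteq> 0" "\<And>i. i < J \<Longrightarrow> (\<Sum>j<J. id_minus L i j * w j) = 0"
    using minor_det_zero_kernel[of J "id_minus L"] by metis
  \<comment> \<open>A kernel vector of the small matrix is lifted by the columns \<open>r j\<close>.
    The kernel equation says that \<open>v\<close> and \<open>w\<close> agree below
    \<open>J\<close>, which turns the defining equations of the \<open>r j\<close> into B v =
    v.\<close>
  define v where "v i = (\<Sum>j<J. w j * r j i)" for i
  have vw: "v i = w i" if "i < J" for i
  proof -
    have "(\<Sum>j<J. id_minus L i j * w j) = (\<Sum>j<J. (if j = i then w j else 0) - L i j * w j)"
      by (rule sum.cong) (auto simp: id_minus_def algebra_simps)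
    also have "\<dots> = w i - v i" using that by (simp add: sum_subtractf L_def v_def mult.commute)
    finally show ?thesis using w(2)[OF that] by simp
  qed
  have vb: "v \<in> bounded_seqs" unfolding v_def[abs_def] by (intro bounded_seqs_sum r)
  have Tv: "mat_app T v = (\<lambda>i. \<Sum>j<J. w j * mat_app T (r j) i)"
    unfolding v_def[abs_def] by (intro mat_app_sum T r)
  have "mat_app B v = v"
  proof
    fix i
    have "v i = (\<Sum>j<J. w j * (B i j + mat_app T (r j) i))" unfolding v_def by (simp only: r(2)[symmetric])
    also have "\<dots> = (\<Sum>j<J. B i j * w j) + mat_app T v i" unfolding Tv
      by (simp add: algebra_simps sum.distrib)
    also have "mat_app T v i = (\<Sum>k. T i (k + J) * v (k + J))"
      unfolding mat_app_def using suminf_split_initial_segment[OF summable_norm_cancel[OF summable_mat_app[OF T vb]], of i J]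
      by (simp add: T_def)
    also have "\<dots> = (\<Sum>k. B i (k + J) * v (k + J))" by (simp add: T_def)
    also have "(\<Sum>j<J. B i j * w j) = (\<Sum>j<J. B i j * v j)" using vw by simp
    also have "(\<Sum>j<J. B i j * v j) + (\<Sum>k. B i (k + J) * v (k + J)) = mat_app B v i"
      unfolding mat_app_def using suminf_split_initial_segment[OF summable_norm_cancel[OF summable_mat_app[OF B vb]], of i J] by simp
    finally show "mat_app B v i = v i" by simp
  qed
  moreover have "v \<noteq> (\<lambda>_. 0)" using w(1) vw by metis
  ultimately show ?thesis using that vb by blast
qed

lemma fredholm_cmult_zero_imp_eigenvector:
  assumes A: "l1_matrix A" and "fredholm (\<lambda>i j. z * A i j) = 0"
  obtains v where "v \<in> bounded_seqs" "v \<noteq> (\<lambda>_. 0)" "z \<noteq> 0" "mat_app A v = (\<lambda>i. (1 / z) * v i)"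
proof -
  obtain v where v: "v \<in> bounded_seqs" "v \<noteq> (\<lambda>_. 0)" "mat_app (\<lambda>i j. z * A i j) v = v"
    using fredholm_zero_imp_fixed_point[OF l1_matrix_cmult(1)[OF A] assms(2)] .
  have "z * mat_app A v i = v i" for i
    using fun_cong[OF v(3), of i] suminf_mult[OF summable_norm_cancel[OF summable_mat_app[OF A v(1)]], of z i]
    by (simp add: mat_app_def mult.assoc)
  moreover from this have "z \<noteq> 0" using v(2) by auto
  ultimately show ?thesis using that[OF v(1,2)] by (simp add: field_simps fun_eq_iff)
qed

text \<open>Wielandt deflation: with \<open>Q = v e\<^sub>k\<^sup>T\<close>, one has \<open>(I - z A')(I - z \<mu> Q) = I - z A\<close> because \<open>A' Q = 0\<close>.\<close>
lemma deflation:
  assumes A: "l1_matrix A" and v: "v \<in> bounded_seqs" "mat_app A v = (\<lambda>i. \<mu> * v i)" "v k = 1" and mu: "\<mu> \<noteq> 0"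
  defines "A' \<equiv> (\<lambda>i j. A i j - (if j = k then \<mu> * v i else 0))"
  shows "l1_matrix A'"
    and "fredholm (\<lambda>i j. z * A i j) = (1 - z * \<mu>) * fredholm (\<lambda>i j. z * A' i j)"
    and "u \<in> bounded_seqs \<Longrightarrow> mat_app A' u = (\<lambda>i. mat_app A u i - \<mu> * u k * v i)"
proof -
  define Q where "Q i j = (if j = k then \<mu> * v i else 0)" for i j
  have A'_eq: "A' i j = A i j - Q i j" for i j by (simp add: A'_def Q_def)
  \<comment> \<open>A v is summable and \<mu> is nonzero, so \<open>v\<close> is summable as well;
    this makes the rank-one matrix \<open>Q\<close> an \<open>l1_matrix\<close>.\<close>
  have sv: "summable (\<lambda>i. norm (v i))"
  proof -
    have "summable (\<lambda>i. inverse (norm \<mu>) * norm (mat_app A v i))"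
      by (intro summable_mult mat_app_summable A v(1))
    then show ?thesis using mu by (simp add: v(2) norm_mult)
  qed
  have Q: "l1_matrix Q"
    unfolding l1_matrix_altdef
  proof
    show "\<forall>j. summable (\<lambda>i. norm (Q i j))"
    proof
      fix j show "summable (\<lambda>i. norm (Q i j))"
        using sv by (cases "j = k") (simp_all add: Q_def norm_mult summable_mult)
    qed
    show "summable (col_norm Q)"
      by (rule summable_finite[of "{k}"]) (auto simp: col_norm_def Q_def)
  qed
  show A': "l1_matrix A'"
    unfolding l1_matrix_altdef
  proof
    have s: "summable (\<lambda>i. norm (A i j) + norm (Q i j))" for j
      using A Q by (intro summable_add) (auto simp: l1_matrix_def)
    show s': "\<forall>j. summable (\<lambda>i. norm (A' i j))"
    proof
      fix j show "summable (\<lambda>i. norm (A' i j))"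
        by (rule summable_comparison_test'[OF s[of j], of 0]) (simp add: A'_eq norm_triangle_ineq4)
    qed
    have "col_norm A' j \<le> col_norm A j + col_norm Q j" for j
    proof -
      have "col_norm A' j \<le> (\<Sum>i. norm (A i j) + norm (Q i j))"
        unfolding col_norm_def using s s' by (intro suminf_le) (auto simp: A'_eq norm_triangle_ineq4)
      also have "\<dots> = col_norm A j + col_norm Q j"
        unfolding col_norm_def using A Q by (intro suminf_add[symmetric]) (auto simp: l1_matrix_def)
      finally show ?thesis .
    qed
    moreover have "0 \<le> col_norm A' j" for j unfolding col_norm_def using s' by (intro suminf_nonneg) auto
    ultimately show "summable (col_norm A')"
      by (intro summable_comparison_test'[OF summable_add[OF summable_col_norm[OF A] summable_col_norm[OF Q]], of 0]) auto
  qed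
  have Qu: "(\<lambda>j. Q i j * u j) sums (\<mu> * u k * v i)" for u i
    using sums_finite[of "{k}" "\<lambda>j. Q i j * u j"] by (simp add: Q_def mult_ac)
  show app: "mat_app A' u = (\<lambda>i. mat_app A u i - \<mu> * u k * v i)" if u: "u \<in> bounded_seqs" for u
  proof
    fix i
    have "(\<lambda>j. A i j * u j - Q i j * u j) sums (mat_app A u i - \<mu> * u k * v i)"
      unfolding mat_app_def by (intro sums_diff Qu summable_sums summable_norm_cancel[OF summable_mat_app[OF A u]])
    then show "mat_app A' u i = mat_app A u i - \<mu> * u k * v i"
      unfolding mat_app_def[of A'] A'_eq by (simp add: sums_iff left_diff_distrib)
  qed
  \<comment> \<open>The normalisation \<open>v k = 1\<close> enters here.\<close>
  have A'v: "mat_app A' v i = 0" for i using app[OF v(1)] v(2,3) by simp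
  note zA = l1_matrix_cmult(1)[OF A, of z] and zA' = l1_matrix_cmult(1)[OF A', of z] and zQ = l1_matrix_cmult(1)[OF Q, of z]
  have "fredholm (\<lambda>i j. z * A' i j) * fredholm (\<lambda>i j. z * Q i j) = fredholm (\<lambda>i j. z * A i j)"
  proof (rule fredholm_mult[OF zA' zQ zA])
    fix i j
    have "(\<Sum>l. z * A' i l * (z * Q l j)) = (\<Sum>l. (z * z * (if j = k then \<mu> else 0)) * (A' i l * v l))"
      by (rule suminf_cong) (auto simp: Q_def)
    also have "\<dots> = (z * z * (if j = k then \<mu> else 0)) * mat_app A' v i"
      unfolding mat_app_def by (intro suminf_mult summable_norm_cancel[OF summable_mat_app[OF A' v(1)]])
    finally show "z * A i j = z * A' i j + z * Q i j - (\<Sum>l. z * A' i l * (z * Q l j))"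
      using A'v by (simp add: A'_eq algebra_simps)
  qed
  moreover have "fredholm (\<lambda>i j. z * Q i j) = 1 - z * Q k k"
    by (rule fredholm_single_column) (simp add: Q_def)
  ultimately show "fredholm (\<lambda>i j. z * A i j) = (1 - z * \<mu>) * fredholm (\<lambda>i j. z * A' i j)"
    by (simp add: Q_def v(3) mult.commute)
qed

section \<open>Generalised eigenspaces\<close>

interpretation cvs: vector_space "\<lambda>(c::complex) (v::nat \<Rightarrow> complex) i. c * v i"
  by unfold_locales (auto simp: fun_eq_iff algebra_simps)

definition shift :: "(nat \<Rightarrow> nat \<Rightarrow> complex) \<Rightarrow> complex \<Rightarrow> (nat \<Rightarrow> complex) \<Rightarrow> nat \<Rightarrow> complex" where
  "shift A l v = (\<lambda>i. mat_app A v i - l * v i)"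

definition gen_eigenspace :: "(nat \<Rightarrow> nat \<Rightarrow> complex) \<Rightarrow> complex \<Rightarrow> (nat \<Rightarrow> complex) set" where
  "gen_eigenspace A l = {v \<in> bounded_seqs. \<exists>n. (shift A l ^^ n) v = (\<lambda>_. 0)}"

text \<open>A relation and not \<open>cvs.dim\<close>, because the value of \<open>cvs.dim\<close>
  alone does not assert that a finite basis exists.\<close>

definition fin_dim :: "(nat \<Rightarrow> complex) set \<Rightarrow> nat \<Rightarrow> bool" where
  "fin_dim S d \<longleftrightarrow> (\<exists>B. finite B \<and> cvs.independent B \<and> cvs.span B = S \<and> card B = d)"

definition matrix_eigenvalue :: "(nat \<Rightarrow> nat \<Rightarrow> complex) \<Rightarrow> complex \<Rightarrow> bool" where
  "matrix_eigenvalue A l \<longleftrightarrow> (\<exists>v\<in>bounded_seqs. v \<noteq> (\<lambda>_. 0) \<and> mat_app A v = (\<lambda>i. l * v i))"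

lemma shift_lincomb:
  assumes "l1_matrix A" "u \<in> bounded_seqs" "v \<in> bounded_seqs"
  shows "shift A l (\<lambda>i. b * u i + c * v i) = (\<lambda>i. b * shift A l u i + c * shift A l v i)"
  unfolding shift_def by (simp add: mat_app_lincomb[OF assms] algebra_simps)

lemma shift_bounded:
  assumes "l1_matrix A" "v \<in> bounded_seqs"
  shows "shift A l v \<in> bounded_seqs"
  using bounded_seqs_lincomb[OF mat_app_bounded[OF assms] assms(2), of 1 "-l"]
  by (simp add: shift_def)

lemma shift_pow_bounded:
  "l1_matrix A \<Longrightarrow> v \<in> bounded_seqs \<Longrightarrow> (shift A l ^^ n) v \<in> bounded_seqs"
  by (induction n) (auto intro: shift_bounded)

lemma shift_pow_lincomb:
  assumes "l1_matrix A" "u \<in> bounded_seqs" "v \<in> bounded_seqs"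
  shows "(shift A l ^^ n) (\<lambda>i. b * u i + c * v i) = (\<lambda>i. b * (shift A l ^^ n) u i + c * (shift A l ^^ n) v i)"
proof (induction n)
  case (Suc n)
  then show ?case
    using shift_lincomb[OF assms(1) shift_pow_bounded[OF assms(1,2)] shift_pow_bounded[OF assms(1,3)]] by simp
qed simp

lemma shift_zero [simp]: "shift A l (\<lambda>_. 0) = (\<lambda>_. 0)"
  by (simp add: shift_def mat_app_def)

lemma shift_pow_zero [simp]: "(shift A l ^^ n) (\<lambda>_. 0) = (\<lambda>_. 0)"
  by (induction n) auto

lemma shift_pow_zero_mono:
  assumes "(shift A l ^^ n) v = (\<lambda>_. 0)" "n \<le> m"
  shows "(shift A l ^^ m) v = (\<lambda>_. 0)"
proof -
  have "(shift A l ^^ m) v = (shift A l ^^ (m - n)) ((shift A l ^^ n) v)"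
    using assms(2) by (metis comp_apply funpow_add le_add_diff_inverse2)
  then show ?thesis using assms(1) by simp
qed

lemma gen_eigenspace_lincomb:
  assumes A: "l1_matrix A" and "u \<in> gen_eigenspace A l" "v \<in> gen_eigenspace A l"
  shows "(\<lambda>i. b * u i + c * v i) \<in> gen_eigenspace A l"
proof -
  obtain m n where u: "u \<in> bounded_seqs" "(shift A l ^^ m) u = (\<lambda>_. 0)"
    and v: "v \<in> bounded_seqs" "(shift A l ^^ n) v = (\<lambda>_. 0)"
    using assms unfolding gen_eigenspace_def by auto
  have "(shift A l ^^ (max m n)) u = (\<lambda>_. 0)" "(shift A l ^^ (max m n)) v = (\<lambda>_. 0)"
    using shift_pow_zero_mono[OF u(2)] shift_pow_zero_mono[OF v(2)] by auto
  then have "(shift A l ^^ (max m n)) (\<lambda>i. b * u i + c * v i) = (\<lambda>_. 0)"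
    by (simp only: shift_pow_lincomb[OF A u(1) v(1)]) simp
  then show ?thesis unfolding gen_eigenspace_def using bounded_seqs_lincomb[OF u(1) v(1)] by auto
qed

lemma zero_in_gen_eigenspace: "(\<lambda>_. 0) \<in> gen_eigenspace A l"
  unfolding gen_eigenspace_def by (auto intro!: bounded_seqsI exI[of _ 0])

lemma subspace_gen_eigenspace:
  assumes A: "l1_matrix A"
  shows "cvs.subspace (gen_eigenspace A l)"
proof (rule cvs.subspaceI)
  show "0 \<in> gen_eigenspace A l" using zero_in_gen_eigenspace by (simp add: zero_fun_def)
  show "x + y \<in> gen_eigenspace A l" if "x \<in> gen_eigenspace A l" "y \<in> gen_eigenspace A l" for x y
    using gen_eigenspace_lincomb[OF A that, of 1 1] by (simp add: plus_fun_def)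
  show "(\<lambda>i. c * x i) \<in> gen_eigenspace A l" if "x \<in> gen_eigenspace A l" for c x
    using gen_eigenspace_lincomb[OF A that that, of c 0] by simp
qed

lemma shift_pow_eigenvector:
  assumes A: "l1_matrix A" and v: "v \<in> bounded_seqs" "mat_app A v = (\<lambda>i. \<nu> * v i)"
  shows "(shift A l ^^ n) v = (\<lambda>i. (\<nu> - l) ^ n * v i)"
proof (induction n)
  case (Suc n)
  have "shift A l v = (\<lambda>i. (\<nu> - l) * v i)" by (simp add: shift_def v algebra_simps)
  moreover have "shift A l (\<lambda>i. (\<nu> - l) ^ n * v i) = (\<lambda>i. (\<nu> - l) ^ n * shift A l v i)"
    using shift_lincomb[OF A v(1) v(1), of l "(\<nu> - l) ^ n" 0] by simp
  ultimately show ?case using Suc by (simp add: mult_ac)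
qed simp

text \<open>If \<nu> = l, one more application of the shift annihilates the multiple of
  \<open>v\<close>. Otherwise the shift acts on \<open>v\<close> as the nonzero scalar \<nu> - l,
  and a multiple of \<open>v\<close> added to \<open>u\<close> cancels the remainder.\<close>

lemma gen_eigenspace_mod_eigenvector:
  assumes A: "l1_matrix A" and v: "v \<in> bounded_seqs" "mat_app A v = (\<lambda>i. \<nu> * v i)"
    and u: "u \<in> bounded_seqs" "(shift A l ^^ n) u = (\<lambda>i. c * v i)"
  shows "\<exists>b. (\<lambda>i. u i + b * v i) \<in> gen_eigenspace A l"
proof (cases "\<nu> = l")
  case True
  have "(shift A l ^^ Suc n) u = shift A l (\<lambda>i. c * v i + 0 * v i)" using u by simp
  also have "\<dots> = (\<lambda>_. 0)" unfolding shift_lincomb[OF A v(1) v(1)] by (simp add: shift_def v True)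
  finally have "u \<in> gen_eigenspace A l" using u(1) unfolding gen_eigenspace_def by blast
  then show ?thesis by (intro exI[of _ 0]) simp
next
  case False
  define b where "b = - c / (\<nu> - l) ^ n"
  have "(shift A l ^^ n) (\<lambda>i. 1 * u i + b * v i) = (\<lambda>_. 0)"
    unfolding shift_pow_lincomb[OF A u(1) v(1)] u(2) shift_pow_eigenvector[OF A v]
    using False by (simp add: b_def)
  then have "(\<lambda>i. 1 * u i + b * v i) \<in> gen_eigenspace A l"
    unfolding gen_eigenspace_def using bounded_seqs_lincomb[OF u(1) v(1), of 1 b] by blast
  then show ?thesis by auto
qed

text \<open>A and A' differ by a map into the line of \<open>v\<close>, an eigenvector of both, for
  A' with eigenvalue 0. Hence their generalised eigenspaces agree modulo that line. The line meets
  the space of A' trivially, as l is nonzero, and lies in the space of A exactly when \<mu> =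
  l.\<close>

lemma fin_dim_gen_eigenspace_deflation:
  assumes A: "l1_matrix A" and A': "l1_matrix A'"
    and v: "v \<in> bounded_seqs" "mat_app A v = (\<lambda>i. \<mu> * v i)" "v k = 1"
    and app: "\<And>u. u \<in> bounded_seqs \<Longrightarrow> mat_app A' u = (\<lambda>i. mat_app A u i - \<mu> * u k * v i)"
    and l: "l \<noteq> 0" and d: "fin_dim (gen_eigenspace A' l) d"
  shows "fin_dim (gen_eigenspace A l) (d + (if \<mu> = l then 1 else 0))"
proof -
  let ?G = "gen_eigenspace A l" and ?G' = "gen_eigenspace A' l"
  have v': "mat_app A' v = (\<lambda>i. 0 * v i)" using app[OF v(1)] v by simp
  \<comment> \<open>Each further shift adds a new multiple of \<open>v\<close> and maps the old
    multiple to a multiple.\<close>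
  have rel: "\<exists>c. (shift A' l ^^ n) u = (\<lambda>i. (shift A l ^^ n) u i + c * v i)" if u: "u \<in> bounded_seqs" for u n
  proof (induction n)
    case 0
    show ?case by (rule exI[of _ 0]) simp
  next
    case (Suc n)
    then obtain c where c: "(shift A' l ^^ n) u = (\<lambda>i. (shift A l ^^ n) u i + c * v i)" by auto
    define y where "y = (shift A l ^^ n) u"
    have y: "y \<in> bounded_seqs" unfolding y_def by (rule shift_pow_bounded[OF A u])
    have "(shift A' l ^^ Suc n) u = shift A' l (\<lambda>i. 1 * y i + c * v i)" using c by (simp add: y_def)
    also have "\<dots> = (\<lambda>i. shift A l y i + (- \<mu> * y k - c * l) * v i)"
      unfolding shift_lincomb[OF A' y v(1)] by (simp add: shift_def app[OF y] v' algebra_simps)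
    finally show ?case by (auto simp: y_def)
  qed
  have to: "\<exists>b. (\<lambda>i. u i + b * v i) \<in> ?G" if u: "u \<in> ?G'" for u
  proof -
    obtain n where n: "u \<in> bounded_seqs" "(shift A' l ^^ n) u = (\<lambda>_. 0)" using u by (auto simp: gen_eigenspace_def)
    obtain c where c: "(shift A' l ^^ n) u = (\<lambda>i. (shift A l ^^ n) u i + c * v i)" using rel[OF n(1)] by auto
    have "(shift A l ^^ n) u i = - c * v i" for i using fun_cong[OF c, of i] n(2) by (simp add: add_eq_0_iff)
    then have "(shift A l ^^ n) u = (\<lambda>i. (- c) * v i)" by auto
    then show ?thesis by (rule gen_eigenspace_mod_eigenvector[OF A v(1,2) n(1)])
  qed
  have down: "\<exists>b. (\<lambda>i. u i + b * v i) \<in> ?G'" if u: "u \<in> ?G" for u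
  proof -
    obtain n where n: "u \<in> bounded_seqs" "(shift A l ^^ n) u = (\<lambda>_. 0)" using u by (auto simp: gen_eigenspace_def)
    obtain c where "(shift A' l ^^ n) u = (\<lambda>i. (shift A l ^^ n) u i + c * v i)" using rel[OF n(1)] by auto
    then have "(shift A' l ^^ n) u = (\<lambda>i. c * v i)" using n(2) by simp
    then show ?thesis by (rule gen_eigenspace_mod_eigenvector[OF A' v(1) v' n(1)])
  qed
  have not_gen: "v \<notin> gen_eigenspace K l"
    if "l1_matrix K" "mat_app K v = (\<lambda>i. \<nu> * v i)" "\<nu> \<noteq> l" for K \<nu>
  proof
    assume "v \<in> gen_eigenspace K l"
    then obtain n where "(shift K l ^^ n) v = (\<lambda>_. 0)" by (auto simp: gen_eigenspace_def)
    then have "(\<nu> - l) ^ n * v k = 0" using shift_pow_eigenvector[OF that(1) v(1) that(2)] by metis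
    then show False using that(3) v(3) by simp
  qed
  have span_insertI: "u \<in> cvs.span (insert v S)" if "(\<lambda>i. u i + b * v i) \<in> cvs.span S" for u b S
  proof -
    have "u - (\<lambda>i. (- b) * v i) = (\<lambda>i. u i + b * v i)" by (simp add: fun_eq_iff)
    then show ?thesis using that by (metis cvs.span_breakdown_eq)
  qed
  obtain B where B: "finite B" "cvs.independent B" "cvs.span B = ?G'" "card B = d"
    using d by (auto simp: fin_dim_def)
  have vB: "v \<notin> cvs.span B" unfolding B(3) by (rule not_gen[OF A' v']) (use l in simp)
  then have vB': "v \<notin> B" using cvs.span_base by auto
  have indB: "cvs.independent (insert v B)" by (rule cvs.independent_insertI[OF vB B(2)])
  have G_sub: "?G \<subseteq> cvs.span (insert v B)" using down span_insertI B(3) by blast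
  show ?thesis
  proof (cases "\<mu> = l")
    case True
    have "v \<in> ?G" unfolding gen_eigenspace_def
      using v True by (auto intro!: exI[of _ 1] simp: shift_def)
    have "B \<subseteq> ?G"
    proof
      fix w assume "w \<in> B"
      then have "w \<in> ?G'" using cvs.span_base B(3) by blast
      then obtain b where "(\<lambda>i. w i + b * v i) \<in> ?G" using to by blast
      from gen_eigenspace_lincomb[OF A this \<open>v \<in> ?G\<close>, of 1 "-b"] show "w \<in> ?G" by simp
    qed
    then have "cvs.span (insert v B) = ?G"
      using G_sub \<open>v \<in> ?G\<close> cvs.span_minimal[OF _ subspace_gen_eigenspace[OF A], of "insert v B"] by auto
    then show ?thesis unfolding fin_dim_def using True B vB' indB
      by (intro exI[of _ "insert v B"]) auto
  next
    case False
    \<comment> \<open>Finite dimension of the space of A is part of the claim. A maximal independent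
      set \<open>C\<close> is compared with \<open>B\<close> after \<open>v\<close> is added to
      both: each enlarged set lies in the span of the other, so the exchange bound applies in both
      directions.\<close>
    obtain C where C: "C \<subseteq> ?G" "cvs.independent C" "?G \<subseteq> cvs.span C"
      using cvs.maximal_independent_subset by metis
    have spanC: "cvs.span C = ?G"
      using C cvs.span_minimal[OF C(1) subspace_gen_eigenspace[OF A]] by auto
    have vC: "v \<notin> cvs.span C" unfolding spanC by (rule not_gen[OF A v(2) False])
    then have vC': "v \<notin> C" using cvs.span_base by auto
    have indC: "cvs.independent (insert v C)" by (rule cvs.independent_insertI[OF vC C(2)])
    have C_sub: "insert v C \<subseteq> cvs.span (insert v B)" using C(1) G_sub cvs.span_base by auto
    have finC: "finite (insert v C)" "card (insert v C) \<le> card (insert v B)"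
      using cvs.independent_span_bound[OF _ indC C_sub] B(1) by auto
    have "w \<in> cvs.span (insert v C)" if "w \<in> B" for w
    proof -
      have "w \<in> ?G'" using that cvs.span_base B(3) by blast
      then show ?thesis using to spanC span_insertI by blast
    qed
    then have "insert v B \<subseteq> cvs.span (insert v C)" using cvs.span_base by auto
    then have "card (insert v B) \<le> card (insert v C)"
      using cvs.independent_span_bound[OF finC(1) indB] by auto
    then have "card C = d" using finC B vB' vC' by simp
    then show ?thesis unfolding fin_dim_def using False finC C(2) spanC by auto
  qed
qed

text \<open>The last nonzero iterate of the shift on a generalised eigenvector would be an
  eigenvector.\<close>

lemma gen_eigenspace_trivial:
  assumes A: "l1_matrix A" and "\<not> matrix_eigenvalue A l"
  shows "gen_eigenspace A l = {\<lambda>_. 0}"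
proof -
  have "v = (\<lambda>_. 0)" if "v \<in> bounded_seqs" "(shift A l ^^ n) v = (\<lambda>_. 0)" for v n
    using that
  proof (induction n)
    case (Suc n)
    have "shift A l ((shift A l ^^ n) v) = (\<lambda>_. 0)" using Suc.prems by simp
    then have "mat_app A ((shift A l ^^ n) v) = (\<lambda>i. l * (shift A l ^^ n) v i)"
      unfolding shift_def[of A l "(shift A l ^^ n) v"] by (simp add: fun_eq_iff)
    then have "(shift A l ^^ n) v = (\<lambda>_. 0)"
      using assms(2) shift_pow_bounded[OF A Suc.prems(1)] unfolding matrix_eigenvalue_def by blast
    then show ?case using Suc by simp
  qed simp
  then show ?thesis using zero_in_gen_eigenspace by (auto simp: gen_eigenspace_def)
qed

lemma fin_dim_zero: "fin_dim {\<lambda>_. 0} 0"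
  unfolding fin_dim_def using cvs.independent_empty cvs.span_empty
  by (intro exI[of _ "{}"]) (simp add: zero_fun_def)

lemma fin_dim_dim: "fin_dim S d \<Longrightarrow> cvs.dim S = d"
  unfolding fin_dim_def by (metis cvs.dim_eq_card_independent cvs.dim_span)

lemma fin_dim_0D: "fin_dim S 0 \<Longrightarrow> S = {\<lambda>_. 0}"
  unfolding fin_dim_def by (auto simp: zero_fun_def)

text \<open>\<open>N\<close> bounds the number of deflations: a chain either uses all of them or
  stops because no eigenvalue of modulus at least \<epsilon> is left. The dimension clause speaks of
  every \<open>d\<close> so that it composes along the chain; the count of \<open>l\<close> in
  \<open>ls\<close> is the multiplicity removed so far.\<close>

lemma deflation_chain:
  assumes A: "l1_matrix A" and "0 < \<epsilon>"
  shows "\<exists>ls A'. l1_matrix A' \<and> (\<forall>x\<in>set ls. \<epsilon> \<le> norm x) \<and>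
    (\<forall>z. fredholm (\<lambda>i j. z * A i j) = (\<Prod>x\<leftarrow>ls. 1 - z * x) * fredholm (\<lambda>i j. z * A' i j)) \<and>
    (\<forall>l d. l \<noteq> 0 \<longrightarrow> fin_dim (gen_eigenspace A' l) d \<longrightarrow> fin_dim (gen_eigenspace A l) (d + count_list ls l)) \<and>
    (length ls = N \<or> (\<forall>l. \<epsilon> \<le> norm l \<longrightarrow> \<not> matrix_eigenvalue A' l))"
proof (induction N)
  case 0
  show ?case by (intro exI[of _ "[]"] exI[of _ A]) (simp add: A)
next
  case (Suc N)
  then obtain ls A' where IH: "l1_matrix A'" "\<forall>x\<in>set ls. \<epsilon> \<le> norm x"
    "\<And>z. fredholm (\<lambda>i j. z * A i j) = (\<Prod>x\<leftarrow>ls. 1 - z * x) * fredholm (\<lambda>i j. z * A' i j)"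
    "\<And>l d. l \<noteq> 0 \<Longrightarrow> fin_dim (gen_eigenspace A' l) d \<Longrightarrow> fin_dim (gen_eigenspace A l) (d + count_list ls l)"
    "length ls = N \<or> (\<forall>l. \<epsilon> \<le> norm l \<longrightarrow> \<not> matrix_eigenvalue A' l)" by blast
  show ?case
  proof (cases "\<forall>l. \<epsilon> \<le> norm l \<longrightarrow> \<not> matrix_eigenvalue A' l")
    case True
    then show ?thesis using IH by blast
  next
    case False
    then obtain \<mu> v0 where mu: "\<epsilon> \<le> norm \<mu>" and v0: "v0 \<in> bounded_seqs" "v0 \<noteq> (\<lambda>_. 0)" "mat_app A' v0 = (\<lambda>i. \<mu> * v0 i)"
      by (auto simp: matrix_eigenvalue_def)
    obtain k where k: "v0 k \<noteq> 0" using v0(2) by auto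
    define v where "v i = 1 / v0 k * v0 i" for i
    have v: "v \<in> bounded_seqs" "mat_app A' v = (\<lambda>i. \<mu> * v i)" "v k = 1"
      using bounded_seqs_cmult[OF v0(1), of "1 / v0 k"] mat_app_lincomb[OF IH(1) v0(1) v0(1), of "1 / v0 k" 0] v0(3) k
      by (simp_all add: v_def[abs_def])
    have mu0: "\<mu> \<noteq> 0" using mu assms(2) by auto
    define A'' where "A'' = (\<lambda>i j. A' i j - (if j = k then \<mu> * v i else 0))"
    have defl: "l1_matrix A''"
      "fredholm (\<lambda>i j. z * A' i j) = (1 - z * \<mu>) * fredholm (\<lambda>i j. z * A'' i j)"
      "u \<in> bounded_seqs \<Longrightarrow> mat_app A'' u = (\<lambda>i. mat_app A' u i - \<mu> * u k * v i)" for z u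
      unfolding A''_def using deflation[OF IH(1) v mu0] by blast+
    show ?thesis
    proof (intro exI conjI)
      show "l1_matrix A''" by (rule defl)
      show "\<forall>x\<in>set (\<mu> # ls). \<epsilon> \<le> norm x" using mu IH(2) by simp
      show "\<forall>z. fredholm (\<lambda>i j. z * A i j) = (\<Prod>x\<leftarrow>\<mu> # ls. 1 - z * x) * fredholm (\<lambda>i j. z * A'' i j)"
        by (simp only: IH(3) defl(2)) simp
      show "\<forall>l d. l \<noteq> 0 \<longrightarrow> fin_dim (gen_eigenspace A'' l) d \<longrightarrow> fin_dim (gen_eigenspace A l) (d + count_list (\<mu> # ls) l)"
      proof (intro allI impI)
        fix l d assume "l \<noteq> 0" "fin_dim (gen_eigenspace A'' l) d"
        from IH(4)[OF this(1) fin_dim_gen_eigenspace_deflation[OF IH(1) defl(1) v defl(3) this]]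
        show "fin_dim (gen_eigenspace A l) (d + count_list (\<mu> # ls) l)"
          by (simp add: add_ac split: if_splits)
      qed
      show "length (\<mu> # ls) = Suc N \<or> (\<forall>l. \<epsilon> \<le> norm l \<longrightarrow> \<not> matrix_eigenvalue A'' l)"
        using IH(5) False by auto
    qed
  qed
qed

section \<open>The eigenvalue sum\<close>

lemma fredholm_0: "fredholm (\<lambda>i j. 0) = 1"
  using fredholm_finite_columns[of 0 "\<lambda>i j. 0"] by (simp add: minor_det_def)

text \<open>Borel-Caratheodory at the centre. A logarithm \<open>g\<close> of \<open>f\<close> that
  vanishes at 0 has real part below \<open>B\<close>; the Moebius map u / (2 B - u) sends that
  half-plane into the unit disc, and Schwarz's lemma bounds the derivative of the composition at
  0.\<close>

lemma norm_deriv_le_of_nonvanishing: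
  fixes f :: "complex \<Rightarrow> complex"
  assumes hol: "f holomorphic_on ball 0 R" and R: "0 < R" and B: "0 < B"
    and nz: "\<And>z. norm z < R \<Longrightarrow> f z \<noteq> 0" and f0: "f 0 = 1"
    and bound: "\<And>z. norm z < R \<Longrightarrow> norm (f z) < exp B"
  shows "norm (deriv f 0) \<le> 2 * B / R"
proof -
  obtain g0 where g0: "g0 holomorphic_on ball 0 R" "\<And>z. z \<in> ball 0 R \<Longrightarrow> exp (g0 z) = f z"
    using holomorphic_logarithm_exists[OF convex_ball open_ball hol, of 0] nz R by auto
  define g where "g z = g0 z - g0 0" for z
  have g: "g holomorphic_on ball 0 R" unfolding g_def[abs_def] by (intro holomorphic_intros g0)
  have exp_g: "exp (g z) = f z" if "z \<in> ball 0 R" for z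
    using g0(2)[OF that] g0(2)[of 0] f0 R by (simp add: g_def exp_diff)
  have g00: "g 0 = 0" by (simp add: g_def)
  have Re_g: "Re (g z) < B" if "z \<in> ball 0 R" for z
    using bound[of z] exp_g[OF that] that norm_exp_eq_Re[of "g z"] by simp
  define h where "h w = g (of_real R * w) / (2 * of_real B - g (of_real R * w))" for w
  have in_ball: "of_real R * w \<in> ball 0 R" if "norm w < 1" for w :: complex
    using that R by (simp add: norm_mult)
  have ne: "2 * of_real B - g (of_real R * w) \<noteq> 0" if "norm w < 1" for w
  proof
    assume "2 * of_real B - g (of_real R * w) = 0"
    then have "Re (2 * of_real B) = Re (g (of_real R * w))" by simp
    then show False using Re_g[OF in_ball[OF that]] B by simp
  qed
  have h_hol: "h holomorphic_on ball 0 1"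
  proof -
    have "(\<lambda>w. g (of_real R * w)) holomorphic_on ball 0 1"
    proof -
      have "(\<lambda>w. complex_of_real R * w) ` ball 0 1 \<subseteq> ball 0 R" using in_ball by auto
      moreover have "(\<lambda>w. complex_of_real R * w) holomorphic_on ball 0 1" by (intro holomorphic_intros)
      ultimately show ?thesis using holomorphic_on_compose_gen[OF _ g] by (simp add: o_def)
    qed
    then show ?thesis unfolding h_def[abs_def] using ne by (intro holomorphic_intros) auto
  qed
  have "norm (deriv h 0) \<le> 1"
  proof (rule Schwarz_Lemma(2)[OF h_hol])
    show "h 0 = 0" by (simp add: h_def g00)
    show "norm (h z) < 1" if "norm z < 1" for z
    proof -
      define u where "u = g (of_real R * z)"
      have "Re u < B" unfolding u_def by (rule Re_g[OF in_ball[OF that]])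
      then have "(norm u)\<^sup>2 < (norm (2 * of_real B - u))\<^sup>2"
      proof -
        \<comment> \<open>This number is |2 B - u|^2 - |u|^2.\<close>
        have "0 < 4 * B * (B - Re u)" using B \<open>Re u < B\<close> by simp
        then show ?thesis unfolding cmod_power2 by (simp add: power2_eq_square algebra_simps)
      qed
      then have "norm u < norm (2 * of_real B - u)" by (rule power_less_imp_less_base) simp
      then show ?thesis unfolding h_def u_def[symmetric]
        by (simp add: norm_divide divide_less_eq_1)
    qed
    show "norm (0::complex) < 1" by simp
  qed
  moreover have "deriv h 0 = of_real R * deriv f 0 / (2 * of_real B)"
  proof -
    have dg: "(g has_field_derivative deriv g 0) (at 0)"
      using g R by (simp add: holomorphic_derivI)
    have "((\<lambda>z. exp (g z)) has_field_derivative exp (g 0) * deriv g 0) (at 0)"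
      by (intro DERIV_chain' [OF dg] DERIV_exp) 
    moreover have "((\<lambda>z. exp (g z)) has_field_derivative d) (at 0) \<longleftrightarrow> (f has_field_derivative d) (at 0)" for d
      by (rule DERIV_cong_ev) (use R exp_g eventually_nhds_ball[of R 0] in \<open>auto elim: eventually_mono\<close>)
    ultimately have df: "deriv f 0 = deriv g 0" by (simp add: g00 DERIV_imp_deriv)
    have "((\<lambda>w. g (of_real R * w)) has_field_derivative deriv g 0 * of_real R) (at 0)"
      using DERIV_chain'[of "\<lambda>w. of_real R * w" "of_real R" 0 UNIV g] dg
      by (auto intro!: derivative_eq_intros DERIV_chain2[where f = g])
    then have "(h has_field_derivative deriv g 0 * of_real R / (2 * of_real B)) (at 0)"
      unfolding h_def[abs_def] using B
      by (auto intro!: derivative_eq_intros simp: g00 field_simps)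
    then show ?thesis unfolding df by (simp add: DERIV_imp_deriv mult.commute)
  qed
  ultimately show ?thesis
    using R B by (simp add: norm_mult norm_divide field_simps)
qed

lemma prod_list_norm_ge:
  fixes f :: "'a \<Rightarrow> complex"
  assumes "\<And>x. x \<in> set xs \<Longrightarrow> c \<le> norm (f x)" "0 \<le> c"
  shows "c ^ length xs \<le> norm (\<Prod>x\<leftarrow>xs. f x)"
  using assms by (induction xs) (auto simp: norm_mult intro!: mult_mono)

lemma has_field_derivative_prod_list_linear:
  "((\<lambda>z. \<Prod>x\<leftarrow>xs. 1 - z * x) has_field_derivative - sum_list xs) (at (0::complex))"
proof (induction xs)
  case (Cons x xs)
  have "((\<lambda>z. (1 - z * x) * (\<Prod>x\<leftarrow>xs. 1 - z * x)) has_field_derivative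
      - x * (\<Prod>x\<leftarrow>xs. 1 - 0 * x) + - sum_list xs * (1 - 0 * x)) (at 0)"
    by (rule DERIV_mult'[THEN DERIV_cong]) (auto intro!: derivative_eq_intros Cons simp: mult.commute)
  then show ?case by (simp add: map_replicate_const prod_list_replicate cong: map_cong)
qed simp

text \<open>On the circle of radius \<open>R\<close> every linear factor has modulus at least
  \<open>c\<close>, so the quotient \<open>f\<close> is controlled by \<open>F\<close> there, and
  inside by the maximum principle. At z = 0 this plays the part of Jensen's inequality.\<close>

lemma deflated_bound:
  assumes hol: "f holomorphic_on UNIV" and F: "\<And>z. F z = (\<Prod>x\<leftarrow>ls. 1 - z * x) * f z"
    and FB: "\<And>z. norm z = R \<Longrightarrow> norm (F z) \<le> B" and R: "0 < R"
    and c: "0 < c" "\<And>z x. norm z = R \<Longrightarrow> x \<in> set ls \<Longrightarrow> c \<le> norm (1 - z * x)"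
    and z: "norm z \<le> R"
  shows "norm (f z) \<le> B / c ^ length ls"
proof (rule maximum_modulus_frontier[where S = "cball 0 R" and f = f and \<xi> = z])
  show "f holomorphic_on interior (cball 0 R)" using hol by (rule holomorphic_on_subset) auto
  show "continuous_on (closure (cball 0 R)) f"
    using hol by (intro holomorphic_on_imp_continuous_on) (auto intro: holomorphic_on_subset)
  show "bounded (cball (0::complex) R)" by simp
  show "z \<in> cball 0 R" using z by simp
  fix w assume "w \<in> frontier (cball (0::complex) R)"
  then have w: "norm w = R" using R by simp
  have p: "c ^ length ls \<le> norm (\<Prod>x\<leftarrow>ls. 1 - w * x)"
    using c(2)[OF w] c(1) by (intro prod_list_norm_ge) auto
  have "c ^ length ls * norm (f w) \<le> norm (\<Prod>x\<leftarrow>ls. 1 - w * x) * norm (f w)"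
    using p by (rule mult_right_mono) simp
  also have "\<dots> = norm (F w)" by (simp add: F norm_mult)
  also have "\<dots> \<le> B" by (rule FB[OF w])
  finally show "norm (f w) \<le> B / c ^ length ls" using c(1) by (simp add: field_simps)
qed

lemma norm_one_minus_ge:
  fixes z x :: complex
  assumes "norm z = c / \<epsilon>" "\<epsilon> \<le> norm x" "0 < \<epsilon>" "0 < c"
  shows "c - 1 \<le> norm (1 - z * x)"
proof -
  have "c = norm z * \<epsilon>" using assms by simp
  then have "c \<le> norm z * norm x" using assms(2) by (simp add: mult_left_mono)
  also have "norm z * norm x \<le> norm (1 - z * x) + 1"
    using norm_triangle_ineq4[of 1 "1 - z * x"] by (simp add: norm_mult)
  finally show ?thesis by simp
qed

text \<open>On l1 such a matrix is s-nuclear in the sense of Grothendieck; the exponent below 1 is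
  what allows the eigenvalues to be summed absolutely.\<close>

locale l1_decay =
  fixes A :: "nat \<Rightarrow> nat \<Rightarrow> complex" and s :: real
  assumes l1: "l1_matrix A" and s: "0 < s" "s < 1" and col_summable: "summable (\<lambda>j. col_norm A j powr s)"
begin

definition growth :: real where "growth = (\<Sum>j. col_norm A j powr s) / s"

lemma growth_nonneg: "0 \<le> growth"
  unfolding growth_def using s by (intro divide_nonneg_pos suminf_nonneg col_summable) auto

text \<open>Two radii are used. On |z| = 4/\<epsilon> each factor 1 - z x has modulus at least 3,
  and the value 1 of the deflated determinant at 0 turns this into a bound for the number of
  factors. On |z| = 2/\<epsilon> the factors are at least 1, so the deflated determinant inherits
  the growth of \<open>F\<close>, and the derivative estimate applies on the disc of radius
  1/\<epsilon>, where it has no zeros.\<close>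

lemma spectral_approx:
  assumes e: "0 < \<epsilon>"
  obtains ls where "\<And>x. x \<in> set ls \<Longrightarrow> \<epsilon> \<le> norm x"
    "\<And>l. \<epsilon> \<le> norm l \<Longrightarrow> fin_dim (gen_eigenspace A l) (count_list ls l)"
    "real (length ls) * ln 3 \<le> (4 / \<epsilon>) powr s * growth"
    "norm ((\<Sum>i. A i i) - sum_list ls) \<le> 2 * ((2 / \<epsilon>) powr s * growth + 1) * \<epsilon>"
proof -
  define F where "F z = fredholm (\<lambda>i j. z * A i j)" for z
  have F_le: "norm (F z) \<le> exp (norm z powr s * growth)" for z
    unfolding F_def growth_def using s by (intro norm_fredholm_cmult_le l1 col_summable) auto
  have length_le: "real (length ls) * ln 3 \<le> (4 / \<epsilon>) powr s * growth"
    if A': "l1_matrix A'" and ls: "\<forall>x\<in>set ls. \<epsilon> \<le> norm x"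
      and FA: "\<forall>z. F z = (\<Prod>x\<leftarrow>ls. 1 - z * x) * fredholm (\<lambda>i j. z * A' i j)" for ls A'
  proof -
    have "norm (fredholm (\<lambda>i j. 0 * A' i j)) \<le> exp ((4 / \<epsilon>) powr s * growth) / 3 ^ length ls"
    proof (rule deflated_bound[where f = "\<lambda>z. fredholm (\<lambda>i j. z * A' i j)" and R = "4 / \<epsilon>" and z = 0])
      show "(\<lambda>z. fredholm (\<lambda>i j. z * A' i j)) holomorphic_on UNIV"
        by (rule fredholm_cmult_has_derivative(1)[OF A'])
      show "F z = (\<Prod>x\<leftarrow>ls. 1 - z * x) * fredholm (\<lambda>i j. z * A' i j)" for z using FA by simp
      show "norm (F z) \<le> exp ((4 / \<epsilon>) powr s * growth)" if "norm z = 4 / \<epsilon>" for z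
        using F_le[of z] that by simp
      show "3 \<le> norm (1 - z * x)" if "norm z = 4 / \<epsilon>" "x \<in> set ls" for z x
        using norm_one_minus_ge[of z 4 \<epsilon> x] that ls e by simp
    qed (use e in auto)
    then have "3 ^ length ls \<le> exp ((4 / \<epsilon>) powr s * growth)" by (simp add: fredholm_0 field_simps)
    then have "ln (3 ^ length ls) \<le> ln (exp ((4 / \<epsilon>) powr s * growth))" by (subst ln_le_cancel_iff) auto
    then show ?thesis by (simp add: ln_realpow)
  qed
  \<comment> \<open>\<open>N\<close> exceeds the bound on the length of any chain, so the chain must
    have stopped for lack of eigenvalues.\<close>
  obtain N :: nat where N: "(4 / \<epsilon>) powr s * growth / ln 3 < real N" using reals_Archimedean2 by blast
  obtain ls A' where A': "l1_matrix A'" and ls: "\<forall>x\<in>set ls. \<epsilon> \<le> norm x"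
    and FA: "\<forall>z. F z = (\<Prod>x\<leftarrow>ls. 1 - z * x) * fredholm (\<lambda>i j. z * A' i j)"
    and dims: "\<And>l d. l \<noteq> 0 \<Longrightarrow> fin_dim (gen_eigenspace A' l) d \<Longrightarrow> fin_dim (gen_eigenspace A l) (d + count_list ls l)"
    and stop: "length ls = N \<or> (\<forall>l. \<epsilon> \<le> norm l \<longrightarrow> \<not> matrix_eigenvalue A' l)"
    using deflation_chain[OF l1 e, of N] unfolding F_def by blast
  note len = length_le[OF A' ls FA]
  have "length ls \<noteq> N"
  proof
    assume "length ls = N"
    then have "real N \<le> (4 / \<epsilon>) powr s * growth / ln 3" using len by (simp add: field_simps)
    then show False using N by simp
  qed
  then have noeig: "\<And>l. \<epsilon> \<le> norm l \<Longrightarrow> \<not> matrix_eigenvalue A' l" using stop by blast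
  define f where "f z = fredholm (\<lambda>i j. z * A' i j)" for z
  have f_hol: "f holomorphic_on UNIV" unfolding f_def by (rule fredholm_cmult_has_derivative(1)[OF A'])
  have f0: "f 0 = 1" by (simp add: f_def fredholm_0)
  have f_nz: "f z \<noteq> 0" if "norm z < 1 / \<epsilon>" for z
  proof
    assume "f z = 0"
    then obtain v where v: "v \<in> bounded_seqs" "v \<noteq> (\<lambda>_. 0)" "z \<noteq> 0" "mat_app A' v = (\<lambda>i. (1 / z) * v i)"
      unfolding f_def using fredholm_cmult_zero_imp_eigenvector[OF A'] by blast
    then have "matrix_eigenvalue A' (1 / z)" unfolding matrix_eigenvalue_def by blast
    moreover have "\<epsilon> \<le> norm (1 / z)" using that v(3) e by (simp add: norm_divide field_simps)
    ultimately show False using noeig by blast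
  qed
  define B where "B = (2 / \<epsilon>) powr s * growth"
  have B0: "0 \<le> B" unfolding B_def using growth_nonneg by simp
  have f_bound: "norm (f z) \<le> exp B" if "norm z < 1 / \<epsilon>" for z
  proof -
    have "norm (f z) \<le> exp B / 1 ^ length ls"
    proof (rule deflated_bound[where f = f and R = "2 / \<epsilon>" and z = z])
      show "f holomorphic_on UNIV" by (rule f_hol)
      show "F z = (\<Prod>x\<leftarrow>ls. 1 - z * x) * f z" for z using FA by (simp add: f_def)
      show "norm (F z) \<le> exp B" if "norm z = 2 / \<epsilon>" for z
        using F_le[of z] that by (simp add: B_def)
      show "1 \<le> norm (1 - z * x)" if "norm z = 2 / \<epsilon>" "x \<in> set ls" for z x
        using norm_one_minus_ge[of z 2 \<epsilon> x] that ls e by simp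
      have "1 / \<epsilon> \<le> 2 / \<epsilon>" using e by (simp add: divide_right_mono)
      then show "norm z \<le> 2 / \<epsilon>" using that by simp
    qed (use e in auto)
    then show ?thesis by simp
  qed
  \<comment> \<open>B + 1 in place of B makes the exponent positive and the bound strict.\<close>
  have "norm (deriv f 0) \<le> 2 * (B + 1) / (1 / \<epsilon>)"
  proof (rule norm_deriv_le_of_nonvanishing)
    show "f holomorphic_on ball 0 (1 / \<epsilon>)" using f_hol by (rule holomorphic_on_subset) simp
    show "norm (f z) < exp (B + 1)" if "norm z < 1 / \<epsilon>" for z
      using f_bound[OF that] by (rule order.strict_trans1) simp
  qed (use e B0 f0 f_nz in auto)
  \<comment> \<open>The product rule at 0 with f 0 = 1, compared with the derivative of the full
    determinant.\<close>
  moreover have "deriv f 0 = sum_list ls - (\<Sum>i. A i i)"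
  proof -
    have df: "(f has_field_derivative deriv f 0) (at 0)" using f_hol by (simp add: holomorphic_derivI)
    have "((\<lambda>z. (\<Prod>x\<leftarrow>ls. 1 - z * x) * f z) has_field_derivative
        (\<Prod>x\<leftarrow>ls. 1 - 0 * x) * deriv f 0 + (- sum_list ls) * f 0) (at 0)"
      by (rule DERIV_mult'[OF has_field_derivative_prod_list_linear df])
    then have "(F has_field_derivative deriv f 0 - sum_list ls) (at 0)"
      using FA by (simp add: f_def[symmetric] f0 map_replicate_const prod_list_replicate fun_eq_iff[symmetric])
    moreover have "(F has_field_derivative - (\<Sum>i. A i i)) (at 0)"
      unfolding F_def[abs_def] by (rule fredholm_cmult_has_derivative(2)[OF l1])
    ultimately have "deriv f 0 - sum_list ls = - (\<Sum>i. A i i)" by (rule DERIV_unique)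
    then show ?thesis by (simp add: algebra_simps)
  qed
  ultimately have "norm ((\<Sum>i. A i i) - sum_list ls) \<le> 2 * (B + 1) * \<epsilon>"
    by (simp add: norm_minus_commute)
  moreover have "fin_dim (gen_eigenspace A l) (count_list ls l)" if "\<epsilon> \<le> norm l" for l
  proof -
    have "l \<noteq> 0" using that e by auto
    moreover have "fin_dim (gen_eigenspace A' l) 0"
      using gen_eigenspace_trivial[OF A' noeig[OF that]] fin_dim_zero by simp
    ultimately show ?thesis using dims by fastforce
  qed
  ultimately show ?thesis using that ls len unfolding B_def by blast
qed

end

lemma sum_list_map_eq_sum_of_nat_count:
  fixes f :: "'a \<Rightarrow> 'b::comm_semiring_1"
  assumes "finite X" "set xs \<subseteq> X"
  shows "sum_list (map f xs) = (\<Sum>x\<in>X. of_nat (count_list xs x) * f x)"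
  using assms(2)
proof (induction xs)
  case (Cons a xs)
  have "(\<Sum>x\<in>X. of_nat (count_list (a # xs) x) * f x)
      = (\<Sum>x\<in>X. (if x = a then f x else 0) + of_nat (count_list xs x) * f x)"
    by (rule sum.cong) (auto simp: algebra_simps)
  also have "\<dots> = f a + (\<Sum>x\<in>X. of_nat (count_list xs x) * f x)"
    using Cons.prems assms(1) by (simp add: sum.distrib)
  finally show ?case using Cons by simp
qed simp

context l1_decay begin

definition mult :: "complex \<Rightarrow> nat" where "mult l = cvs.dim (gen_eigenspace A l)"

lemma fin_dim_mult:
  assumes "l \<noteq> 0" shows "fin_dim (gen_eigenspace A l) (mult l)"
proof -
  obtain ls where "fin_dim (gen_eigenspace A l) (count_list ls l)"
    using spectral_approx[of "norm l"] assms by (metis norm_eq_zero order_refl zero_less_norm_iff)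
  then show ?thesis unfolding mult_def using fin_dim_dim by metis
qed

lemma eigenvalue_iff_mult:
  assumes "l \<noteq> 0" shows "matrix_eigenvalue A l \<longleftrightarrow> mult l \<noteq> 0"
proof
  assume "matrix_eigenvalue A l"
  then obtain v where v: "v \<in> bounded_seqs" "v \<noteq> (\<lambda>_. 0)" "mat_app A v = (\<lambda>i. l * v i)"
    by (auto simp: matrix_eigenvalue_def)
  then have "v \<in> gen_eigenspace A l"
    by (auto simp: gen_eigenspace_def shift_def intro!: exI[of _ 1])
  then show "mult l \<noteq> 0" using v(2) fin_dim_mult[OF assms] fin_dim_0D by force
next
  assume "mult l \<noteq> 0"
  then show "matrix_eigenvalue A l"
    using gen_eigenspace_trivial[OF l1] fin_dim_zero fin_dim_dim unfolding mult_def by metis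
qed

text \<open>The thresholds are 2^-k. With multiplicities, at most a constant times 2^(k s)
  eigenvalues have modulus at least 2^-(k+1), and those new at that stage have modulus below 2^-k,
  so the moduli added are bounded by a geometric series of ratio 2^(s-1).\<close>

theorem eigenvalue_sum:
  "((\<lambda>l. of_nat (mult l) * l) has_sum (\<Sum>i. A i i)) {l. l \<noteq> 0 \<and> matrix_eigenvalue A l}"
proof -
  define Z where "Z = {l. l \<noteq> 0 \<and> matrix_eigenvalue A l}"
  define f where "f l = of_nat (mult l) * l" for l :: complex
  define e where "e k = (1/2 :: real) ^ k" for k :: nat
  have e: "0 < e k" for k by (simp add: e_def)
  define Zk where "Zk k = {l \<in> Z. e k \<le> norm l}" for k
  define P where "P k ls \<longleftrightarrow> (\<forall>x\<in>set ls. e k \<le> norm x) \<and> (\<forall>l. e k \<le> norm l \<longrightarrow> fin_dim (gen_eigenspace A l) (count_list ls l)) \<and>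
     real (length ls) * ln 3 \<le> (4 / e k) powr s * growth \<and>
     norm ((\<Sum>i. A i i) - sum_list ls) \<le> 2 * ((2 / e k) powr s * growth + 1) * e k" for k ls
  have "\<exists>ls. P k ls" for k unfolding P_def
    by (rule spectral_approx[OF e[of k]]) blast
  then obtain L where "P k (L k)" for k by metis
  then have L: "\<And>k x. x \<in> set (L k) \<Longrightarrow> e k \<le> norm x"
    "\<And>k l. e k \<le> norm l \<Longrightarrow> fin_dim (gen_eigenspace A l) (count_list (L k) l)"
    "\<And>k. real (length (L k)) * ln 3 \<le> (4 / e k) powr s * growth"
    "\<And>k. norm ((\<Sum>i. A i i) - sum_list (L k)) \<le> 2 * ((2 / e k) powr s * growth + 1) * e k" unfolding P_def by blast+
  have count: "count_list (L k) l = mult l" if "e k \<le> norm l" for k l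
    using L(2)[OF that] fin_dim_dim unfolding mult_def by metis
  have Zk: "Zk k = set (L k)" for k
  proof -
    have "l \<in> Zk k \<longleftrightarrow> e k \<le> norm l \<and> mult l \<noteq> 0" for l
      using eigenvalue_iff_mult[of l] e[of k] unfolding Zk_def Z_def by (cases "l = 0") auto
    moreover have "l \<in> set (L k) \<longleftrightarrow> e k \<le> norm l \<and> mult l \<noteq> 0" for l
      using L(1)[of l k] count[of k l] count_list_0_iff[of "L k" l] by metis
    ultimately show ?thesis by blast
  qed
  have finZk: "finite (Zk k)" for k by (simp add: Zk)
  have sum_Zk: "sum f (Zk k) = sum_list (L k)" for k
  proof -
    have "sum_list (L k) = (\<Sum>x\<in>Zk k. of_nat (count_list (L k) x) * x)"
      using sum_list_map_eq_sum_of_nat_count[of "Zk k" "L k" "\<lambda>x. x"] finZk Zk by simp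
    also have "\<dots> = sum f (Zk k)"
      by (rule sum.cong) (auto simp: f_def Zk_def count)
    finally show ?thesis ..
  qed
  have norm_f: "norm (f l) = real (mult l) * norm l" for l by (simp add: f_def norm_mult)
  have mult_sum: "(\<Sum>l\<in>Zk k. real (mult l)) = real (length (L k))" for k
  proof -
    have "real (length (L k)) = (\<Sum>x\<in>Zk k. of_nat (count_list (L k) x) * 1)"
      using sum_list_map_eq_sum_of_nat_count[of "Zk k" "L k" "\<lambda>x. 1 :: real"] finZk Zk by (simp add: sum_list_triv)
    also have "\<dots> = (\<Sum>l\<in>Zk k. real (mult l))"
      by (rule sum.cong) (auto simp: Zk_def count)
    finally show ?thesis ..
  qed
  define q where "q = (2::real) powr (s - 1)"
  have q: "0 < q" "q < 1" using s by (auto simp: q_def powr_less_one)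
  have e_powr: "(c / e k) powr s * e k = c powr s * q ^ k" if "0 < c" for c k
  proof -
    have ek: "e k = 1 / 2 ^ k" by (simp add: e_def power_one_over)
    have "(c / e k) powr s * e k = (c * 2 ^ k) powr s * (1 / 2 ^ k)" by (simp add: ek)
    also have "\<dots> = c powr s * ((2 ^ k) powr s / 2 ^ k)" using that by (simp add: powr_mult)
    also have "(2 ^ k) powr s / 2 ^ k = 2 powr (real k * s) / 2 powr real k"
      by (simp add: powr_powr flip: powr_realpow)
    also have "\<dots> = 2 powr ((s - 1) * real k)"
      unfolding powr_diff[symmetric] by (simp add: algebra_simps)
    also have "\<dots> = q ^ k"
      unfolding q_def powr_powr[symmetric] by (rule powr_realpow) simp
    finally show ?thesis .
  qed
  \<comment> \<open>The factor 2 is the ratio of \<open>e k\<close> to \<open>e (Suc k)\<close>, and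
    \<open>q\<close> is left over from \<open>q ^ Suc k\<close>.\<close>
  define D where "D = 2 * 4 powr s * q * growth / ln 3"
  have D0: "0 \<le> D" using q growth_nonneg by (simp add: D_def)
  have step: "(\<Sum>l\<in>Zk (Suc k). norm (f l)) \<le> (\<Sum>l\<in>Zk k. norm (f l)) + D * q ^ k" for k
  proof -
    have "e (Suc k) \<le> e k" by (simp add: e_def)
    then have sub: "Zk k \<subseteq> Zk (Suc k)" unfolding Zk_def by auto
    have "(\<Sum>l\<in>Zk (Suc k). norm (f l)) = (\<Sum>l\<in>Zk k. norm (f l)) + (\<Sum>l\<in>Zk (Suc k) - Zk k. norm (f l))"
      using sum.subset_diff[OF sub finZk, of "\<lambda>l. norm (f l)"] by simp
    also have "(\<Sum>l\<in>Zk (Suc k) - Zk k. norm (f l)) \<le> (\<Sum>l\<in>Zk (Suc k) - Zk k. real (mult l) * e k)"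
      unfolding norm_f by (intro sum_mono mult_left_mono) (auto simp: Zk_def)
    also have "\<dots> \<le> (\<Sum>l\<in>Zk (Suc k). real (mult l) * e k)"
      using e[of k] finZk by (intro sum_mono2) auto
    also have "\<dots> = real (length (L (Suc k))) * e k"
      unfolding sum_distrib_right[symmetric] mult_sum ..
    also have "\<dots> \<le> ((4 / e (Suc k)) powr s * growth / ln 3) * e k"
      using L(3)[of "Suc k"] e[of k] by (intro mult_right_mono) (auto simp: field_simps)
    also have "\<dots> = ((4 / e (Suc k)) powr s * e (Suc k)) * (2 * growth / ln 3)"
      by (simp add: e_def)
    also have "\<dots> = D * q ^ k" by (subst e_powr) (simp_all add: D_def)
    finally show ?thesis by simp
  qed
  define M where "M = (\<Sum>l\<in>Zk 0. norm (f l)) + D / (1 - q)"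
  have bound: "(\<Sum>l\<in>Zk k. norm (f l)) \<le> M" for k
  proof -
    have "(\<Sum>l\<in>Zk k. norm (f l)) \<le> (\<Sum>l\<in>Zk 0. norm (f l)) + D * (\<Sum>j<k. q ^ j)"
    proof (induction k)
      case (Suc k)
      then show ?case using step[of k] by (simp add: algebra_simps)
    qed simp
    also have "D * (\<Sum>j<k. q ^ j) \<le> D * (1 / (1 - q))"
    proof (rule mult_left_mono[OF _ D0])
      have "(\<Sum>j<k. q ^ j) \<le> (\<Sum>j. q ^ j)"
        using q by (intro sum_le_suminf summable_geometric) auto
      then show "(\<Sum>j<k. q ^ j) \<le> 1 / (1 - q)" using q by (simp add: suminf_geometric)
    qed
    finally show ?thesis by (simp add: M_def)
  qed
  have e0: "e \<longlonglongrightarrow> 0" unfolding e_def[abs_def] by (rule LIMSEQ_realpow_zero) auto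
  have exhaust: "\<exists>k0. \<forall>k\<ge>k0. F \<subseteq> Zk k" if "finite F" "F \<subseteq> Z" for F
  proof -
    have "\<forall>\<^sub>F k in sequentially. \<forall>l\<in>F. e k \<le> norm l"
    proof (rule eventually_ball_finite[OF that(1)], rule ballI)
      fix l assume "l \<in> F"
      then have "0 < norm l" using that(2) by (auto simp: Z_def)
      from order_tendstoD(2)[OF e0 this] show "\<forall>\<^sub>F k in sequentially. e k \<le> norm l"
        by (rule eventually_mono) simp
    qed
    then show ?thesis using that(2) unfolding eventually_sequentially Zk_def by blast
  qed
  have "(\<lambda>l. norm (f l)) summable_on Z"
  proof (rule nonneg_bdd_above_summable_on)
    show "bdd_above (sum (\<lambda>l. norm (f l)) ` {F. F \<subseteq> Z \<and> finite F})"
    proof (rule bdd_aboveI2)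
      fix F assume "F \<in> {F. F \<subseteq> Z \<and> finite F}"
      then obtain k where "F \<subseteq> Zk k" using exhaust[of F] by auto
      then have "sum (\<lambda>l. norm (f l)) F \<le> (\<Sum>l\<in>Zk k. norm (f l))"
        using finZk by (intro sum_mono2) auto
      then show "sum (\<lambda>l. norm (f l)) F \<le> M" using bound[of k] by simp
    qed
  qed simp
  then have "f summable_on Z" by (rule abs_summable_summable)
  then obtain t where t: "(f has_sum t) Z" by (auto simp: summable_on_def)
  \<comment> \<open>Unconditional summability is known here, so the limit may be taken along the
    exhausting finite sets \<open>Zk\<close>, where the spectral approximation identifies
    it.\<close>
  have "filterlim Zk (finite_subsets_at_top Z) sequentially"
    unfolding filterlim_finite_subsets_at_top
  proof (intro allI impI)
    fix X assume "finite X \<and> X \<subseteq> Z"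
    then obtain k0 where "\<forall>k\<ge>k0. X \<subseteq> Zk k" using exhaust by blast
    then show "\<forall>\<^sub>F k in sequentially. finite (Zk k) \<and> X \<subseteq> Zk k \<and> Zk k \<subseteq> Z"
      using finZk unfolding eventually_sequentially by (intro exI[of _ k0]) (auto simp: Zk_def)
  qed
  then have "(\<lambda>k. sum f (Zk k)) \<longlonglongrightarrow> t"
    using t unfolding has_sum_def by (rule filterlim_compose[rotated])
  moreover have "(\<lambda>k. sum f (Zk k)) \<longlonglongrightarrow> (\<Sum>i. A i i)"
  proof -
    have g0: "(\<lambda>k. 2 * (2 powr s * q ^ k * growth + e k)) \<longlonglongrightarrow> 2 * (2 powr s * 0 * growth + 0)"
      using q by (intro tendsto_intros e0 LIMSEQ_realpow_zero) auto
    have le: "norm (sum f (Zk k) - (\<Sum>i. A i i)) \<le> 2 * (2 powr s * q ^ k * growth + e k)" for k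
    proof -
      have "norm (sum f (Zk k) - (\<Sum>i. A i i)) \<le> 2 * ((2 / e k) powr s * growth + 1) * e k"
        unfolding sum_Zk using L(4)[of k] by (simp add: norm_minus_commute)
      also have "\<dots> = 2 * (((2 / e k) powr s * e k) * growth + e k)" by (simp add: algebra_simps)
      also have "\<dots> = 2 * (2 powr s * q ^ k * growth + e k)" by (subst e_powr) simp_all
      finally show ?thesis .
    qed
    have "(\<lambda>k. sum f (Zk k) - (\<Sum>i. A i i)) \<longlonglongrightarrow> 0"
      by (rule Lim_null_comparison[OF always_eventually[OF allI[OF le]]]) (use g0 in simp)
    then show ?thesis by (rule LIM_zero_cancel)
  qed
  ultimately have "t = (\<Sum>i. A i i)" by (rule LIMSEQ_unique)
  then show ?thesis using t unfolding f_def[abs_def] Z_def by simp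
qed

end

section \<open>Fourier coefficients of periodic functions\<close>

no_notation vec_index (infixl "$" 100) and fps_nth (infixl "$" 75)

lemma mem_unit_cube: "x \<in> unit_cube \<longleftrightarrow> (\<forall>i. 0 \<le> x $ i \<and> x $ i \<le> 1)"
proof -
  have "x \<in> unit_cube \<longleftrightarrow> (\<forall>b\<in>Basis. 0 \<le> x \<bullet> b \<and> x \<bullet> b \<le> 1)"
    unfolding unit_cube_def mem_box by simp
  also have "\<dots> \<longleftrightarrow> (\<forall>i. 0 \<le> x $ i \<and> x $ i \<le> 1)"
    by (auto simp: Basis_vec_def inner_axis)
  finally show ?thesis .
qed

lemma continuous_integrable_unit_cube:
  fixes f :: "real ^ 'n \<Rightarrow> 'b::banach"
  shows "continuous_on UNIV f \<Longrightarrow> f integrable_on unit_cube"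
  unfolding unit_cube_def by (intro integrable_continuous) (rule continuous_on_subset, auto)

lemma measure_unit_cube: "integral unit_cube (\<lambda>_. c) = (c :: 'a::euclidean_space)"
  unfolding unit_cube_def by (simp add: content_cbox_if prod.neutral)

lemma int_vec_axis: "int_vec (axis j 1) = axis j 1"
  unfolding int_vec_def axis_def by (auto simp: Finite_Cartesian_Product.vec_eq_iff)

text \<open>A translated cube differs from the cube by a slab, which periodicity moves back.\<close>
lemma integral_periodic_translate_01:
  fixes g :: "real ^ 'n \<Rightarrow> complex"
  assumes cont: "continuous_on UNIV g" and per: "periodic_fun g" and t: "0 \<le> t" "t \<le> 1"
  shows "integral unit_cube (\<lambda>x. g (x + t *\<^sub>R axis j 1)) = integral unit_cube g"
proof -
  \<comment> \<open>Boxes that vary in direction \<open>j\<close> only; the unit cube is the case a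
    = 0, b = 1.\<close>
  define slab :: "real \<Rightarrow> real \<Rightarrow> (real ^ 'n) set" where
    "slab a b = cbox (\<chi> i. if i = j then a else 0) (\<chi> i. if i = j then b else 1)" for a b
  have mem: "x \<in> slab a b \<longleftrightarrow> a \<le> x $ j \<and> x $ j \<le> b \<and> (\<forall>i. i \<noteq> j \<longrightarrow> 0 \<le> x $ i \<and> x $ i \<le> 1)" for x a b
    unfolding slab_def mem_box_cart by (auto split: if_splits)
  have cube: "unit_cube = slab 0 1"
  proof -
    have all: "(\<forall>i. Q i) \<longleftrightarrow> Q j \<and> (\<forall>i. i \<noteq> j \<longrightarrow> Q i)" for Q :: "'n \<Rightarrow> bool" by metis
    have "x \<in> unit_cube \<longleftrightarrow> x \<in> slab 0 1" for x
      unfolding mem mem_unit_cube using all[of "\<lambda>i. 0 \<le> x $ i \<and> x $ i \<le> 1"] by simp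
    then show ?thesis by (simp add: set_eq_iff)
  qed
  have int: "g integrable_on slab a b" for a b
    unfolding slab_def using cont by (intro integrable_continuous) (rule continuous_on_subset, auto)
  have split: "integral (slab a c) g = integral (slab a b) g + integral (slab b c) g" if "a \<le> b" "b \<le> c" for a b c
  proof -
    have 1: "slab a c \<inter> {x. x \<bullet> axis j 1 \<le> b} = slab a b"
      using that by (auto simp: mem inner_axis)
    have 2: "slab a c \<inter> {x. x \<bullet> axis j 1 \<ge> b} = slab b c"
      using that by (auto simp: mem inner_axis)
    have "(g has_integral (integral (slab a b) g + integral (slab b c) g)) (slab a c)"
      unfolding slab_def[of a c]
    proof (rule has_integral_split[where k = "axis j 1" and c = b], fold slab_def)
      show "(g has_integral integral (slab a b) g) (slab a c \<inter> {x. x \<bullet> axis j 1 \<le> b})"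
        unfolding 1 by (rule integrable_integral[OF int])
      show "(g has_integral integral (slab b c) g) (slab a c \<inter> {x. b \<le> x \<bullet> axis j 1})"
        unfolding 2 by (rule integrable_integral[OF int])
    qed (simp add: axis_in_Basis_iff)
    then show ?thesis by (rule integral_unique)
  qed
  have shift: "integral (slab a b) (\<lambda>x. g (x + s *\<^sub>R axis j 1)) = integral (slab (a + s) (b + s)) g" for a b s
  proof -
    have "(\<chi> i. if i = j then a + s else 0) - s *\<^sub>R axis j 1 = (\<chi> i. if i = j then a else (0::real))"
         "(\<chi> i. if i = j then b + s else 1) - s *\<^sub>R axis j 1 = (\<chi> i. if i = j then b else (1::real))"
      by (auto simp: Finite_Cartesian_Product.vec_eq_iff axis_def)
    then show ?thesis
      using integral_shift_cbox[of "\<chi> i. if i = j then a + s else 0" "s *\<^sub>R axis j 1" "\<chi> i. if i = j then b + s else 1" g]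
      by (simp add: slab_def)
  qed
  have "g (x + 1 *\<^sub>R axis j 1) = g x" for x
    using per unfolding periodic_fun_def by (metis int_vec_axis scaleR_one)
  then have wrap: "integral (slab 1 (1 + t)) g = integral (slab 0 t) g"
    using shift[of 0 t 1] by (simp add: add.commute)
  have "integral unit_cube (\<lambda>x. g (x + t *\<^sub>R axis j 1)) = integral (slab t (1 + t)) g"
    unfolding cube using shift[of 0 1 t] by simp
  also have "\<dots> = integral (slab t 1) g + integral (slab 1 (1 + t)) g"
    by (rule split) (use t in auto)
  also have "\<dots> = integral (slab 0 t) g + integral (slab t 1) g" unfolding wrap by simp
  also have "\<dots> = integral unit_cube g" unfolding cube by (rule split[symmetric]) (use t in auto)
  finally show ?thesis .
qed

text \<open>A negative \<open>t\<close> is replaced by t + 1. Both signs are wanted because the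
  translate is differentiated at t = 0.\<close>

lemma integral_periodic_translate:
  fixes g :: "real ^ 'n \<Rightarrow> complex"
  assumes cont: "continuous_on UNIV g" and per: "periodic_fun g" and t: "\<bar>t\<bar> \<le> 1"
  shows "integral unit_cube (\<lambda>x. g (x + t *\<^sub>R axis j 1)) = integral unit_cube g"
proof (cases "0 \<le> t")
  case True
  then show ?thesis using integral_periodic_translate_01[OF cont per] t by simp
next
  case False
  have "g (x + t *\<^sub>R axis j 1) = g (x + (t + 1) *\<^sub>R axis j 1)" for x
  proof -
    have "g (x + t *\<^sub>R axis j 1) = g (x + t *\<^sub>R axis j 1 + int_vec (axis j 1))"
      using per unfolding periodic_fun_def by simp
    then show ?thesis by (simp add: int_vec_axis scaleR_left_distrib add.assoc)
  qed
  then show ?thesis using integral_periodic_translate_01[OF cont per, of "t + 1" j] t False by simp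
qed

text \<open>The integral of the translate by \<open>t\<close> in direction \<open>j\<close> does not
  depend on \<open>t\<close>; differentiation under the integral sign at t = 0 gives the
  claim.\<close>

lemma integral_pdx_zero:
  fixes g :: "real ^ 'n \<Rightarrow> complex"
  assumes cont: "continuous_on UNIV g" and per: "periodic_fun g"
    and der: "\<And>x. (\<lambda>t::real. g (x + t *\<^sub>R axis j 1)) differentiable (at 0)"
    and cont': "continuous_on UNIV (pdx j g)"
  shows "integral unit_cube (pdx j g) = 0"
proof -
  \<comment> \<open>Open, so that the derivative within \<open>U\<close> at 0 is the ordinary one,
    and inside [-1, 1], where the translation lemma applies.\<close>
  define U :: "real set" where "U = {-1<..<1}"
  have der': "((\<lambda>t. g (x + t *\<^sub>R axis j 1)) has_vector_derivative pdx j g (x + t *\<^sub>R axis j 1)) (at t within U)" for x t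
  proof -
    have "((\<lambda>s. g ((x + t *\<^sub>R axis j 1) + s *\<^sub>R axis j 1)) has_vector_derivative pdx j g (x + t *\<^sub>R axis j 1)) (at 0)"
      unfolding pdx_def using der by (simp add: vector_derivative_works)
    then have "((\<lambda>s. g ((x + t *\<^sub>R axis j 1) + (s - t) *\<^sub>R axis j 1)) has_vector_derivative 1 *\<^sub>R pdx j g (x + t *\<^sub>R axis j 1)) (at t)"
      by (intro vector_diff_chain_at[of "\<lambda>s. s - t" 1 t, unfolded o_def]) (auto intro!: derivative_eq_intros)
    then have "((\<lambda>s. g (x + s *\<^sub>R axis j 1)) has_vector_derivative pdx j g (x + t *\<^sub>R axis j 1)) (at t)"
      by (simp add: algebra_simps)
    then show ?thesis by (rule has_vector_derivative_at_within)
  qed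
  have c1: "continuous_on S (\<lambda>y. g (f y))" if "continuous_on S f" for S :: "'z::topological_space set" and f
    by (rule continuous_on_compose2[OF cont that]) simp
  have c2: "continuous_on S (\<lambda>y. pdx j g (f y))" if "continuous_on S f" for S :: "'z::topological_space set" and f
    by (rule continuous_on_compose2[OF cont' that]) simp
  have "((\<lambda>t. integral (cbox 0 One) (\<lambda>x. g (x + t *\<^sub>R axis j 1))) has_vector_derivative
      integral (cbox 0 One) (\<lambda>x. pdx j g (x + 0 *\<^sub>R axis j 1))) (at 0 within U)"
  proof (rule leibniz_rule_vector_derivative)
    show "(\<lambda>x. g (x + t *\<^sub>R axis j 1)) integrable_on cbox 0 One" for t
      by (intro integrable_continuous c1 continuous_intros)
    show "continuous_on (U \<times> cbox 0 One) (\<lambda>(t, x). pdx j g (x + t *\<^sub>R axis j 1))"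
      unfolding split_beta by (intro c2 continuous_intros)
  qed (auto simp: U_def intro: der'[unfolded U_def])
  then have "((\<lambda>t. integral unit_cube (\<lambda>x. g (x + t *\<^sub>R axis j 1))) has_vector_derivative
      integral unit_cube (pdx j g)) (at 0 within U)" by (simp add: unit_cube_def)
  then have "((\<lambda>t. integral unit_cube g) has_vector_derivative integral unit_cube (pdx j g)) (at 0 within U)"
    by (rule has_vector_derivative_transform[rotated 2])
       (auto simp: U_def integral_periodic_translate[OF cont per])
  moreover have "at 0 within U = at 0" by (rule at_within_open) (simp_all add: U_def)
  ultimately have "((\<lambda>t. integral unit_cube g) has_vector_derivative integral unit_cube (pdx j g)) (at 0)"
    by simp
  then show ?thesis by (rule vector_derivative_unique_at[OF _ has_vector_derivative_const])
qed

section \<open>Characters and integration by parts\<close>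

definition character :: "int ^ 'n \<Rightarrow> real ^ 'n \<Rightarrow> complex" where
  "character \<xi> x = cis (2 * pi * dotZ x \<xi>)"

lemma dotZ_add_left: "dotZ (x + y) \<xi> = dotZ x \<xi> + dotZ y \<xi>"
  by (simp add: dotZ_def sum.distrib distrib_right)

lemma dotZ_uminus: "dotZ x (- \<xi>) = - dotZ x \<xi>"
  by (simp add: dotZ_def sum_negf)

lemma dotZ_add_right: "dotZ x (\<xi> + \<eta>) = dotZ x \<xi> + dotZ x \<eta>"
  by (simp add: dotZ_def sum.distrib distrib_left)

lemma dotZ_axis: "dotZ (t *\<^sub>R axis j 1) \<xi> = t * of_int (\<xi> $ j)"
proof -
  have "dotZ (t *\<^sub>R axis j 1) \<xi> = (\<Sum>i\<in>UNIV. if i = j then t * of_int (\<xi> $ j) else 0)"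
    unfolding dotZ_def by (rule sum.cong) (auto simp: axis_def)
  then show ?thesis by simp
qed

lemma continuous_on_dotZ [continuous_intros]: "continuous_on S (\<lambda>x. dotZ x \<xi>)"
  unfolding dotZ_def by (intro continuous_intros)

lemma continuous_on_character: "continuous_on S (character \<xi>)"
  unfolding character_def[abs_def] by (intro continuous_intros)

lemma norm_character [simp]: "norm (character \<xi> x) = 1"
  by (simp add: character_def)

lemma character_add: "character (\<xi> + \<eta>) x = character \<xi> x * character \<eta> x"
  by (simp add: character_def dotZ_add_right distrib_left cis_mult)

lemma character_translate: "character \<xi> (x + y) = character \<xi> x * character \<xi> y"
  by (simp add: character_def dotZ_add_left distrib_left cis_mult)

lemma character_int_vec: "character \<xi> (int_vec k) = 1"
proof -
  have "dotZ (int_vec k) \<xi> = of_int (\<Sum>i\<in>UNIV. k $ i * \<xi> $ i)"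
    by (simp add: dotZ_def int_vec_def)
  then show ?thesis unfolding character_def by (metis cis_multiple_2pi Ints_of_int)
qed

lemma periodic_character: "periodic_fun (character \<xi>)"
  by (simp add: periodic_fun_def character_translate character_int_vec)

lemma periodic_mult: "periodic_fun f \<Longrightarrow> periodic_fun g \<Longrightarrow> periodic_fun (\<lambda>x. f x * g x :: complex)"
  by (simp add: periodic_fun_def)

lemma fhat_character_form: "fhat f \<xi> = integral unit_cube (\<lambda>x. character (- \<xi>) x * f x)"
  by (simp add: fhat_def character_def dotZ_uminus)

text \<open>Translation by half a period in a direction of nonzero frequency changes the sign of the
  character but not its integral. Half a period is at most 1/2, since the frequency is an
  integer.\<close>

lemma integral_character: "integral unit_cube (character \<xi>) = (if \<xi> = 0 then 1 else 0)"
proof (cases "\<xi> = 0")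
  case True
  then have "character \<xi> = (\<lambda>_. 1)" by (auto simp: character_def dotZ_def)
  then show ?thesis using True measure_unit_cube[of "1::complex"] by simp
next
  case False
  then obtain j where j: "\<xi> $ j \<noteq> 0" by (auto simp: Finite_Cartesian_Product.vec_eq_iff)
  define t where "t = 1 / (2 * real_of_int (\<xi> $ j))"
  have "\<bar>real_of_int (\<xi> $ j)\<bar> \<ge> 1" using j by linarith
  then have t: "\<bar>t\<bar> \<le> 1" by (simp add: t_def abs_mult divide_le_eq)
  have "character \<xi> (t *\<^sub>R axis j 1) = -1"
    unfolding character_def dotZ_axis using j by (simp add: t_def)
  then have "character \<xi> (x + t *\<^sub>R axis j 1) = - character \<xi> x" for x by (simp add: character_translate)
  then have "- integral unit_cube (character \<xi>) = integral unit_cube (character \<xi>)"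
    using integral_periodic_translate[OF continuous_on_character periodic_character t, of \<xi> j]
    by (simp add: integral_neg)
  then show ?thesis using False by (simp add: equation_minus_iff)
qed

lemma fhat_character_mult: "fhat (\<lambda>x. character \<xi> x * f x) \<eta> = fhat f (\<eta> - \<xi>)"
  unfolding fhat_character_form
  by (rule integral_cong) (simp add: character_add[symmetric] mult.assoc[symmetric])

lemma fhat_character: "fhat (character \<xi>) \<eta> = (if \<eta> = \<xi> then 1 else 0)"
proof -
  have "fhat (character \<xi>) \<eta> = integral unit_cube (character (\<xi> - \<eta>))"
    unfolding fhat_character_form by (rule integral_cong) (simp add: character_add[symmetric])
  then show ?thesis by (auto simp: integral_character)
qed

text \<open>The derivative of the character times \<open>f\<close> has integral zero; the product
  rule reads this as an integration by parts without boundary terms.\<close>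

lemma fhat_pdx:
  assumes cont: "continuous_on UNIV f" and per: "periodic_fun f"
    and der: "\<And>x. (\<lambda>t::real. f (x + t *\<^sub>R axis j 1)) differentiable (at 0)"
    and cont': "continuous_on UNIV (pdx j f)"
  shows "fhat (pdx j f) \<xi> = 2 * pi * \<i> * of_int (\<xi> $ j) * fhat f \<xi>"
proof -
  define g where "g x = character (- \<xi>) x * f x" for x
  define c where "c = - (2 * pi * \<i> * of_int (\<xi> $ j))"
  have dg: "((\<lambda>t::real. g (x + t *\<^sub>R axis j 1)) has_vector_derivative
      character (- \<xi>) x * pdx j f x + c * g x) (at 0)" for x
  proof -
    have f: "((\<lambda>t::real. f (x + t *\<^sub>R axis j 1)) has_vector_derivative pdx j f x) (at 0)"
      unfolding pdx_def using der by (simp add: vector_derivative_works)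
    have "((\<lambda>t::real. exp (c * of_real t)) has_vector_derivative c) (at 0)"
      by (rule has_vector_derivative_real_field[THEN has_vector_derivative_eq_rhs])
         (auto intro!: derivative_eq_intros)
    moreover have "character (- \<xi>) (t *\<^sub>R axis j 1) = exp (c * of_real t)" for t
      unfolding character_def dotZ_axis cis_conv_exp c_def by (simp add: algebra_simps)
    ultimately have "((\<lambda>t::real. character (- \<xi>) (t *\<^sub>R axis j 1)) has_vector_derivative c) (at 0)" by simp
    from has_vector_derivative_mult[OF this f]
    have "((\<lambda>t::real. character (- \<xi>) (t *\<^sub>R axis j 1) * f (x + t *\<^sub>R axis j 1)) has_vector_derivative
        pdx j f x + c * f x) (at 0)" by (simp add: character_def dotZ_def)
    from has_vector_derivative_mult_right[OF this, of "character (- \<xi>) x"]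
    show ?thesis by (simp add: g_def character_translate algebra_simps)
  qed
  then have pg: "pdx j g x = character (- \<xi>) x * pdx j f x + c * g x" for x
    unfolding pdx_def[of j g] by (rule vector_derivative_at)
  have contg: "continuous_on UNIV g"
    unfolding g_def by (intro continuous_intros cont continuous_on_character)
  have contp: "continuous_on UNIV (\<lambda>x. character (- \<xi>) x * pdx j f x)"
    by (intro continuous_intros cont' continuous_on_character)
  have "integral unit_cube (pdx j g) = 0"
  proof (rule integral_pdx_zero[OF contg])
    show "periodic_fun g" unfolding g_def by (intro periodic_mult periodic_character per)
    show "(\<lambda>t::real. g (x + t *\<^sub>R axis j 1)) differentiable at 0" for x
      using dg by (rule differentiableI_vector)
    show "continuous_on UNIV (pdx j g)"
      unfolding pg by (intro continuous_intros contg contp)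
  qed
  also have "integral unit_cube (pdx j g) = fhat (pdx j f) \<xi> + c * fhat f \<xi>"
    unfolding pg fhat_character_form
    by (subst integral_add)
       (auto simp: g_def[symmetric] intro!: continuous_integrable_unit_cube contp continuous_intros contg)
  finally show ?thesis by (simp add: c_def add_eq_0_iff)
qed

lemma periodic_pdx:
  assumes "periodic_fun f" shows "periodic_fun (pdx j f)"
  unfolding periodic_fun_def
proof (intro allI)
  fix x k
  have "f (x + int_vec k + t *\<^sub>R axis j 1) = f (x + t *\<^sub>R axis j 1)" for t
  proof -
    have "x + int_vec k + t *\<^sub>R axis j 1 = (x + t *\<^sub>R axis j 1) + int_vec k" by (simp add: algebra_simps)
    then show ?thesis using assms unfolding periodic_fun_def by metis
  qed
  then show "pdx j f (x + int_vec k) = pdx j f x" by (simp add: pdx_def)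
qed

lemma norm_integral_unit_cube_le:
  fixes f :: "real ^ 'n \<Rightarrow> complex"
  assumes "f integrable_on unit_cube" "\<And>x. norm (f x) \<le> C"
  shows "norm (integral unit_cube f) \<le> C"
proof -
  have "norm (integral unit_cube f) \<le> integral unit_cube (\<lambda>_::real^'n. C)"
    using assms by (intro integral_norm_bound_integral) (auto simp: unit_cube_def)
  then show ?thesis by (simp add: measure_unit_cube)
qed

lemma norm_fhat_le:
  assumes "continuous_on UNIV f" "\<And>x. norm (f x) \<le> C"
  shows "norm (fhat f \<xi>) \<le> C"
  unfolding fhat_character_form using assms
  by (intro norm_integral_unit_cube_le continuous_integrable_unit_cube continuous_intros continuous_on_character)
     (auto simp: norm_mult)

lemma fhat_pdiffs:
  assumes "smooth_fun f" "periodic_fun f"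
  shows "periodic_fun (pdiffs (replicate n j) f) \<and> fhat (pdiffs (replicate n j) f) \<xi> = (2 * pi * \<i> * of_int (\<xi> $ j)) ^ n * fhat f \<xi>"
proof (induction n)
  case (Suc n)
  let ?f = "pdiffs (replicate n j) f"
  have "fhat (pdx j ?f) \<xi> = 2 * pi * \<i> * of_int (\<xi> $ j) * fhat ?f \<xi>"
  proof (rule fhat_pdx)
    show "continuous_on UNIV ?f" using assms(1) unfolding smooth_fun_def by blast
    show "(\<lambda>t. ?f (x + t *\<^sub>R axis j 1)) differentiable at 0" for x using assms(1) unfolding smooth_fun_def by blast
    have "continuous_on UNIV (pdiffs (j # replicate n j) f)" using assms(1) unfolding smooth_fun_def by blast
    then show "continuous_on UNIV (pdx j ?f)" by simp
  qed (use Suc in simp)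
  then show ?case using Suc by (simp add: periodic_pdx mult_ac)
qed (simp add: assms)

section \<open>Lattice sums and decay of symbol coefficients\<close>

lemma has_sum_finite_sum:
  fixes f :: "'i \<Rightarrow> 'a \<Rightarrow> 'b::topological_comm_monoid_add"
  assumes "\<And>i. i \<in> I \<Longrightarrow> (f i has_sum S i) A"
  shows "((\<lambda>x. \<Sum>i\<in>I. f i x) has_sum (\<Sum>i\<in>I. S i)) A"
  using assms by (induction I rule: infinite_finite_induct) (auto intro: has_sum_add)

lemma has_sum_diff:
  fixes f g :: "'a \<Rightarrow> 'b::topological_ab_group_add"
  assumes "(f has_sum a) A" "(g has_sum b) A"
  shows "((\<lambda>x. f x - g x) has_sum (a - b)) A"
  using has_sum_add[where f = f and a = a and A = A and g = "\<lambda>x. - g x" and b = "- b"] assms by (simp add: has_sum_uminus)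


text \<open>The M-test along \<open>finite_subsets_at_top\<close> gives continuity and termwise
  integration without ordering the index set.\<close>

lemma uniform_series:
  fixes g :: "'i \<Rightarrow> real ^ 'n \<Rightarrow> complex"
  assumes cont: "\<And>i. continuous_on UNIV (g i)" and le: "\<And>i x. norm (g i x) \<le> b i" and b: "b summable_on UNIV"
  shows "continuous_on UNIV (\<lambda>x. \<Sum>\<^sub>\<infinity>i. g i x)"
    and "((\<lambda>i. integral unit_cube (g i)) has_sum integral unit_cube (\<lambda>x. \<Sum>\<^sub>\<infinity>i. g i x)) UNIV"
proof -
  have ul: "uniform_limit S (\<lambda>X x. \<Sum>i\<in>X. g i x) (\<lambda>x. \<Sum>\<^sub>\<infinity>i. g i x) (finite_subsets_at_top UNIV)" for S
    by (rule Weierstrass_m_test_general[OF _ b]) (rule le)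
  have cs: "continuous_on S (\<lambda>x. \<Sum>i\<in>X. g i x)" for S X
    by (intro continuous_on_sum continuous_on_subset[OF cont]) simp
  show "continuous_on UNIV (\<lambda>x. \<Sum>\<^sub>\<infinity>i. g i x)"
    by (rule uniform_limit_theorem[OF _ ul]) (auto intro: always_eventually cs)
  obtain I J where I: "\<And>X. ((\<lambda>x. \<Sum>i\<in>X. g i x) has_integral I X) (cbox 0 One)"
    and J: "((\<lambda>x. \<Sum>\<^sub>\<infinity>i. g i x) has_integral J) (cbox 0 One)"
    and lim: "(I \<longlongrightarrow> J) (finite_subsets_at_top UNIV)"
    by (rule uniform_limit_integral_cbox[OF ul cs]) auto
  have "I X = (\<Sum>i\<in>X. integral unit_cube (g i))" if "finite X" for X
  proof -
    have "((\<lambda>x. \<Sum>i\<in>X. g i x) has_integral (\<Sum>i\<in>X. integral unit_cube (g i))) (cbox 0 One)"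
      using that continuous_integrable_unit_cube[OF cont]
      unfolding unit_cube_def by (intro has_integral_sum integrable_integral) auto
    then show ?thesis using I has_integral_unique by blast
  qed
  then have "\<forall>\<^sub>F X in finite_subsets_at_top UNIV. I X = (\<Sum>i\<in>X. integral unit_cube (g i))"
    by (rule eventually_finite_subsets_at_top_weakI)
  then have "((\<lambda>X. \<Sum>i\<in>X. integral unit_cube (g i)) \<longlongrightarrow> J) (finite_subsets_at_top UNIV)"
    by (rule Lim_transform_eventually[OF lim])
  then show "((\<lambda>i. integral unit_cube (g i)) has_sum integral unit_cube (\<lambda>x. \<Sum>\<^sub>\<infinity>i. g i x)) UNIV"
    using J unfolding has_sum_def unit_cube_def by (simp add: integral_unique)
qed

lemma fhat_uniform_series:
  fixes g :: "'i \<Rightarrow> real ^ 'n \<Rightarrow> complex"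
  assumes cont: "\<And>i. continuous_on UNIV (g i)" and le: "\<And>i x. norm (g i x) \<le> b i" and b: "b summable_on UNIV"
  shows "((\<lambda>i. fhat (g i) \<eta>) has_sum fhat (\<lambda>x. \<Sum>\<^sub>\<infinity>i. g i x) \<eta>) UNIV"
proof -
  have "((\<lambda>i. integral unit_cube (\<lambda>x. character (- \<eta>) x * g i x)) has_sum
      integral unit_cube (\<lambda>x. \<Sum>\<^sub>\<infinity>i. character (- \<eta>) x * g i x)) UNIV"
    by (rule uniform_series(2)[OF _ _ b])
       (auto simp: norm_mult le intro!: continuous_intros cont continuous_on_character)
  then show ?thesis unfolding fhat_character_form by (simp add: infsum_cmult_right')
qed

section \<open>Weights on the frequency lattice\<close>

lemma jbr_ge_1: "1 \<le> jbr \<xi>"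
  by (simp add: jbr_def)

lemma jbr_square: "(jbr \<xi>)\<^sup>2 = 1 + (\<Sum>j\<in>UNIV. (of_int (\<xi> $ j))\<^sup>2)"
proof -
  have "0 \<le> (\<Sum>j\<in>UNIV. (real_of_int (\<xi> $ j))\<^sup>2)" by (intro sum_nonneg) simp
  then show ?thesis unfolding jbr_def normZ_def by simp
qed

lemma jbr_component: "1 + (of_int (\<xi> $ j))\<^sup>2 \<le> (jbr \<xi>)\<^sup>2"
  unfolding jbr_square using member_le_sum[of j UNIV "\<lambda>j. (real_of_int (\<xi> $ j))\<^sup>2"] by simp

text \<open>Peetre's inequality with a generous constant. With \<eta> written as (\<eta> - \<xi>) +
  \<xi> it splits the Besov weight between the distance to the diagonal and the column
  index.\<close>

lemma jbr_add_le: "jbr (\<xi> + \<eta>) \<le> 2 * jbr \<xi> * jbr \<eta>"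
proof -
  define X Y where "X = (\<Sum>j\<in>UNIV. (real_of_int (\<xi> $ j))\<^sup>2)" and "Y = (\<Sum>j\<in>UNIV. (real_of_int (\<eta> $ j))\<^sup>2)"
  have XY: "0 \<le> X" "0 \<le> Y" unfolding X_def Y_def by (auto intro: sum_nonneg)
  have "(jbr (\<xi> + \<eta>))\<^sup>2 \<le> 1 + (\<Sum>j\<in>UNIV. 2 * (real_of_int (\<xi> $ j))\<^sup>2 + 2 * (real_of_int (\<eta> $ j))\<^sup>2)"
    unfolding jbr_square
  proof (intro add_left_mono sum_mono)
    fix j
    have "0 \<le> (real_of_int (\<xi> $ j) - real_of_int (\<eta> $ j))\<^sup>2" by simp
    then show "(real_of_int ((\<xi> + \<eta>) $ j))\<^sup>2 \<le> 2 * (real_of_int (\<xi> $ j))\<^sup>2 + 2 * (real_of_int (\<eta> $ j))\<^sup>2"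
      by (simp add: power2_eq_square algebra_simps)
  qed
  also have "\<dots> = 1 + 2 * X + 2 * Y" by (simp add: X_def Y_def sum.distrib sum_distrib_left)
  also have "\<dots> \<le> 4 * ((1 + X) * (1 + Y))"
  proof -
    have "4 * ((1 + X) * (1 + Y)) - (1 + 2 * X + 2 * Y) = 3 + 2 * X + 2 * Y + 4 * (X * Y)"
      by (simp add: algebra_simps)
    moreover have "0 \<le> X * Y" using XY by simp
    ultimately show ?thesis using XY by linarith
  qed
  also have "\<dots> = (2 * jbr \<xi> * jbr \<eta>)\<^sup>2" by (simp add: power_mult_distrib jbr_square X_def Y_def)
  finally show ?thesis
    by (rule power2_le_imp_le) (use jbr_ge_1[of \<xi>] jbr_ge_1[of \<eta>] in simp)
qed

text \<open>With r = s/n > 1, the bracket to the power -s is at most the product over the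
  coordinates of (1 + \<xi>_j^2)^(-r/2). Over a box the sum of such products is a product of
  one-dimensional sums, each bounded by a convergent p-series.\<close>

lemma summable_jbr:
  fixes s :: real
  assumes s: "real CARD('n) < s"
  shows "(\<lambda>\<xi> :: int ^ 'n. jbr \<xi> powr (- s)) summable_on UNIV"
proof -
  define n where "n = real CARD('n)"
  define r where "r = s / n"
  have n: "0 < n" by (simp add: n_def)
  have r: "1 < r" using s n by (simp add: r_def n_def)
  define g where "g k = (1 + (real_of_int k)\<^sup>2) powr (- r / 2)" for k
  have g0: "0 \<le> g k" for k by (simp add: g_def)
  \<comment> \<open>The value at 0 is set to 1, as \<open>0 powr (- r)\<close> is 0 while
    \<open>g 0\<close> is 1.\<close>
  define h where "h j = (if j = 0 then 1 else real j powr (- r))" for j :: nat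
  have gh: "g (int j) \<le> h j" for j
  proof (cases "j = 0")
    case False
    have "g (int j) \<le> ((real j)\<^sup>2) powr (- r / 2)"
      unfolding g_def using False r by (intro powr_mono2') auto
    also have "\<dots> = real j powr (- r)" using False by (simp add: powr_powr flip: powr_numeral)
    finally show ?thesis using False by (simp add: h_def)
  qed (simp add: g_def h_def)
  have "summable (\<lambda>j. real j powr (- r))" using r by (simp add: summable_real_powr_iff)
  then have h_sum: "summable h"
    by (rule summable_cong[THEN iffD1, rotated]) (auto simp: h_def eventually_at_top_linorder intro!: exI[of _ 1])
  have h0: "0 \<le> h j" for j by (simp add: h_def)
  define G where "G = 2 * suminf h"
  have g_le: "(\<Sum>k\<in>{-K..K}. g k) \<le> G" for K
  proof -
    let ?P = "int ` {..nat K}" and ?Q = "(\<lambda>j. - int j) ` {..nat K}"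
    have "k \<in> ?P \<union> ?Q" if "k \<in> {-K..K}" for k
    proof (cases "0 \<le> k")
      case True then show ?thesis using that by (intro UnI1 image_eqI[of _ _ "nat k"]) auto
    next
      case False then show ?thesis using that by (intro UnI2 image_eqI[of _ _ "nat (- k)"]) auto
    qed
    then have sub: "{-K..K} \<subseteq> ?P \<union> ?Q" by blast
    have "(\<Sum>k\<in>{-K..K}. g k) \<le> sum g (?P \<union> ?Q)"
      by (rule sum_mono2[OF _ sub]) (simp_all add: g0)
    also have "\<dots> \<le> sum g ?P + sum g ?Q"
      using sum.union_inter[of ?P ?Q g] sum_nonneg[of "?P \<inter> ?Q" g] g0 by simp
    also have "sum g ?P = (\<Sum>j\<le>nat K. g (int j))" by (subst sum.reindex) (auto simp: inj_on_def)
    also have "sum g ?Q = (\<Sum>j\<le>nat K. g (int j))"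
      by (subst sum.reindex) (auto simp: inj_on_def g_def)
    also have "(\<Sum>j\<le>nat K. g (int j)) \<le> suminf h"
      by (rule order.trans[OF sum_mono[OF gh] sum_le_suminf[OF h_sum]]) (auto simp: h0)
    finally show ?thesis by (simp add: G_def)
  qed
  have le: "jbr \<xi> powr (- s) \<le> (\<Prod>j\<in>UNIV. g (\<xi> $ j))" for \<xi> :: "int ^ 'n"
  proof -
    have "jbr \<xi> powr (- s) = (jbr \<xi> powr (- r)) ^ CARD('n)"
      using jbr_ge_1[of \<xi>] n by (subst powr_realpow[symmetric]) (auto simp: powr_powr r_def n_def)
    also have "\<dots> = (\<Prod>j\<in>(UNIV :: 'n set). jbr \<xi> powr (- r))" by simp
    also have "\<dots> \<le> (\<Prod>j\<in>UNIV. g (\<xi> $ j))"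
    proof (intro prod_mono conjI)
      fix j
      have "jbr \<xi> powr (- r) = ((jbr \<xi>)\<^sup>2) powr (- r / 2)"
        using jbr_ge_1[of \<xi>] by (simp add: powr_powr flip: powr_numeral)
      also have "\<dots> \<le> g (\<xi> $ j)"
        unfolding g_def using jbr_component[of \<xi> j] r by (intro powr_mono2') (auto simp: add_pos_nonneg)
      finally show "jbr \<xi> powr (- r) \<le> g (\<xi> $ j)" .
    qed simp
    finally show ?thesis .
  qed
  show ?thesis
  proof (rule nonneg_bdd_above_summable_on)
    show "bdd_above (sum (\<lambda>\<xi> :: int ^ 'n. jbr \<xi> powr (- s)) ` {F. F \<subseteq> UNIV \<and> finite F})"
    proof (rule bdd_aboveI2)
      fix F :: "(int ^ 'n) set" assume "F \<in> {F. F \<subseteq> UNIV \<and> finite F}"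
      then have F: "finite F" by simp
      \<comment> \<open>A crude half-width of a box that contains \<open>F\<close>.\<close>
      define K where "K = (\<Sum>\<xi>\<in>F. \<Sum>j\<in>UNIV. \<bar>\<xi> $ j\<bar>)"
      have K: "\<bar>\<xi> $ j\<bar> \<le> K" if "\<xi> \<in> F" for \<xi> j
      proof -
        have "\<bar>\<xi> $ j\<bar> \<le> (\<Sum>j\<in>UNIV. \<bar>\<xi> $ j\<bar>)" by (intro member_le_sum) auto
        also have "\<dots> \<le> K" unfolding K_def
          using that F by (intro member_le_sum[of \<xi> F "\<lambda>\<xi>. \<Sum>j\<in>UNIV. \<bar>\<xi> $ j\<bar>"]) (auto intro: sum_nonneg)
        finally show ?thesis .
      qed
      let ?B = "PiE (UNIV :: 'n set) (\<lambda>_. {-K..K})"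
      have inj: "inj_on (\<lambda>\<xi> :: int ^ 'n. (\<lambda>j. \<xi> $ j)) F"
        by (auto simp: inj_on_def Finite_Cartesian_Product.vec_eq_iff fun_eq_iff)
      have "sum (\<lambda>\<xi>. jbr \<xi> powr (- s)) F \<le> (\<Sum>\<xi>\<in>F. \<Prod>j\<in>UNIV. g (\<xi> $ j))"
        by (intro sum_mono le)
      also have "\<dots> = (\<Sum>f\<in>(\<lambda>\<xi> :: int ^ 'n. (\<lambda>j. \<xi> $ j)) ` F. \<Prod>j\<in>UNIV. g (f j))"
        by (subst sum.reindex[OF inj]) simp
      also have "\<dots> \<le> (\<Sum>f\<in>?B. \<Prod>j\<in>UNIV. g (f j))"
      proof (rule sum_mono2)
        show "finite ?B" by (intro finite_PiE) auto
        show "(\<lambda>\<xi> j. \<xi> $ j) ` F \<subseteq> ?B" using K by (force simp: abs_le_iff)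
      qed (auto intro!: prod_nonneg g0)
      also have "\<dots> = (\<Prod>j\<in>(UNIV :: 'n set). \<Sum>k\<in>{-K..K}. g k)"
        by (rule prod_sum_PiE[symmetric]) auto
      also have "\<dots> \<le> (\<Prod>j\<in>(UNIV :: 'n set). G)"
        by (intro prod_mono conjI g_le sum_nonneg g0)
      finally show "sum (\<lambda>\<xi>. jbr \<xi> powr (- s)) F \<le> G ^ CARD('n)" by simp
    qed
  qed simp
qed

text \<open>The square of the bracket is at most (n + 1) \<mu>, where \<mu> is the largest among 1
  and the squared components, and \<mu>^k is one of the summands on the right. Decay in all
  directions is thereby reduced to pure derivatives along single axes.\<close>

lemma jbr_power_le:
  fixes \<zeta> :: "int ^ 'n"
  shows "jbr \<zeta> ^ (2 * k) \<le> (real CARD('n) + 1) ^ k * (1 + (\<Sum>j\<in>UNIV. \<bar>real_of_int (\<zeta> $ j)\<bar> ^ (2 * k)))"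
proof -
  define S where "S = 1 + (\<Sum>j\<in>UNIV. \<bar>real_of_int (\<zeta> $ j)\<bar> ^ (2 * k))"
  define \<mu> where "\<mu> = Max (insert 1 ((\<lambda>j. (real_of_int (\<zeta> $ j))\<^sup>2) ` UNIV))"
  have mu: "1 \<le> \<mu>" "(real_of_int (\<zeta> $ j))\<^sup>2 \<le> \<mu>" for j
    unfolding \<mu>_def by (rule Max_ge, simp, simp)+
  have "\<mu> \<in> insert 1 ((\<lambda>j. (real_of_int (\<zeta> $ j))\<^sup>2) ` UNIV)" unfolding \<mu>_def by (intro Max_in) auto
  then have "\<mu> ^ k \<le> S"
  proof (elim insertE imageE)
    assume "\<mu> = 1"
    then show ?thesis unfolding S_def by (auto intro: sum_nonneg)
  next
    fix j assume "\<mu> = (real_of_int (\<zeta> $ j))\<^sup>2"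
    then have "\<mu> ^ k = \<bar>real_of_int (\<zeta> $ j)\<bar> ^ (2 * k)" by (simp add: power_mult)
    also have "\<dots> \<le> (\<Sum>j\<in>UNIV. \<bar>real_of_int (\<zeta> $ j)\<bar> ^ (2 * k))" by (rule member_le_sum) auto
    finally show ?thesis by (simp add: S_def)
  qed
  have "(jbr \<zeta>)\<^sup>2 \<le> \<mu> + (\<Sum>j\<in>(UNIV :: 'n set). \<mu>)"
    unfolding jbr_square by (intro add_mono sum_mono mu)
  then have "(jbr \<zeta>)\<^sup>2 \<le> (real CARD('n) + 1) * \<mu>" by (simp add: algebra_simps)
  then have "((jbr \<zeta>)\<^sup>2) ^ k \<le> ((real CARD('n) + 1) * \<mu>) ^ k" by (rule power_mono) simp
  also have "\<dots> \<le> (real CARD('n) + 1) ^ k * S"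
    unfolding power_mult_distrib using \<open>\<mu> ^ k \<le> S\<close> by (intro mult_left_mono) auto
  finally show ?thesis by (simp add: S_def power_mult)
qed

text \<open>Integration by parts \<open>2k\<close> times in each coordinate direction.\<close>
lemma symbol_coefficient_decay:
  fixes a :: "real ^ 'n \<Rightarrow> int ^ 'n \<Rightarrow> complex"
  assumes a: "symbol_class m \<rho> \<delta> (2 * k) a" and \<delta>: "0 \<le> \<delta>"
  obtains C where "0 \<le> C"
    "\<And>\<xi> \<zeta>. norm (fhat (\<lambda>x. a x \<xi>) \<zeta>) \<le> C * jbr \<zeta> powr (- (2 * real k)) * jbr \<xi> powr (m + 2 * real k * \<delta>)"
proof -
  define e where "e = m + 2 * real k * \<delta>"
  have per: "periodic_fun (\<lambda>x. a x \<xi>)" and smooth: "smooth_fun (\<lambda>x. a x \<xi>)" for \<xi>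
    using a by (auto simp: symbol_class_def)
  have ex: "\<exists>C. \<forall>x \<xi>. norm (pdiffs is (\<lambda>y. a y \<xi>) x) \<le> C * jbr \<xi> powr (m + \<delta> * real (length is))" if "length is \<le> 2 * k" for "is"
    using a that unfolding symbol_class_def by blast
  have "\<exists>C. \<forall>x \<xi>. norm (pdiffs (replicate (2 * k) j) (\<lambda>y. a y \<xi>) x) \<le> C * jbr \<xi> powr e" for j
    using ex[of "replicate (2 * k) j"] by (simp add: e_def mult_ac)
  then obtain D where D: "\<And>j x \<xi>. norm (pdiffs (replicate (2 * k) j) (\<lambda>y. a y \<xi>) x) \<le> D j * jbr \<xi> powr e" by metis
  obtain C0' where C0': "\<And>x \<xi>. norm (a x \<xi>) \<le> C0' * jbr \<xi> powr m" using ex[of "[]"] by auto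
  have pw: "0 < jbr \<xi> powr t" for \<xi> :: "int ^ 'n" and t using jbr_ge_1[of \<xi>] by simp
  \<comment> \<open>Nonnegativity of the constants is read off at frequency 0.\<close>
  have "0 \<le> C0' * jbr (0 :: int ^ 'n) powr m" by (rule order.trans[OF norm_ge_zero C0'])
  then have "0 \<le> C0'" using pw[of 0 m] by (simp only: zero_le_mult_iff) linarith
  have D0: "0 \<le> D j" for j
  proof -
    have "0 \<le> D j * jbr (0 :: int ^ 'n) powr e" by (rule order.trans[OF norm_ge_zero D])
    then show ?thesis using pw[of 0 e] by (simp only: zero_le_mult_iff) linarith
  qed
  define C1 where "C1 = C0' + (\<Sum>j\<in>UNIV. D j)"
  define C where "C = (real CARD('n) + 1) ^ k * C1"
  have C1: "0 \<le> C1" unfolding C1_def using \<open>0 \<le> C0'\<close> D0 by (intro add_nonneg_nonneg sum_nonneg)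
  have main: "norm (fhat (\<lambda>x. a x \<xi>) \<zeta>) \<le> C * jbr \<zeta> powr (- (2 * real k)) * jbr \<xi> powr e" for \<xi> \<zeta>
  proof -
    define h where "h = norm (fhat (\<lambda>x. a x \<xi>) \<zeta>)"
    have cont: "continuous_on UNIV (pdiffs is (\<lambda>y. a y \<xi>))" for "is"
      using smooth unfolding smooth_fun_def by blast
    \<comment> \<open>Order zero supplies the summand 1 in \<open>jbr_power_le\<close>; it is then
      weakened to the exponent \<open>e\<close>, which is at least \<open>m\<close>.\<close>
    have "h \<le> C0' * jbr \<xi> powr m"
      unfolding h_def using cont[of "[]"] C0' by (intro norm_fhat_le) auto
    also have "\<dots> \<le> C0' * jbr \<xi> powr e"
      using \<open>0 \<le> C0'\<close> \<delta> jbr_ge_1[of \<xi>] by (intro mult_left_mono powr_mono) (auto simp: e_def)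
    finally have h0: "h \<le> C0' * jbr \<xi> powr e" .
    have hj: "\<bar>real_of_int (\<zeta> $ j)\<bar> ^ (2 * k) * h \<le> D j * jbr \<xi> powr e" for j
    proof -
      have "norm (2 * complex_of_real pi * \<i> * of_int (\<zeta> $ j)) = 2 * pi * \<bar>real_of_int (\<zeta> $ j)\<bar>"
        by (simp add: norm_mult)
      then have "(2 * pi * \<bar>real_of_int (\<zeta> $ j)\<bar>) ^ (2 * k) * h = norm (fhat (pdiffs (replicate (2 * k) j) (\<lambda>x. a x \<xi>)) \<zeta>)"
        using fhat_pdiffs[OF smooth per, of "2 * k" j \<xi> \<zeta>] by (simp only: h_def norm_mult norm_power) (simp add: norm_mult)
      also have "\<dots> \<le> D j * jbr \<xi> powr e" by (intro norm_fhat_le cont D)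
      finally have 1: "(2 * pi * \<bar>real_of_int (\<zeta> $ j)\<bar>) ^ (2 * k) * h \<le> D j * jbr \<xi> powr e" .
      have "\<bar>real_of_int (\<zeta> $ j)\<bar> \<le> 2 * pi * \<bar>real_of_int (\<zeta> $ j)\<bar>"
        using pi_gt3 by (simp add: mult_le_cancel_right1)
      then have "\<bar>real_of_int (\<zeta> $ j)\<bar> ^ (2 * k) * h \<le> (2 * pi * \<bar>real_of_int (\<zeta> $ j)\<bar>) ^ (2 * k) * h"
        by (intro mult_right_mono power_mono) (auto simp: h_def)
      then show ?thesis using 1 by (rule order.trans)
    qed
    have "jbr \<zeta> ^ (2 * k) * h \<le> (real CARD('n) + 1) ^ k * (1 + (\<Sum>j\<in>UNIV. \<bar>real_of_int (\<zeta> $ j)\<bar> ^ (2 * k))) * h"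
      by (intro mult_right_mono jbr_power_le) (simp add: h_def)
    also have "\<dots> = (real CARD('n) + 1) ^ k * (h + (\<Sum>j\<in>UNIV. \<bar>real_of_int (\<zeta> $ j)\<bar> ^ (2 * k) * h))"
      by (simp add: algebra_simps sum_distrib_left)
    also have "\<dots> \<le> (real CARD('n) + 1) ^ k * (C0' * jbr \<xi> powr e + (\<Sum>j\<in>UNIV. D j * jbr \<xi> powr e))"
      by (intro mult_left_mono add_mono sum_mono h0 hj) auto
    also have "\<dots> = C * jbr \<xi> powr e" 
      by (simp only: C_def C1_def sum_distrib_right[symmetric] distrib_right[symmetric] mult.assoc)
    finally have *: "jbr \<zeta> ^ (2 * k) * h \<le> C * jbr \<xi> powr e" .
    have "jbr \<zeta> powr (- (2 * real k)) = inverse (jbr \<zeta> ^ (2 * k))"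
      using jbr_ge_1[of \<zeta>] by (simp add: powr_minus powr_realpow[symmetric])
    moreover have "0 < jbr \<zeta> ^ (2 * k)" using jbr_ge_1[of \<zeta>] by simp
    ultimately show ?thesis using * unfolding h_def by (simp add: field_simps)
  qed
  show ?thesis
  proof (rule that)
    show "0 \<le> C" unfolding C_def using C1 by simp
  qed (use main in \<open>simp add: e_def\<close>)
qed

section \<open>Periodic Besov spaces\<close>

lemma unit_cube_lebesgue: "unit_cube \<in> sets lebesgue"
  by (simp add: unit_cube_def)

lemma continuous_absolutely_integrable_unit_cube:
  fixes f :: "real ^ 'n \<Rightarrow> complex"
  assumes "continuous_on UNIV f"
  shows "f absolutely_integrable_on unit_cube"
  unfolding unit_cube_def
  by (rule absolutely_integrable_continuous) (rule continuous_on_subset[OF assms], simp)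

lemma absolutely_integrable_character_mult:
  fixes f :: "real ^ 'n \<Rightarrow> complex"
  assumes "f absolutely_integrable_on unit_cube"
  shows "(\<lambda>x. character \<xi> x * f x) absolutely_integrable_on unit_cube"
proof (rule absolutely_integrable_bounded_measurable_product[where h = "(*)" and f = "character \<xi>", OF _ _ unit_cube_lebesgue _ assms])
  show "bilinear ((*) :: complex \<Rightarrow> complex \<Rightarrow> complex)" by (rule bilinear_times)
  show "character \<xi> \<in> borel_measurable (lebesgue_on unit_cube)"
    by (rule continuous_imp_measurable_on_sets_lebesgue[OF continuous_on_character unit_cube_lebesgue])
  show "bounded (character \<xi> ` unit_cube)"
    by (rule boundedI[of _ 1]) auto
qed

lemma norm_fhat_le_L1:
  fixes f :: "real ^ 'n \<Rightarrow> complex"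
  assumes "f absolutely_integrable_on unit_cube"
  shows "norm (fhat f \<xi>) \<le> integral unit_cube (\<lambda>x. norm (f x))"
proof -
  note 1 = absolutely_integrable_character_mult[OF assms, of "- \<xi>"]
  have "norm (fhat f \<xi>) \<le> integral unit_cube (\<lambda>x. norm (character (- \<xi>) x * f x))"
    unfolding fhat_character_form using 1 unfolding absolutely_integrable_on_def
    by (intro integral_norm_bound_integral) auto
  then show ?thesis by (simp add: norm_mult)
qed

lemma fhat_add:
  assumes "f absolutely_integrable_on unit_cube" "g absolutely_integrable_on unit_cube"
  shows "fhat (\<lambda>x. f x + g x) \<xi> = fhat f \<xi> + fhat g \<xi>"
  unfolding fhat_character_form distrib_left using assms
  by (intro integral_add) (auto intro: absolutely_integrable_character_mult set_lebesgue_integral_eq_integral(1))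

lemma fhat_cmult: "fhat (\<lambda>x. c * f x) \<xi> = c * fhat f \<xi>"
  unfolding fhat_character_form mult.left_commute[of _ c] by (rule integral_mult_right)

lemma absolutely_integrable_cmult:
  fixes f :: "real ^ 'n \<Rightarrow> complex"
  assumes "f absolutely_integrable_on unit_cube"
  shows "(\<lambda>x. c * f x) absolutely_integrable_on unit_cube"
  using assms by (rule set_integrable_mult_right)

lemma absolutely_integrable_sum:
  fixes f :: "'i \<Rightarrow> real ^ 'n \<Rightarrow> complex"
  assumes "\<And>i. i \<in> I \<Longrightarrow> f i absolutely_integrable_on unit_cube"
  shows "(\<lambda>x. \<Sum>i\<in>I. f i x) absolutely_integrable_on unit_cube"
  using assms by (induction I rule: infinite_finite_induct) (auto intro: set_integral_add(1))

lemma fhat_sum: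
  assumes "\<And>i. i \<in> I \<Longrightarrow> f i absolutely_integrable_on unit_cube"
  shows "fhat (\<lambda>x. \<Sum>i\<in>I. c i * f i x) \<xi> = (\<Sum>i\<in>I. c i * fhat (f i) \<xi>)"
  using assms
proof (induction I rule: infinite_finite_induct)
  case (insert i I)
  then show ?case
    by (simp add: fhat_add absolutely_integrable_sum absolutely_integrable_cmult fhat_cmult)
qed (simp_all add: fhat_character_form)

lemma fhat_trig_poly:
  assumes "finite F"
  shows "fhat (\<lambda>x. \<Sum>\<xi>\<in>F. character \<xi> x * c \<xi>) \<eta> = (if \<eta> \<in> F then c \<eta> else 0)"
proof -
  have "fhat (\<lambda>x. \<Sum>\<xi>\<in>F. c \<xi> * character \<xi> x) \<eta> = (\<Sum>\<xi>\<in>F. c \<xi> * fhat (character \<xi>) \<eta>)"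
    by (rule fhat_sum) (intro continuous_absolutely_integrable_unit_cube continuous_on_character)
  also have "\<dots> = (\<Sum>\<xi>\<in>F. if \<xi> = \<eta> then c \<eta> else 0)"
    by (rule sum.cong) (auto simp: fhat_character)
  finally show ?thesis using assms by (simp add: mult.commute)
qed

lemma normZ_le_jbr: "normZ \<xi> \<le> jbr \<xi>"
  unfolding jbr_def by (rule real_le_rsqrt) simp

lemma jbr_powr_pos [simp]: "0 < jbr \<xi> powr t"
  using jbr_ge_1[of \<xi>] by simp

section \<open>Dyadic blocks\<close>

lemma finite_dyadic: "finite (dyadic m :: (int ^ 'n) set)"
proof -
  define K where "K = \<lceil>2 ^ (m + 1) :: real\<rceil>"
  have "\<bar>\<xi> $ j\<bar> \<le> K" if "\<xi> \<in> dyadic m" for \<xi> :: "int ^ 'n" and j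
  proof -
    have "(of_int (\<xi> $ j))\<^sup>2 \<le> (\<Sum>j\<in>UNIV. (real_of_int (\<xi> $ j))\<^sup>2)"
      by (rule member_le_sum) auto
    then have "\<bar>real_of_int (\<xi> $ j)\<bar> \<le> normZ \<xi>"
      unfolding normZ_def by (intro real_le_rsqrt) simp
    also have "\<dots> \<le> 2 ^ (m + 1)" using that by (auto simp: dyadic_def split: if_splits)
    finally have "real_of_int \<bar>\<xi> $ j\<bar> \<le> 2 ^ (m + 1)" by simp
    then show ?thesis unfolding K_def by linarith
  qed
  then have "(\<lambda>\<xi> :: int ^ 'n. (\<lambda>j. \<xi> $ j)) ` dyadic m \<subseteq> PiE UNIV (\<lambda>_. {-K..K})"
    by (force simp: abs_le_iff)
  then have "finite ((\<lambda>\<xi> :: int ^ 'n. (\<lambda>j. \<xi> $ j)) ` dyadic m)"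
    by (rule finite_subset) (intro finite_PiE, auto)
  then show ?thesis
    by (rule finite_imageD) (auto simp: inj_on_def Finite_Cartesian_Product.vec_eq_iff fun_eq_iff)
qed

lemma dyadic_cover: "\<exists>m. \<xi> \<in> dyadic m"
proof (cases "normZ \<xi> < 2")
  case True
  then show ?thesis by (intro exI[of _ 0]) (simp add: dyadic_def)
next
  case False
  define m where "m = (LEAST m. normZ \<xi> < 2 ^ (m + 1))"
  obtain m0 where "normZ \<xi> < 2 ^ m0" using real_arch_pow[of 2 "normZ \<xi>"] by auto
  then have "normZ \<xi> < 2 ^ (m0 + 1)" by (simp add: less_le_trans)
  then have m: "normZ \<xi> < 2 ^ (m + 1)" unfolding m_def by (rule LeastI)
  have "m \<noteq> 0" using m False by (intro notI) simp
  then have "\<not> normZ \<xi> < 2 ^ ((m - 1) + 1)" unfolding m_def by (intro not_less_Least) (simp add: m_def[symmetric])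
  then show ?thesis using m \<open>m \<noteq> 0\<close> by (intro exI[of _ m]) (auto simp: dyadic_def)
qed

lemma dyadic_disjoint:
  assumes "\<xi> \<in> dyadic m" "\<xi> \<in> dyadic l" shows "m = l"
proof -
  have "\<not> m < l" if "\<xi> \<in> dyadic m" "\<xi> \<in> dyadic l" for m l
  proof
    assume "m < l"
    then have "(2::real) ^ (m + 1) \<le> 2 ^ l" by (intro power_increasing) auto
    then show False using that \<open>m < l\<close> by (auto simp: dyadic_def split: if_splits)
  qed
  then show ?thesis using assms by (meson linorder_neqE_nat)
qed

lemma block_character: "block f m x = (\<Sum>\<xi>\<in>dyadic m. character \<xi> x * fhat f \<xi>)"
  by (simp add: block_def character_def)

lemma continuous_on_block: "continuous_on S (block f m)"
  unfolding block_character by (intro continuous_intros continuous_on_character)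

lemma fhat_block: "fhat (block f m) \<xi> = (if \<xi> \<in> dyadic m then fhat f \<xi> else 0)"
  unfolding block_character by (rule fhat_trig_poly[OF finite_dyadic])

lemma block_cong: "(\<And>\<xi>. \<xi> \<in> dyadic m \<Longrightarrow> fhat f \<xi> = fhat g \<xi>) \<Longrightarrow> block f m = block g m"
  by (simp add: block_character fun_eq_iff)

lemma sum_squares_le_square_sum:
  fixes f :: "nat \<Rightarrow> real"
  assumes "\<And>i. 0 \<le> f i"
  shows "(\<Sum>i<M. (f i)\<^sup>2) \<le> (\<Sum>i<M. f i)\<^sup>2"
proof (induction M)
  case (Suc M)
  have "0 \<le> 2 * (\<Sum>i<M. f i) * f M" using assms by (simp add: sum_nonneg)
  moreover have "(\<Sum>i<Suc M. f i)\<^sup>2 = (\<Sum>i<M. f i)\<^sup>2 + (f M)\<^sup>2 + 2 * (\<Sum>i<M. f i) * f M"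
    by (simp add: power2_sum)
  moreover have "(\<Sum>i<Suc M. (f i)\<^sup>2) = (\<Sum>i<M. (f i)\<^sup>2) + (f M)\<^sup>2" by simp
  ultimately show ?case using Suc.IH by linarith
qed simp

text \<open>\<open>dim\<close> fixes the dimension of the torus, which \<open>w\<close> and
  \<open>p\<close> do not determine. The third index is 2 throughout, hence the square roots of sums
  of squares.\<close>

locale besov =
  fixes w p :: real and dim :: "'n::finite itself"
  assumes w: "0 < w" and p: "1 < p"
begin

abbreviation space :: "(real ^ 'n \<Rightarrow> complex) set" where "space \<equiv> besov_space w p 2"
abbreviation N :: "(real ^ 'n \<Rightarrow> complex) \<Rightarrow> real" where "N \<equiv> besov_norm w p 2"

definition weighted :: "(real ^ 'n \<Rightarrow> complex) \<Rightarrow> nat \<Rightarrow> real" where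
  "weighted f m = 2 powr (real m * w) * Lp_norm p (block f m)"

lemma Lp_nonneg: "0 \<le> Lp_norm p g"
  by (simp add: Lp_norm_def)

lemma weighted_nonneg: "0 \<le> weighted f m"
  by (simp add: weighted_def Lp_nonneg)

lemma N_sqrt:
  assumes "summable (\<lambda>m. (weighted f m)\<^sup>2)"
  shows "N f = sqrt (\<Sum>m. (weighted f m)\<^sup>2)"
proof -
  have "0 \<le> (\<Sum>m. (weighted f m)\<^sup>2)" by (intro suminf_nonneg assms) simp
  then show ?thesis
    unfolding besov_norm_def weighted_def[symmetric] using weighted_nonneg by (simp add: powr_half_sqrt)
qed

lemma space_def: "space = {f. periodic_fun f \<and> f absolutely_integrable_on unit_cube \<and> summable (\<lambda>m. (weighted f m)\<^sup>2)}"
  unfolding besov_space_def weighted_def[symmetric] using weighted_nonneg by simp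

lemma space_integrable: "f \<in> space \<Longrightarrow> f absolutely_integrable_on unit_cube"
  by (simp add: space_def)

lemma continuous_on_norm_powr:
  fixes g :: "real ^ 'n \<Rightarrow> complex"
  assumes "continuous_on UNIV g"
  shows "continuous_on UNIV (\<lambda>x. norm (g x) powr p)"
  by (intro continuous_on_powr' continuous_intros assms) (use p in auto)

lemma continuous_powr:
  fixes g :: "real ^ 'n \<Rightarrow> complex"
  assumes "continuous_on UNIV g"
  shows "(\<lambda>x. norm (g x) powr p) integrable_on unit_cube"
  by (intro continuous_integrable_unit_cube continuous_on_norm_powr assms)

text \<open>Young's inequality, normalised by an arbitrary constant above the \<open>L\<^sup>p\<close> norm.\<close>
lemma L1_le_Lp:
  fixes g :: "real ^ 'n \<Rightarrow> complex"
  assumes g: "continuous_on UNIV g"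
  shows "integral unit_cube (\<lambda>x. norm (g x)) \<le> Lp_norm p g"
proof (rule dense_ge)
  fix c assume c: "Lp_norm p g < c"
  have c0: "0 < c" using c Lp_nonneg[of g] by simp
  define I where "I = integral unit_cube (\<lambda>x. norm (g x) powr p)"
  have I0: "0 \<le> I" unfolding I_def by (intro integral_nonneg continuous_powr g) simp
  have "I = Lp_norm p g powr p" unfolding Lp_norm_def I_def[symmetric] using I0 p by (simp add: powr_powr)
  then have Ic: "I \<le> c powr p" using c Lp_nonneg[of g] p powr_mono2[of p "Lp_norm p g" c] by simp
  have young: "norm (g x) \<le> c * ((1 - 1 / p) + (1 / (p * c powr p)) * norm (g x) powr p)" for x
  proof -
    define t where "t = norm (g x) / c"
    have t0: "0 \<le> t" using c0 by (simp add: t_def)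
    define q where "q = p / (p - 1)"
    have q: "1 < q" "1 / q = 1 - 1 / p" using p by (auto simp: q_def field_simps)
    have "t * 1 \<le> t powr p / p + 1 powr q / q"
      by (rule Youngs_inequality) (use p q t0 in auto)
    then have "t \<le> 1 - 1 / p + t powr p / p" using q(2) by simp
    moreover have "t powr p = norm (g x) powr p / c powr p" unfolding t_def using c0 by (simp add: powr_divide)
    ultimately show ?thesis using c0 unfolding t_def by (simp add: field_simps)
  qed
  have "integral unit_cube (\<lambda>x. norm (g x)) \<le> integral unit_cube (\<lambda>x. c * ((1 - 1 / p) + (1 / (p * c powr p)) * norm (g x) powr p))"
  proof (rule integral_le)
    show "(\<lambda>x. norm (g x)) integrable_on unit_cube"
      by (rule continuous_integrable_unit_cube) (intro continuous_intros g)
    show "(\<lambda>x. c * ((1 - 1 / p) + (1 / (p * c powr p)) * norm (g x) powr p)) integrable_on unit_cube"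
      by (intro continuous_integrable_unit_cube continuous_on_norm_powr continuous_intros g)
  qed (rule young)
  also have "\<dots> = c * ((1 - 1 / p) + (1 / (p * c powr p)) * I)"
  proof -
    have "((\<lambda>x. c * ((1 - 1 / p) + (1 / (p * c powr p)) * norm (g x) powr p)) has_integral
        c * ((1 - 1 / p) + (1 / (p * c powr p)) * I)) unit_cube"
    proof (intro has_integral_mult_right has_integral_add)
      show "((\<lambda>x::real^'n. 1 - 1 / p) has_integral (1 - 1 / p)) unit_cube"
        using measure_unit_cube[of "1 - 1 / p"] continuous_integrable_unit_cube[of "\<lambda>_. 1 - 1 / p"]
        by (metis continuous_on_const integrable_integral)
      show "((\<lambda>x. norm (g x) powr p) has_integral I) unit_cube"
        unfolding I_def by (rule integrable_integral[OF continuous_powr[OF g]])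
    qed
    then show ?thesis by (rule integral_unique)
  qed
  also have "\<dots> \<le> c * ((1 - 1 / p) + (1 / (p * c powr p)) * c powr p)"
    using c0 p Ic by (intro mult_left_mono add_left_mono) auto
  also have "\<dots> = c" using c0 p by (simp add: field_simps)
  finally show "integral unit_cube (\<lambda>x. norm (g x)) \<le> c" .
qed

lemma Lp_norm_le:
  fixes g :: "real ^ 'n \<Rightarrow> complex"
  assumes g: "continuous_on UNIV g" and C: "\<And>x. norm (g x) \<le> C"
  shows "Lp_norm p g \<le> C"
proof -
  have C0: "0 \<le> C" using C[of 0] norm_ge_zero order.trans by blast
  have "integral unit_cube (\<lambda>x. norm (g x) powr p) \<le> integral unit_cube (\<lambda>x::real^'n. C powr p)"
    by (intro integral_le continuous_powr g) (auto intro!: powr_mono2 C continuous_integrable_unit_cube simp: p[THEN less_imp_le] order.trans[OF zero_le_one p[THEN less_imp_le]])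
  then have "integral unit_cube (\<lambda>x. norm (g x) powr p) \<le> C powr p" by (simp add: measure_unit_cube)
  then have "Lp_norm p g \<le> (C powr p) powr (1 / p)" unfolding Lp_norm_def
    using p by (intro powr_mono2) (auto intro!: integral_nonneg continuous_powr g)
  then show ?thesis using p C0 by (simp add: powr_powr)
qed

lemma Lp_norm_cmult: "Lp_norm p (\<lambda>x. c * g x) = norm c * Lp_norm p g"
  unfolding Lp_norm_def using p by (simp add: norm_mult powr_mult powr_powr)

text \<open>|g + h|^p is at most 2^p times the p-th power of the larger modulus. The constant 4,
  which bounds 2 * 2^(1/p), is harmless, because the inequality serves only to close the space under
  addition.\<close>

lemma Lp_norm_add:
  fixes g h :: "real ^ 'n \<Rightarrow> complex"
  assumes g: "continuous_on UNIV g" and h: "continuous_on UNIV h"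
  shows "Lp_norm p (\<lambda>x. g x + h x) \<le> 4 * (Lp_norm p g + Lp_norm p h)"
proof -
  define G where "G = integral unit_cube (\<lambda>x. norm (g x) powr p)"
  define H where "H = integral unit_cube (\<lambda>x. norm (h x) powr p)"
  have GH: "0 \<le> G" "0 \<le> H" unfolding G_def H_def by (auto intro!: integral_nonneg continuous_powr g h)
  have "integral unit_cube (\<lambda>x. norm (g x + h x) powr p) \<le> integral unit_cube (\<lambda>x. 2 powr p * (norm (g x) powr p + norm (h x) powr p))"
  proof (rule integral_le)
    show "(\<lambda>x. norm (g x + h x) powr p) integrable_on unit_cube" by (intro continuous_powr continuous_intros g h)
    show "(\<lambda>x. 2 powr p * (norm (g x) powr p + norm (h x) powr p)) integrable_on unit_cube"
      by (intro continuous_integrable_unit_cube continuous_on_norm_powr continuous_intros g h)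
    fix x
    define M where "M = max (norm (g x)) (norm (h x))"
    have "norm (g x + h x) \<le> 2 * M" using norm_triangle_ineq[of "g x" "h x"] by (simp add: M_def)
    then have "norm (g x + h x) powr p \<le> (2 * M) powr p" using p by (intro powr_mono2) auto
    also have "\<dots> = 2 powr p * M powr p" by (simp add: powr_mult M_def)
    also have "M powr p \<le> norm (g x) powr p + norm (h x) powr p" by (auto simp: M_def max_def)
    finally show "norm (g x + h x) powr p \<le> 2 powr p * (norm (g x) powr p + norm (h x) powr p)" by simp
  qed
  also have "\<dots> = 2 powr p * (G + H)"
    unfolding G_def H_def by (simp add: integral_add continuous_powr g h)
  finally have "Lp_norm p (\<lambda>x. g x + h x) \<le> (2 powr p * (G + H)) powr (1 / p)"
    unfolding Lp_norm_def using p
    by (intro powr_mono2) (auto intro!: integral_nonneg continuous_powr continuous_intros g h)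
  also have "\<dots> = 2 * (G + H) powr (1 / p)" using p GH by (simp add: powr_mult powr_powr)
  also have "(G + H) powr (1 / p) \<le> (2 * max G H) powr (1 / p)"
    using p GH by (intro powr_mono2) auto
  also have "\<dots> = 2 powr (1 / p) * max G H powr (1 / p)" using GH by (simp add: powr_mult)
  also have "\<dots> \<le> 2 powr 1 * (G powr (1 / p) + H powr (1 / p))"
    using p by (intro mult_mono powr_mono) (auto simp: max_def)
  finally show ?thesis by (simp add: Lp_norm_def G_def H_def)
qed

section \<open>Comparison of the Besov norm with sequence norms\<close>

lemma norm_fhat_le_Lp_block:
  fixes f :: "real ^ 'n \<Rightarrow> complex"
  assumes "\<xi> \<in> dyadic m"
  shows "norm (fhat f \<xi>) \<le> Lp_norm p (block f m)"
proof -
  have "norm (fhat f \<xi>) = norm (fhat (block f m) \<xi>)" using assms by (simp add: fhat_block)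
  also have "\<dots> \<le> integral unit_cube (\<lambda>x. norm (block f m x))"
    by (intro norm_fhat_le_L1 continuous_absolutely_integrable_unit_cube continuous_on_block)
  also have "\<dots> \<le> Lp_norm p (block f m)" by (rule L1_le_Lp[OF continuous_on_block])
  finally show ?thesis .
qed

text \<open>Every frequency belongs to a dyadic block, whose weight is at least 1 as w > 0. Each
  coefficient is therefore a functional of norm at most 1.\<close>

lemma norm_fhat_le_N:
  assumes f: "f \<in> space"
  shows "norm (fhat f \<xi>) \<le> N f"
proof -
  obtain m where m: "\<xi> \<in> dyadic m" using dyadic_cover by blast
  have s: "summable (\<lambda>m. (weighted f m)\<^sup>2)" using f by (simp add: space_def)
  have "norm (fhat f \<xi>) \<le> 1 * Lp_norm p (block f m)" using norm_fhat_le_Lp_block[OF m] by simp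
  also have "\<dots> \<le> weighted f m" unfolding weighted_def
    using w by (intro mult_right_mono Lp_nonneg) (simp add: ge_one_powr_ge_zero)
  also have "\<dots> \<le> N f" unfolding N_sqrt[OF s]
    using sum_le_suminf[OF s, of "{m}"] by (intro real_le_rsqrt) simp
  finally show ?thesis .
qed

lemma weighted_le:
  "weighted f m \<le> (\<Sum>\<xi>\<in>dyadic m. jbr \<xi> powr w * norm (fhat f \<xi>))"
proof -
  have "Lp_norm p (block f m) \<le> (\<Sum>\<xi>\<in>dyadic m. norm (fhat f \<xi>))"
  proof (rule Lp_norm_le[OF continuous_on_block])
    show "norm (block f m x) \<le> (\<Sum>\<xi>\<in>dyadic m. norm (fhat f \<xi>))" for x
      unfolding block_character by (rule sum_norm_le) (simp add: norm_mult)
  qed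
  then have "weighted f m \<le> 2 powr (real m * w) * (\<Sum>\<xi>\<in>dyadic m. norm (fhat f \<xi>))"
    unfolding weighted_def by (rule mult_left_mono) simp
  also have "\<dots> \<le> (\<Sum>\<xi>\<in>dyadic m. jbr \<xi> powr w * norm (fhat f \<xi>))"
    unfolding sum_distrib_left
  proof (intro sum_mono mult_right_mono)
    fix \<xi> :: "int ^ 'n" assume xi: "\<xi> \<in> dyadic m"
    have "2 powr real m \<le> jbr \<xi>"
    proof (cases "m = 0")
      case False
      then have "2 ^ m \<le> normZ \<xi>" using xi by (simp add: dyadic_def)
      then show ?thesis using normZ_le_jbr[of \<xi>] by (simp add: powr_realpow)
    qed (simp add: jbr_ge_1)
    then have "(2 powr real m) powr w \<le> jbr \<xi> powr w" using w by (intro powr_mono2) auto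
    then show "2 powr (real m * w) \<le> jbr \<xi> powr w" by (simp add: powr_powr)
  qed simp
  finally show ?thesis .
qed

text \<open>The opposite embedding: the l2 sum over blocks is at most the l1 sum, and each block is
  bounded by the moduli of its coefficients. Between this and \<open>norm_fhat_le_N\<close>,
  estimates in the Besov norm become estimates of sequences.\<close>

lemma weighted_summable:
  assumes s: "(\<lambda>\<xi>. jbr \<xi> powr w * norm (fhat f \<xi>)) summable_on UNIV"
  shows "summable (\<lambda>m. (weighted f m)\<^sup>2)"
    and "N f \<le> (\<Sum>\<^sub>\<infinity>\<xi>. jbr \<xi> powr w * norm (fhat f \<xi>))"
proof -
  define S where "S = (\<Sum>\<^sub>\<infinity>\<xi>. jbr \<xi> powr w * norm (fhat f \<xi>))"
  have S0: "0 \<le> S" unfolding S_def by (rule infsum_nonneg) simp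
  have le: "(\<Sum>m<M. (weighted f m)\<^sup>2) \<le> S\<^sup>2" for M
  proof -
    have "(\<Sum>m<M. weighted f m) \<le> (\<Sum>m<M. \<Sum>\<xi>\<in>dyadic m. jbr \<xi> powr w * norm (fhat f \<xi>))"
      by (intro sum_mono weighted_le)
    also have "\<dots> = (\<Sum>\<xi>\<in>(\<Union>m<M. dyadic m). jbr \<xi> powr w * norm (fhat f \<xi>))"
      by (rule sum.UNION_disjoint[symmetric]) (use finite_dyadic dyadic_disjoint in \<open>auto\<close>)
    also have "\<dots> \<le> S" unfolding S_def
      by (rule finite_sum_le_infsum[OF s]) (auto simp: finite_dyadic)
    finally have "(\<Sum>m<M. weighted f m)\<^sup>2 \<le> S\<^sup>2" by (intro power_mono sum_nonneg weighted_nonneg)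
    then show ?thesis using sum_squares_le_square_sum[of "weighted f" M, OF weighted_nonneg] by linarith
  qed
  show s: "summable (\<lambda>m. (weighted f m)\<^sup>2)"
    by (rule summableI_nonneg_bounded[OF _ le]) simp
  have "(\<Sum>m. (weighted f m)\<^sup>2) \<le> S\<^sup>2" by (rule suminf_le_const[OF s le])
  then have "sqrt (\<Sum>m. (weighted f m)\<^sup>2) \<le> sqrt (S\<^sup>2)" by (rule real_sqrt_le_mono)
  then show "N f \<le> S" unfolding N_sqrt[OF s] using S0 by simp
qed

lemma weighted_cong: "(\<And>\<xi>. \<xi> \<in> dyadic m \<Longrightarrow> fhat f \<xi> = fhat g \<xi>) \<Longrightarrow> weighted f m = weighted g m"
  unfolding weighted_def by (metis block_cong)

lemma weighted_zero: "(\<And>\<xi>. \<xi> \<in> dyadic m \<Longrightarrow> fhat f \<xi> = 0) \<Longrightarrow> weighted f m = 0"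
proof -
  assume "\<And>\<xi>. \<xi> \<in> dyadic m \<Longrightarrow> fhat f \<xi> = 0"
  then have "block f m = (\<lambda>_. 0)" by (simp add: block_character fun_eq_iff)
  then show ?thesis by (simp add: weighted_def Lp_norm_def)
qed

lemma N_eq_0_iff: "f \<in> space \<Longrightarrow> N f = 0 \<longleftrightarrow> (\<forall>\<xi>. fhat f \<xi> = 0)"
proof
  assume "f \<in> space" "N f = 0"
  then show "\<forall>\<xi>. fhat f \<xi> = 0" using norm_fhat_le_N[of f] by simp
next
  assume "\<forall>\<xi>. fhat f \<xi> = 0"
  then have "weighted f m = 0" for m by (simp add: weighted_zero)
  then show "N f = 0" by (simp add: N_sqrt)
qed

lemma weighted_cmult: "weighted (\<lambda>x. c * f x) m = norm c * weighted f m"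
proof -
  have "block (\<lambda>x. c * f x) m = (\<lambda>x. c * block f m x)"
    by (simp add: block_character fhat_cmult fun_eq_iff sum_distrib_left mult_ac)
  then show ?thesis by (simp add: weighted_def Lp_norm_cmult)
qed

lemma N_cmult:
  assumes "f \<in> space" shows "N (\<lambda>x. c * f x) = norm c * N f"
proof -
  have s: "summable (\<lambda>m. (weighted f m)\<^sup>2)" using assms by (simp add: space_def)
  have "summable (\<lambda>m. (weighted (\<lambda>x. c * f x) m)\<^sup>2)"
    unfolding weighted_cmult power_mult_distrib by (rule summable_mult[OF s])
  from N_sqrt[OF this] show ?thesis
    unfolding weighted_cmult power_mult_distrib suminf_mult[OF s] N_sqrt[OF s] by (simp add: real_sqrt_mult)
qed

lemma space_cmult:
  assumes "f \<in> space" shows "(\<lambda>x. c * f x) \<in> space"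
  using assms unfolding space_def
  by (auto simp: weighted_cmult power_mult_distrib periodic_fun_def intro: absolutely_integrable_cmult)

lemma space_add:
  assumes f: "f \<in> space" and g: "g \<in> space"
  shows "(\<lambda>x. f x + g x) \<in> space"
proof -
  have int: "f absolutely_integrable_on unit_cube" "g absolutely_integrable_on unit_cube"
    and sum: "summable (\<lambda>m. (weighted f m)\<^sup>2)" "summable (\<lambda>m. (weighted g m)\<^sup>2)"
    using assms by (auto simp: space_def)
  have "weighted (\<lambda>x. f x + g x) m \<le> 4 * (weighted f m + weighted g m)" for m
  proof -
    have "block (\<lambda>x. f x + g x) m = (\<lambda>x. block f m x + block g m x)"
      by (simp add: block_character fhat_add[OF int] fun_eq_iff sum.distrib distrib_left)
    then have "Lp_norm p (block (\<lambda>x. f x + g x) m) \<le> 4 * (Lp_norm p (block f m) + Lp_norm p (block g m))"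
      using Lp_norm_add[OF continuous_on_block continuous_on_block] by simp
    then have "weighted (\<lambda>x. f x + g x) m \<le> 2 powr (real m * w) * (4 * (Lp_norm p (block f m) + Lp_norm p (block g m)))"
      unfolding weighted_def by (rule mult_left_mono) simp
    then show ?thesis by (simp add: weighted_def algebra_simps)
  qed
  then have "(weighted (\<lambda>x. f x + g x) m)\<^sup>2 \<le> (4 * (weighted f m + weighted g m))\<^sup>2" for m
    by (intro power_mono weighted_nonneg)
  moreover have "(4 * (weighted f m + weighted g m))\<^sup>2 \<le> 32 * (weighted f m)\<^sup>2 + 32 * (weighted g m)\<^sup>2" for m
  proof -
    have "0 \<le> 16 * (weighted f m - weighted g m)\<^sup>2" by simp
    then show ?thesis by (simp add: power2_eq_square algebra_simps)
  qed
  ultimately have "(weighted (\<lambda>x. f x + g x) m)\<^sup>2 \<le> 32 * (weighted f m)\<^sup>2 + 32 * (weighted g m)\<^sup>2" for m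
    using order.trans by blast
  then have "summable (\<lambda>m. (weighted (\<lambda>x. f x + g x) m)\<^sup>2)"
    by (intro summable_comparison_test'[OF summable_add[OF summable_mult[OF sum(1), of 32] summable_mult[OF sum(2), of 32]], of 0]) simp
  then show ?thesis using assms int by (auto simp: space_def periodic_fun_def intro: set_integral_add(1))
qed

lemma space_sum:
  assumes "\<And>i. i \<in> I \<Longrightarrow> f i \<in> space" shows "(\<lambda>x. \<Sum>i\<in>I. c i * f i x) \<in> space"
  using assms
proof (induction I rule: infinite_finite_induct)
  case (insert i I)
  then show ?case using space_add[OF space_cmult[of "f i" "c i"], of "\<lambda>x. \<Sum>i\<in>I. c i * f i x"] by simp
next
  have "(\<lambda>x. 0 :: complex) \<in> space"
  proof -
    have "fhat (\<lambda>x::real^'n. 0) \<xi> = 0" for \<xi> by (simp add: fhat_character_form)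
    then show ?thesis by (simp add: space_def periodic_fun_def weighted_zero)
  qed
  then show "(\<lambda>x. \<Sum>i\<in>{}. c i * f i x) \<in> space" by simp
  then show "(\<lambda>x. \<Sum>i\<in>A. c i * f i x) \<in> space" if "infinite A" for A using that by simp
qed

lemma space_of_weighted:
  assumes "periodic_fun f" "continuous_on UNIV f" "(\<lambda>\<xi>. jbr \<xi> powr w * norm (fhat f \<xi>)) summable_on UNIV"
  shows "f \<in> space"
  unfolding space_def using assms weighted_summable(1) continuous_absolutely_integrable_unit_cube by blast

lemma character_in_space: "character \<xi> \<in> space"
proof (rule space_of_weighted[OF periodic_character continuous_on_character])
  show "(\<lambda>\<eta>. jbr \<eta> powr w * norm (fhat (character \<xi>) \<eta>)) summable_on UNIV"
    by (rule finite_nonzero_values_imp_summable_on, rule finite_subset[of _ "{\<xi>}"]) (auto simp: fhat_character)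
qed

section \<open>Functionals and dyadic truncation\<close>

lemma bounded_linear_functionalD:
  assumes \<phi>: "bounded_linear_functional space N \<phi>"
  shows "u \<in> space \<Longrightarrow> v \<in> space \<Longrightarrow> \<phi> (\<lambda>x. u x + v x) = \<phi> u + \<phi> v"
    and "u \<in> space \<Longrightarrow> \<phi> (\<lambda>x. c * u x) = c * \<phi> u"
  using \<phi> by (auto simp: bounded_linear_functional_def)

lemma functional_sum:
  assumes \<phi>: "bounded_linear_functional space N \<phi>" and "\<And>i. i \<in> I \<Longrightarrow> f i \<in> space"
  shows "\<phi> (\<lambda>x. \<Sum>i\<in>I. c i * f i x) = (\<Sum>i\<in>I. c i * \<phi> (f i))"
  using assms(2)
proof (induction I rule: infinite_finite_induct)
  case (insert i I)
  then show ?case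
    using bounded_linear_functionalD(1)[OF \<phi> space_cmult[of "f i" "c i"] space_sum[of I f c]]
      bounded_linear_functionalD(2)[OF \<phi>, of "f i" "c i"] by simp
next
  have "\<phi> (\<lambda>x. 0) = 0"
    using bounded_linear_functionalD(2)[OF \<phi> character_in_space, of 0] by simp
  then show "\<phi> (\<lambda>x. \<Sum>i\<in>{}. c i * f i x) = (\<Sum>i\<in>{}. c i * \<phi> (f i))" by simp
  then show "\<phi> (\<lambda>x. \<Sum>i\<in>A. c i * f i x) = (\<Sum>i\<in>A. c i * \<phi> (f i))" if "infinite A" for A using that by simp
qed

text \<open>The set in \<open>dual_norm\<close> is nonempty and bounded, so its real supremum is
  meaningful; scaling to norm 1 gives the operator norm estimate, and functions of norm 0 are
  covered by the bound in the definition of the functional.\<close>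

lemma dual_norm_props:
  assumes \<phi>: "bounded_linear_functional space N \<phi>"
  shows "0 \<le> dual_norm space N \<phi>" "u \<in> space \<Longrightarrow> norm (\<phi> u) \<le> dual_norm space N \<phi> * N u"
    and "(\<And>u. u \<in> space \<Longrightarrow> norm (\<phi> u) \<le> B * N u) \<Longrightarrow> 0 \<le> B \<Longrightarrow> dual_norm space N \<phi> \<le> B"
proof -
  define X where "X = {norm (\<phi> u) | u. u \<in> space \<and> N u \<le> 1}"
  obtain D where "\<forall>u\<in>space. norm (\<phi> u) \<le> D * N u"
    using \<phi> unfolding bounded_linear_functional_def by blast
  then have D: "norm (\<phi> u) \<le> D * N u" if "u \<in> space" for u using that by blast
  have N0: "0 \<le> N u" if "u \<in> space" for u using norm_fhat_le_N[OF that, of 0] norm_ge_zero order.trans by blast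
  have bdd: "bdd_above X"
  proof (rule bdd_aboveI)
    fix t assume "t \<in> X"
    then obtain u where u: "u \<in> space" "N u \<le> 1" "t = norm (\<phi> u)" by (auto simp: X_def)
    \<comment> \<open>The constant \<open>D\<close> comes without a sign, hence the modulus.\<close>
    have "D * N u \<le> \<bar>D\<bar> * 1" using u N0[OF u(1)] by (intro mult_mono) auto
    then show "t \<le> \<bar>D\<bar>" using D[OF u(1)] u(3) by simp
  qed
  have zero_in: "0 \<in> X"
  proof -
    have z: "(\<lambda>x. 0 * character 0 x) \<in> space" by (rule space_cmult[OF character_in_space])
    have "N (\<lambda>x. 0 * character 0 x) = norm (0::complex) * N (character 0)" by (rule N_cmult[OF character_in_space])
    moreover have "\<phi> (\<lambda>x. 0 * character 0 x) = 0" by (subst bounded_linear_functionalD(2)[OF \<phi> character_in_space]) simp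
    ultimately show ?thesis unfolding X_def using z by (intro CollectI exI[of _ "\<lambda>x. 0 * character 0 x"]) simp
  qed
  have dn: "dual_norm space N \<phi> = Sup X" by (simp add: dual_norm_def X_def)
  show dn0: "0 \<le> dual_norm space N \<phi>" unfolding dn by (rule cSup_upper[OF zero_in bdd])
  show "norm (\<phi> u) \<le> dual_norm space N \<phi> * N u" if u: "u \<in> space"
  proof (cases "N u = 0")
    case True then show ?thesis using D[OF u] by simp
  next
    case False
    then have Nu: "0 < N u" using N0[OF u] by simp
    let ?v = "\<lambda>x. of_real (1 / N u) * u x"
    have "N ?v = 1" using Nu by (subst N_cmult[OF u]) (simp add: norm_divide)
    then have "norm (\<phi> ?v) \<in> X" unfolding X_def using space_cmult[OF u, of "of_real (1 / N u)"] by auto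
    then have "norm (\<phi> ?v) \<le> dual_norm space N \<phi>" unfolding dn by (rule cSup_upper[OF _ bdd])
    moreover have "norm (\<phi> ?v) = norm (\<phi> u) / N u"
      using Nu by (subst bounded_linear_functionalD(2)[OF \<phi> u]) (simp add: norm_mult norm_divide)
    ultimately have "norm (\<phi> u) / N u \<le> dual_norm space N \<phi>" by (simp only:)
    then show ?thesis using Nu by (simp only: pos_divide_le_eq)
  qed
  show "dual_norm space N \<phi> \<le> B" if B: "\<And>u. u \<in> space \<Longrightarrow> norm (\<phi> u) \<le> B * N u" "0 \<le> B"
    unfolding dn
  proof (rule cSup_least)
    show "X \<noteq> {}" using zero_in by auto
    fix t assume "t \<in> X"
    then obtain u where u: "u \<in> space" "N u \<le> 1" "t = norm (\<phi> u)" by (auto simp: X_def)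
    have "B * N u \<le> B * 1" using u B by (intro mult_left_mono) auto
    then show "t \<le> B" using B(1)[OF u(1)] u(3) by simp
  qed
qed

lemma coefficient_functional: "bounded_linear_functional space N (\<lambda>u. fhat u \<xi>)"
  unfolding bounded_linear_functional_def
proof (intro conjI ballI allI)
  show "\<exists>C. \<forall>u\<in>space. norm (fhat u \<xi>) \<le> C * N u"
    by (rule exI[of _ 1]) (simp add: norm_fhat_le_N)
qed (auto simp: fhat_cmult intro: fhat_add space_integrable)

definition low :: "nat \<Rightarrow> (int ^ 'n) set" where "low M = (\<Union>m<M. dyadic m)"

lemma finite_low: "finite (low M)" by (simp add: low_def finite_dyadic)

text \<open>Truncation at whole dyadic blocks acts on the sequence of block norms by keeping or
  deleting its terms.\<close>

definition lowpass :: "(real ^ 'n \<Rightarrow> complex) \<Rightarrow> nat \<Rightarrow> real ^ 'n \<Rightarrow> complex" where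
  "lowpass f M x = (\<Sum>\<xi>\<in>low M. fhat f \<xi> * character \<xi> x)"

lemma lowpass_in_space: "lowpass f M \<in> space"
  unfolding lowpass_def[abs_def] by (rule space_sum[OF character_in_space])

lemma fhat_lowpass: "fhat (lowpass f M) \<xi> = (if \<xi> \<in> low M then fhat f \<xi> else 0)"
  unfolding lowpass_def[abs_def] using fhat_trig_poly[OF finite_low[of M], of "fhat f" \<xi>] by (simp add: mult.commute)

text \<open>What the truncation leaves over has the blocks below \<open>M\<close> deleted and the
  others untouched, so its norm is the root of a tail of the series of squares.\<close>

lemma N_minus_lowpass:
  assumes f: "f \<in> space"
  defines "g \<equiv> \<lambda>M x. f x + (-1) * lowpass f M x"
  shows "g M \<in> space" "N (g M) \<le> N f" "(\<lambda>M. N (g M)) \<longlonglongrightarrow> 0"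
proof -
  have sum: "summable (\<lambda>m. (weighted f m)\<^sup>2)" using f by (simp add: space_def)
  show "g M \<in> space" for M unfolding g_def by (intro space_add f space_cmult lowpass_in_space)
  have fg: "fhat (g M) \<xi> = (if \<xi> \<in> low M then 0 else fhat f \<xi>)" for M \<xi>
  proof -
    have "fhat (g M) \<xi> = fhat f \<xi> + fhat (\<lambda>x. (-1) * lowpass f M x) \<xi>"
      unfolding g_def
      by (rule fhat_add) (use f space_cmult[OF lowpass_in_space] in \<open>auto simp only: space_def\<close>)
    then show ?thesis by (simp only: fhat_cmult fhat_lowpass) simp
  qed
  have wg: "weighted (g M) m = (if m < M then 0 else weighted f m)" for M m
  proof (cases "m < M")
    case True
    then have "fhat (g M) \<xi> = 0" if "\<xi> \<in> dyadic m" for \<xi> using that by (auto simp: fg low_def)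
    then show ?thesis using True by (simp add: weighted_zero)
  next
    case False
    then have "fhat (g M) \<xi> = fhat f \<xi>" if "\<xi> \<in> dyadic m" for \<xi>
      using that dyadic_disjoint by (auto simp: fg low_def)
    then have "weighted (g M) m = weighted f m" by (rule weighted_cong)
    then show ?thesis using False by simp
  qed
  have sumg: "summable (\<lambda>m. (weighted (g M) m)\<^sup>2)" for M
    by (rule summable_comparison_test'[OF sum, of 0]) (simp add: wg)
  show "N (g M) \<le> N f" for M unfolding N_sqrt[OF sum] N_sqrt[OF sumg]
    by (intro real_sqrt_le_mono suminf_le sum sumg) (simp add: wg)
  have Ng: "N (g M) = sqrt ((\<Sum>m. (weighted f m)\<^sup>2) - (\<Sum>m<M. (weighted f m)\<^sup>2))" for M
  proof -
    have "(\<Sum>m. (weighted (g M) m)\<^sup>2) = (\<Sum>m. (weighted (g M) (m + M))\<^sup>2) + (\<Sum>m<M. (weighted (g M) m)\<^sup>2)"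
      by (rule suminf_split_initial_segment[OF sumg])
    also have "\<dots> = (\<Sum>m. (weighted f (m + M))\<^sup>2)" by (simp add: wg)
    also have "\<dots> = (\<Sum>m. (weighted f m)\<^sup>2) - (\<Sum>m<M. (weighted f m)\<^sup>2)"
      by (rule suminf_minus_initial_segment[OF sum])
    finally show ?thesis by (simp add: N_sqrt[OF sumg])
  qed
  have "(\<lambda>M. sqrt ((\<Sum>m. (weighted f m)\<^sup>2) - (\<Sum>m<M. (weighted f m)\<^sup>2))) \<longlonglongrightarrow> sqrt ((\<Sum>m. (weighted f m)\<^sup>2) - (\<Sum>m. (weighted f m)\<^sup>2))"
    by (intro tendsto_intros summable_LIMSEQ[OF sum])
  then show "(\<lambda>M. N (g M)) \<longlonglongrightarrow> 0" by (simp add: Ng)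
qed

end

section \<open>Periodic pseudo-differential operators on Besov spaces\<close>

text \<open>\<open>r\<close> measures decay away from the diagonal, \<open>s\<close> decay in the
  column index. Both exceed the dimension by more than \<open>w\<close>, because Peetre's inequality
  charges the weight of the target to either factor.\<close>

locale pdo_besov = besov w p dim for w p :: real and dim :: "'n::finite itself" +
  fixes a :: "real ^ 'n \<Rightarrow> int ^ 'n \<Rightarrow> complex" and C r s :: real
  assumes a_cont: "\<And>\<xi>. continuous_on UNIV (\<lambda>x. a x \<xi>)" and a_per: "\<And>\<xi>. periodic_fun (\<lambda>x. a x \<xi>)"
    and C: "0 \<le> C"
    and a_decay: "\<And>\<xi> \<zeta>. norm (fhat (\<lambda>x. a x \<xi>) \<zeta>) \<le> C * jbr \<zeta> powr (- r) * jbr \<xi> powr (- s)"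
    and a_bound: "\<And>x \<xi>. norm (a x \<xi>) \<le> C * jbr \<xi> powr (- s)"
    and r: "real CARD('n) + w < r" and s: "real CARD('n) + w < s"
begin

definition coef :: "int ^ 'n \<Rightarrow> int ^ 'n \<Rightarrow> complex" where
  "coef \<eta> \<xi> = fhat (\<lambda>x. a x \<xi>) (\<eta> - \<xi>)"

text \<open>\<open>2 powr w\<close> comes from Peetre's inequality; the sum is that of the
  off-diagonal decay after it has absorbed the weight.\<close>

definition W :: real where
  "W = C * 2 powr w * (\<Sum>\<^sub>\<infinity>\<zeta> :: int ^ 'n. jbr \<zeta> powr (- (r - w)))"

definition colbd :: "int ^ 'n \<Rightarrow> real" where "colbd \<xi> = jbr \<xi> powr (- (s - w))"

lemma colbd_nonneg: "0 \<le> colbd \<xi>" by (simp add: colbd_def)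

lemma colbd_summable: "colbd summable_on UNIV"
  unfolding colbd_def[abs_def] by (rule summable_jbr) (use s in simp)

lemma W_nonneg: "0 \<le> W"
  unfolding W_def using C by (intro mult_nonneg_nonneg infsum_nonneg) auto

lemma weighted_coef_le:
  "jbr \<eta> powr w * norm (coef \<eta> \<xi>) \<le> C * 2 powr w * colbd \<xi> * jbr (\<eta> - \<xi>) powr (- (r - w))"
proof -
  have "jbr \<eta> \<le> 2 * jbr (\<eta> - \<xi>) * jbr \<xi>" using jbr_add_le[of "\<eta> - \<xi>" \<xi>] by simp
  then have "jbr \<eta> powr w \<le> (2 * jbr (\<eta> - \<xi>) * jbr \<xi>) powr w"
    using w jbr_ge_1[of \<eta>] by (intro powr_mono2) auto
  also have "\<dots> = 2 powr w * jbr (\<eta> - \<xi>) powr w * jbr \<xi> powr w"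
    using jbr_ge_1[of \<xi>] jbr_ge_1[of "\<eta> - \<xi>"] by (simp add: powr_mult)
  finally have "jbr \<eta> powr w * norm (coef \<eta> \<xi>) \<le> (2 powr w * jbr (\<eta> - \<xi>) powr w * jbr \<xi> powr w) *
      (C * jbr (\<eta> - \<xi>) powr (- r) * jbr \<xi> powr (- s))"
    unfolding coef_def by (intro mult_mono a_decay) auto
  also have "\<dots> = C * 2 powr w * (jbr \<xi> powr w * jbr \<xi> powr (- s)) * (jbr (\<eta> - \<xi>) powr w * jbr (\<eta> - \<xi>) powr (- r))"
    by (simp add: mult_ac)
  also have "\<dots> = C * 2 powr w * colbd \<xi> * jbr (\<eta> - \<xi>) powr (- (r - w))"
    unfolding colbd_def powr_add[symmetric] by (simp add: algebra_simps)
  finally show ?thesis .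
qed

lemma translated_jbr_summable:
  "(\<lambda>\<eta>. jbr (\<eta> - \<xi>) powr (- (r - w))) summable_on (UNIV :: (int ^ 'n) set)"
  "(\<Sum>\<^sub>\<infinity>\<eta>. jbr (\<eta> - \<xi>) powr (- (r - w))) = (\<Sum>\<^sub>\<infinity>\<zeta> :: int ^ 'n. jbr \<zeta> powr (- (r - w)))"
proof -
  have bij: "bij_betw (\<lambda>\<eta>. \<eta> - \<xi>) UNIV (UNIV :: (int ^ 'n) set)"
    by (rule bij_betwI[of _ _ _ "\<lambda>\<eta>. \<eta> + \<xi>"]) auto
  show "(\<lambda>\<eta>. jbr (\<eta> - \<xi>) powr (- (r - w))) summable_on (UNIV :: (int ^ 'n) set)"
    using summable_on_reindex_bij_betw[OF bij, of "\<lambda>\<eta>. jbr \<eta> powr (- (r - w))"] summable_jbr[of "r - w", where 'n = 'n] r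
    by simp
  show "(\<Sum>\<^sub>\<infinity>\<eta>. jbr (\<eta> - \<xi>) powr (- (r - w))) = (\<Sum>\<^sub>\<infinity>\<zeta> :: int ^ 'n. jbr \<zeta> powr (- (r - w)))"
    using infsum_reindex_bij_betw[OF bij, of "\<lambda>\<eta>. jbr \<eta> powr (- (r - w))"] by simp
qed

lemma column_sum_le:
  assumes "finite F"
  shows "(\<Sum>\<eta>\<in>F. jbr \<eta> powr w * norm (coef \<eta> \<xi>)) \<le> W * colbd \<xi>"
proof -
  have "(\<Sum>\<eta>\<in>F. jbr \<eta> powr w * norm (coef \<eta> \<xi>)) \<le> (\<Sum>\<eta>\<in>F. C * 2 powr w * colbd \<xi> * jbr (\<eta> - \<xi>) powr (- (r - w)))"
    by (intro sum_mono weighted_coef_le)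
  also have "\<dots> = C * 2 powr w * colbd \<xi> * (\<Sum>\<eta>\<in>F. jbr (\<eta> - \<xi>) powr (- (r - w)))"
    by (simp add: sum_distrib_left)
  also have "\<dots> \<le> C * 2 powr w * colbd \<xi> * (\<Sum>\<^sub>\<infinity>\<eta>. jbr (\<eta> - \<xi>) powr (- (r - w)))"
    using C colbd_nonneg[of \<xi>] assms
    by (intro mult_left_mono finite_sum_le_infsum translated_jbr_summable) auto
  also have "\<dots> = W * colbd \<xi>" 
    by (simp only: translated_jbr_summable(2) W_def mult_ac)
  finally show ?thesis .
qed

lemma norm_coef_le: "norm (coef \<eta> \<xi>) \<le> W * colbd \<xi>"
proof -
  have "1 * norm (coef \<eta> \<xi>) \<le> jbr \<eta> powr w * norm (coef \<eta> \<xi>)"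
    using w jbr_ge_1[of \<eta>] by (intro mult_right_mono) (auto simp: ge_one_powr_ge_zero)
  then show ?thesis using column_sum_le[of "{\<eta>}" \<xi>] by simp
qed

lemma row_summable:
  assumes c: "\<And>\<xi>. norm (c \<xi>) \<le> b \<xi>" and b: "(\<lambda>\<xi>. b \<xi> * colbd \<xi>) summable_on UNIV"
  shows "(\<lambda>\<xi>. norm (coef \<eta> \<xi> * c \<xi>)) summable_on UNIV"
proof (rule summable_on_comparison_test[of "\<lambda>\<xi>. W * (b \<xi> * colbd \<xi>)"])
  show "(\<lambda>\<xi>. W * (b \<xi> * colbd \<xi>)) summable_on UNIV" by (intro summable_on_cmult_right b)
  show "norm (coef \<eta> \<xi> * c \<xi>) \<le> W * (b \<xi> * colbd \<xi>)" for \<xi>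
  proof -
    have "norm (coef \<eta> \<xi> * c \<xi>) \<le> (W * colbd \<xi>) * b \<xi>"
      unfolding norm_mult using W_nonneg colbd_nonneg by (intro mult_mono norm_coef_le c) auto
    then show ?thesis by (simp add: mult_ac)
  qed
qed simp

text \<open>The majorant \<open>b\<close> may depend on the frequency: for tails of a coefficient
  sequence it vanishes on finitely many frequencies, which yields the convergence in
  \<open>nuclear_pdo\<close>.\<close>

lemma image_weighted:
  assumes c: "\<And>\<xi>. norm (c \<xi>) \<le> b \<xi>" and b: "(\<lambda>\<xi>. b \<xi> * colbd \<xi>) summable_on UNIV"
  shows "(\<lambda>\<eta>. jbr \<eta> powr w * norm (\<Sum>\<^sub>\<infinity>\<xi>. coef \<eta> \<xi> * c \<xi>)) summable_on UNIV"
    and "(\<Sum>\<^sub>\<infinity>\<eta>. jbr \<eta> powr w * norm (\<Sum>\<^sub>\<infinity>\<xi>. coef \<eta> \<xi> * c \<xi>)) \<le> W * (\<Sum>\<^sub>\<infinity>\<xi>. b \<xi> * colbd \<xi>)"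
proof -
  have le: "(\<Sum>\<eta>\<in>F. jbr \<eta> powr w * norm (\<Sum>\<^sub>\<infinity>\<xi>. coef \<eta> \<xi> * c \<xi>)) \<le> W * (\<Sum>\<^sub>\<infinity>\<xi>. b \<xi> * colbd \<xi>)"
    if F: "finite F" for F
  proof -
    note rs = row_summable[of c b, OF c b]
    have "(\<Sum>\<eta>\<in>F. jbr \<eta> powr w * norm (\<Sum>\<^sub>\<infinity>\<xi>. coef \<eta> \<xi> * c \<xi>))
        \<le> (\<Sum>\<eta>\<in>F. \<Sum>\<^sub>\<infinity>\<xi>. jbr \<eta> powr w * norm (coef \<eta> \<xi> * c \<xi>))"
      by (intro sum_mono) (simp add: infsum_cmult_right' norm_infsum_bound[OF rs] mult_left_mono)
    also have "\<dots> = (\<Sum>\<^sub>\<infinity>\<xi>. \<Sum>\<eta>\<in>F. jbr \<eta> powr w * norm (coef \<eta> \<xi> * c \<xi>))"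
      by (rule infsumI[symmetric], rule has_sum_finite_sum) (intro has_sum_infsum summable_on_cmult_right rs)
    also have "\<dots> \<le> (\<Sum>\<^sub>\<infinity>\<xi>. W * (b \<xi> * colbd \<xi>))"
    proof (rule infsum_mono)
      show "(\<lambda>\<xi>. \<Sum>\<eta>\<in>F. jbr \<eta> powr w * norm (coef \<eta> \<xi> * c \<xi>)) summable_on UNIV"
        unfolding summable_on_def
        by (rule exI, rule has_sum_finite_sum, rule has_sum_infsum, intro summable_on_cmult_right rs)
      show "(\<lambda>\<xi>. W * (b \<xi> * colbd \<xi>)) summable_on UNIV" by (intro summable_on_cmult_right b)
      fix \<xi>
      have "(\<Sum>\<eta>\<in>F. jbr \<eta> powr w * norm (coef \<eta> \<xi> * c \<xi>)) = (\<Sum>\<eta>\<in>F. jbr \<eta> powr w * norm (coef \<eta> \<xi>)) * norm (c \<xi>)"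
        by (simp add: norm_mult sum_distrib_right mult.assoc)
      also have "\<dots> \<le> (W * colbd \<xi>) * b \<xi>"
        using W_nonneg colbd_nonneg by (intro mult_mono column_sum_le c F) auto
      finally show "(\<Sum>\<eta>\<in>F. jbr \<eta> powr w * norm (coef \<eta> \<xi> * c \<xi>)) \<le> W * (b \<xi> * colbd \<xi>)" by (simp add: mult_ac)
    qed
    also have "\<dots> = W * (\<Sum>\<^sub>\<infinity>\<xi>. b \<xi> * colbd \<xi>)" by (rule infsum_cmult_right')
    finally show ?thesis .
  qed
  show s: "(\<lambda>\<eta>. jbr \<eta> powr w * norm (\<Sum>\<^sub>\<infinity>\<xi>. coef \<eta> \<xi> * c \<xi>)) summable_on UNIV"
    by (rule nonneg_bdd_above_summable_on) (auto intro!: bdd_aboveI2 le)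
  show "(\<Sum>\<^sub>\<infinity>\<eta>. jbr \<eta> powr w * norm (\<Sum>\<^sub>\<infinity>\<xi>. coef \<eta> \<xi> * c \<xi>)) \<le> W * (\<Sum>\<^sub>\<infinity>\<xi>. b \<xi> * colbd \<xi>)"
    by (rule infsum_le_finite_sums[OF s]) (rule le)
qed

lemma jbr_powr_s_le_colbd: "jbr \<xi> powr (- s) \<le> colbd \<xi>"
  unfolding colbd_def using jbr_ge_1[of \<xi>] w by (intro powr_mono) auto

text \<open>The coefficients of an integrable function are bounded and the bound for the symbol is
  summable over the lattice, so the defining series converges uniformly: the image is continuous and
  its coefficients are computed term by term.\<close>

lemma pdo_props:
  assumes f: "f absolutely_integrable_on unit_cube"
  shows "continuous_on UNIV (pdo a f)" "periodic_fun (pdo a f)"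
    "((\<lambda>\<xi>. coef \<eta> \<xi> * fhat f \<xi>) has_sum fhat (pdo a f) \<eta>) UNIV"
proof -
  define M where "M = integral unit_cube (\<lambda>x. norm (f x))"
  define g where "g \<xi> x = character \<xi> x * (a x \<xi> * fhat f \<xi>)" for \<xi> x
  have pdo: "pdo a f = (\<lambda>x. \<Sum>\<^sub>\<infinity>\<xi>. g \<xi> x)"
    by (simp add: pdo_def fun_eq_iff g_def character_def mult.assoc)
  have M: "norm (fhat f \<xi>) \<le> M" for \<xi> unfolding M_def by (rule norm_fhat_le_L1[OF f])
  have M0: "0 \<le> M" using M[of 0] norm_ge_zero order.trans by blast
  have g_cont: "continuous_on UNIV (g \<xi>)" for \<xi>
    unfolding g_def by (intro continuous_intros continuous_on_character a_cont)
  have g_le: "norm (g \<xi> x) \<le> (C * M) * colbd \<xi>" for \<xi> x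
  proof -
    have "norm (g \<xi> x) \<le> (C * jbr \<xi> powr (- s)) * M"
      unfolding g_def norm_mult norm_character mult_1_left
      using C by (intro mult_mono a_bound M) auto
    also have "\<dots> \<le> (C * colbd \<xi>) * M"
      using C M0 jbr_powr_s_le_colbd by (intro mult_right_mono mult_left_mono) auto
    finally show ?thesis by (simp add: mult_ac)
  qed
  have b: "(\<lambda>\<xi>. (C * M) * colbd \<xi>) summable_on UNIV" by (intro summable_on_cmult_right colbd_summable)
  show "continuous_on UNIV (pdo a f)" unfolding pdo by (rule uniform_series(1)[OF g_cont g_le b])
  show "periodic_fun (pdo a f)"
  proof -
    have "g \<xi> (x + int_vec k) = g \<xi> x" for \<xi> x k
      using periodic_character[of \<xi>] a_per[of \<xi>] by (simp add: g_def periodic_fun_def)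
    then show ?thesis by (simp add: pdo periodic_fun_def)
  qed
  have "((\<lambda>\<xi>. fhat (g \<xi>) \<eta>) has_sum fhat (pdo a f) \<eta>) UNIV"
    unfolding pdo by (rule fhat_uniform_series[OF g_cont g_le b])
  moreover have "fhat (g \<xi>) \<eta> = coef \<eta> \<xi> * fhat f \<xi>" for \<xi>
  proof -
    have "fhat (g \<xi>) \<eta> = fhat (\<lambda>x. fhat f \<xi> * a x \<xi>) (\<eta> - \<xi>)"
      unfolding g_def fhat_character_mult by (simp add: mult.commute)
    then show ?thesis by (simp add: fhat_cmult coef_def mult.commute)
  qed
  ultimately show "((\<lambda>\<xi>. coef \<eta> \<xi> * fhat f \<xi>) has_sum fhat (pdo a f) \<eta>) UNIV" by simp
qed

lemma fhat_pdo: "f \<in> space \<Longrightarrow> fhat (pdo a f) \<eta> = (\<Sum>\<^sub>\<infinity>\<xi>. coef \<eta> \<xi> * fhat f \<xi>)"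
  by (rule infsumI[OF pdo_props(3)[OF space_integrable], symmetric])

lemma pdo_in_space:
  assumes f: "f \<in> space" shows "pdo a f \<in> space"
proof (rule space_of_weighted)
  show "(\<lambda>\<eta>. jbr \<eta> powr w * norm (fhat (pdo a f) \<eta>)) summable_on UNIV"
    unfolding fhat_pdo[OF f]
    by (rule image_weighted[of _ "\<lambda>_. N f"]) (auto intro: norm_fhat_le_N[OF f] summable_on_cmult_right colbd_summable)
qed (use pdo_props[OF space_integrable[OF f]] in auto)

text \<open>The image of \<open>character \<xi>\<close> under \<open>pdo a\<close>.\<close>

definition column_fun :: "int ^ 'n \<Rightarrow> real ^ 'n \<Rightarrow> complex" where
  "column_fun \<xi> x = character \<xi> x * a x \<xi>"

lemma fhat_column_fun: "fhat (column_fun \<xi>) \<eta> = coef \<eta> \<xi>"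
  unfolding column_fun_def[abs_def] fhat_character_mult coef_def ..

lemma column_weighted:
  "(\<lambda>\<eta>. jbr \<eta> powr w * norm (coef \<eta> \<xi>)) summable_on UNIV"
  "(\<Sum>\<^sub>\<infinity>\<eta>. jbr \<eta> powr w * norm (coef \<eta> \<xi>)) \<le> W * colbd \<xi>"
proof -
  show s: "(\<lambda>\<eta>. jbr \<eta> powr w * norm (coef \<eta> \<xi>)) summable_on UNIV"
    by (rule nonneg_bdd_above_summable_on) (auto intro!: bdd_aboveI2 column_sum_le)
  show "(\<Sum>\<^sub>\<infinity>\<eta>. jbr \<eta> powr w * norm (coef \<eta> \<xi>)) \<le> W * colbd \<xi>"
    by (rule infsum_le_finite_sums[OF s]) (rule column_sum_le)
qed

lemma column_fun_in_space: "column_fun \<xi> \<in> space"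
proof (rule space_of_weighted)
  show "periodic_fun (column_fun \<xi>)"
    unfolding column_fun_def by (rule periodic_mult[OF periodic_character a_per])
  show "continuous_on UNIV (column_fun \<xi>)"
    unfolding column_fun_def by (intro continuous_intros continuous_on_character a_cont)
qed (simp add: fhat_column_fun column_weighted)

lemma N_column_fun_le: "N (column_fun \<xi>) \<le> W * colbd \<xi>"
  using weighted_summable(2)[of "column_fun \<xi>"] column_weighted[of \<xi>] by (simp add: fhat_column_fun)

text \<open>The weights are at least 1, so the Fourier series converges uniformly to a continuous
  function. This is the way back from sequences to the function space.\<close>

lemma synthesis:
  assumes c: "(\<lambda>\<xi>. jbr \<xi> powr w * norm (c \<xi>)) summable_on UNIV"
  obtains u where "u \<in> space" "\<And>\<xi>. fhat u \<xi> = c \<xi>"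
proof -
  define g where "g \<xi> x = character \<xi> x * c \<xi>" for \<xi> :: "int ^ 'n" and x
  define u where "u x = (\<Sum>\<^sub>\<infinity>\<xi>. g \<xi> x)" for x
  have g_cont: "continuous_on UNIV (g \<xi>)" for \<xi>
    unfolding g_def by (intro continuous_intros continuous_on_character)
  have g_le: "norm (g \<xi> x) \<le> jbr \<xi> powr w * norm (c \<xi>)" for \<xi> x
  proof -
    have "1 * norm (c \<xi>) \<le> jbr \<xi> powr w * norm (c \<xi>)"
      using w jbr_ge_1[of \<xi>] by (intro mult_right_mono) (auto simp: ge_one_powr_ge_zero)
    then show ?thesis by (simp add: g_def norm_mult)
  qed
  have u_fhat: "fhat u \<eta> = c \<eta>" for \<eta>
  proof -
    have "((\<lambda>\<xi>. fhat (g \<xi>) \<eta>) has_sum fhat u \<eta>) UNIV"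
      unfolding u_def[abs_def] by (rule fhat_uniform_series[OF g_cont g_le c])
    moreover have "fhat (g \<xi>) \<eta> = (if \<xi> = \<eta> then c \<eta> else 0)" for \<xi>
    proof -
      have "fhat (\<lambda>x. c \<xi> * character \<xi> x) \<eta> = c \<xi> * fhat (character \<xi>) \<eta>" by (rule fhat_cmult)
      then show ?thesis by (auto simp: g_def[abs_def] mult.commute fhat_character)
    qed
    ultimately have "((\<lambda>\<xi>. if \<xi> = \<eta> then c \<eta> else 0) has_sum fhat u \<eta>) UNIV" by simp
    moreover have "((\<lambda>\<xi>. if \<xi> = \<eta> then c \<eta> else 0) has_sum c \<eta>) UNIV"
      by (rule has_sum_finite_neutralI[of "{\<eta>}"]) auto
    ultimately show ?thesis by (rule has_sum_unique)
  qed
  have "u \<in> space"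
  proof (rule space_of_weighted)
    show "periodic_fun u"
    proof -
      have "g \<xi> (x + int_vec k) = g \<xi> x" for \<xi> x k
        using periodic_character[of \<xi>] by (simp add: g_def periodic_fun_def)
      then show ?thesis by (simp add: u_def periodic_fun_def)
    qed
    show "continuous_on UNIV u" unfolding u_def[abs_def] by (rule uniform_series(1)[OF g_cont g_le c])
  qed (simp add: u_fhat c)
  then show ?thesis using that u_fhat by blast
qed

end

section \<open>Transfer of the spectrum\<close>

lemma sum_fun_apply: "(\<Sum>i\<in>I. f i) x = (\<Sum>i\<in>I. f i x)"
  for f :: "'i \<Rightarrow> 'a \<Rightarrow> 'b::comm_monoid_add"
  by (induction I rule: infinite_finite_induct) auto

text \<open>The dimension in the form in which the algebraic multiplicity is defined.\<close>
lemma fin_dim_Greatest: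
  assumes "fin_dim S d"
  shows "(GREATEST n. \<exists>v :: nat \<Rightarrow> nat \<Rightarrow> complex. (\<forall>i<n. v i \<in> S) \<and>
      (\<forall>c :: nat \<Rightarrow> complex. (\<lambda>x. \<Sum>i<n. c i * v i x) = (\<lambda>_. 0) \<longrightarrow> (\<forall>i<n. c i = 0))) = d"
proof -
  obtain B where B: "finite B" "cvs.independent B" "cvs.span B = S" "card B = d"
    using assms by (auto simp: fin_dim_def)
  show ?thesis
  proof (rule Greatest_equality)
    obtain v where v: "bij_betw v {..<d} B"
      using ex_bij_betw_nat_finite[OF B(1)] B(4) by (auto simp: lessThan_atLeast0)
    show "\<exists>v :: nat \<Rightarrow> nat \<Rightarrow> complex. (\<forall>i<d. v i \<in> S) \<and>
      (\<forall>c. (\<lambda>x. \<Sum>i<d. c i * v i x) = (\<lambda>_. 0) \<longrightarrow> (\<forall>i<d. c i = 0))"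
    proof (intro exI[of _ v] conjI allI impI)
      fix i assume "i < d"
      then have "v i \<in> B" using v by (auto simp: bij_betw_def)
      then show "v i \<in> S" using B(3) cvs.span_base by blast
    next
      fix c i assume c: "(\<lambda>x. \<Sum>i<d. c i * v i x) = (\<lambda>_. 0)" and i: "i < d"
      have inj: "inj_on v {..<d}" and img: "v ` {..<d} = B" using v by (auto simp: bij_betw_def)
      define c' where "c' = c \<circ> the_inv_into {..<d} v"
      have "(\<Sum>b\<in>B. (\<lambda>x. c' b * b x)) = (\<Sum>i<d. (\<lambda>x. c i * v i x))"
        unfolding img[symmetric] using inj
        by (subst sum.reindex) (auto simp: c'_def the_inv_into_f_f intro!: sum.cong)
      also have "\<dots> = 0" using c by (simp add: fun_eq_iff sum_fun_apply)
      finally have "\<forall>b\<in>B. c' b = 0" using B(2) cvs.dependent_finite[OF B(1)] by blast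
      moreover have "v i \<in> B" "c' (v i) = c i" using i img inj by (auto simp: c'_def the_inv_into_f_f)
      ultimately show "c i = 0" by metis
    qed
  next
    fix n
    assume "\<exists>v :: nat \<Rightarrow> nat \<Rightarrow> complex. (\<forall>i<n. v i \<in> S) \<and>
      (\<forall>c. (\<lambda>x. \<Sum>i<n. c i * v i x) = (\<lambda>_. 0) \<longrightarrow> (\<forall>i<n. c i = 0))"
    then obtain v :: "nat \<Rightarrow> nat \<Rightarrow> complex" where v: "\<And>i. i < n \<Longrightarrow> v i \<in> S"
      and ind: "\<And>c i. (\<lambda>x. \<Sum>i<n. c i * v i x) = (\<lambda>_. 0) \<Longrightarrow> i < n \<Longrightarrow> c i = 0" by blast
    have inj: "inj_on v {..<n}"
    proof (rule inj_onI, rule ccontr)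
      fix i j assume ij: "i \<in> {..<n}" "j \<in> {..<n}" "v i = v j" "i \<noteq> j"
      \<comment> \<open>If two vectors of the family coincided, their difference would be a
        nontrivial relation.\<close>
      define c :: "nat \<Rightarrow> complex" where "c l = (if l = i then 1 else 0) - (if l = j then 1 else 0)" for l
      have "(\<Sum>l<n. c l * v l x) = 0" for x
      proof -
        have "(\<Sum>l<n. c l * v l x) = (\<Sum>l<n. (if l = i then v l x else 0) - (if l = j then v l x else 0))"
          by (rule sum.cong) (auto simp: c_def)
        then show ?thesis using ij by (simp add: sum_subtractf)
      qed
      then have "c i = 0" using ind[of c i] ij by auto
      then show False using ij by (simp add: c_def)
    qed
    have "cvs.independent (v ` {..<n})"
    proof
      assume "cvs.dependent (v ` {..<n})"
      then obtain u where u: "\<exists>b\<in>v ` {..<n}. u b \<noteq> 0" "(\<Sum>b\<in>v ` {..<n}. (\<lambda>x. u b * b x)) = 0"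
        using cvs.dependent_finite[of "v ` {..<n}"] by auto
      have "(\<Sum>i<n. (\<lambda>x. u (v i) * v i x)) = 0" using u(2) by (simp add: sum.reindex[OF inj])
      then have "(\<lambda>x. \<Sum>i<n. u (v i) * v i x) = (\<lambda>_. 0)" by (simp add: fun_eq_iff sum_fun_apply)
      then have "u (v i) = 0" if "i < n" for i using ind[of "\<lambda>i. u (v i)" i] that by blast
      then show False using u(1) by auto
    qed
    moreover have "v ` {..<n} \<subseteq> cvs.span B" using v B(3) by auto
    ultimately have "card (v ` {..<n}) \<le> card B" using cvs.independent_span_bound[OF B(1)] by auto
    then show "n \<le> d" using B(4) inj by (simp add: card_image)
  qed
qed

context pdo_besov
begin

text \<open>Any enumeration serves, since the sums over frequencies converge
  unconditionally.\<close>

definition enum :: "nat \<Rightarrow> int ^ 'n" where "enum = from_nat_into UNIV"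

lemma bij_enum: "bij enum"
proof -
  have "infinite (UNIV :: (int ^ 'n) set)"
  proof
    assume "finite (UNIV :: (int ^ 'n) set)"
    then have "finite ((\<lambda>k. \<chi> j. (k :: int)) ` UNIV :: (int ^ 'n) set)" by (rule finite_subset[OF subset_UNIV])
    then have "finite (UNIV :: int set)"
      by (rule finite_imageD) (auto simp: inj_on_def Finite_Cartesian_Product.vec_eq_iff)
    then show False by simp
  qed
  then show ?thesis unfolding enum_def by (intro bij_betw_from_nat_into) auto
qed

lemma inj_enum: "inj enum" using bij_enum by (rule bij_is_inj)

lemma has_sum_enum:
  assumes "(g has_sum S) UNIV" shows "(\<lambda>i. g (enum i)) sums S"
  using assms has_sum_reindex_bij_betw[OF bij_enum, of g S] by (intro has_sum_imp_sums) simp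

definition K :: "nat \<Rightarrow> nat \<Rightarrow> complex" where "K i j = coef (enum i) (enum j)"

definition seq :: "(real ^ 'n \<Rightarrow> complex) \<Rightarrow> nat \<Rightarrow> complex" where "seq f i = fhat f (enum i)"

lemma colbd_enum_summable: "summable (\<lambda>j. colbd (enum j))"
  using has_sum_enum[OF has_sum_infsum[OF colbd_summable]] by (rule sums_summable)

lemma K_col: "summable (\<lambda>i. norm (K i j))" "col_norm K j \<le> W * colbd (enum j)"
proof -
  have le: "(\<Sum>i<n. norm (K i j)) \<le> W * colbd (enum j)" for n
  proof -
    have "(\<Sum>i<n. norm (K i j)) = (\<Sum>\<eta>\<in>enum ` {..<n}. norm (coef \<eta> (enum j)))"
      by (subst sum.reindex) (auto simp: K_def intro: inj_on_subset[OF inj_enum])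
    also have "\<dots> \<le> (\<Sum>\<eta>\<in>enum ` {..<n}. jbr \<eta> powr w * norm (coef \<eta> (enum j)))"
    proof (rule sum_mono)
      fix \<eta>
      have "1 * norm (coef \<eta> (enum j)) \<le> jbr \<eta> powr w * norm (coef \<eta> (enum j))"
        using w jbr_ge_1[of \<eta>] by (intro mult_right_mono) (auto simp: ge_one_powr_ge_zero)
      then show "norm (coef \<eta> (enum j)) \<le> jbr \<eta> powr w * norm (coef \<eta> (enum j))" by simp
    qed
    also have "\<dots> \<le> W * colbd (enum j)" by (rule column_sum_le) simp
    finally show ?thesis .
  qed
  show s: "summable (\<lambda>i. norm (K i j))"
    by (rule summableI_nonneg_bounded[OF _ le]) simp
  show "col_norm K j \<le> W * colbd (enum j)"
    unfolding col_norm_def by (rule suminf_le_const[OF s le])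
qed

lemma col_norm_K_nonneg: "0 \<le> col_norm K j"
  unfolding col_norm_def by (intro suminf_nonneg K_col) simp

lemma l1_K: "l1_matrix K"
  unfolding l1_matrix_altdef
proof
  show "summable (col_norm K)"
    by (rule summable_comparison_test'[OF summable_mult[OF colbd_enum_summable, of W], of 0])
       (simp add: K_col(2) col_norm_K_nonneg)
qed (simp add: K_col)

text \<open>Any t with n/(s - w) < t < 1 will do: the column norms are at most a multiple of the
  bracket to the power -(s - w), and (s - w) t > n is what the lattice sum requires.\<close>

lemma decay_K: "\<exists>t. l1_decay K t"
proof -
  define n where "n = real CARD('n)"
  have n: "0 < n" "n < s - w" using s by (auto simp: n_def)
  then have "n / (s - w) < 1" by simp
  then obtain t where t: "n / (s - w) < t" "t < 1" using dense by blast
  have "0 < n / (s - w)" using n by simp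
  then have t0: "0 < t" using t by linarith
  have nt: "n < (s - w) * t" using t(1) n by (simp add: field_simps)
  have "(\<lambda>\<xi> :: int ^ 'n. jbr \<xi> powr (- ((s - w) * t))) summable_on UNIV"
    by (rule summable_jbr) (use nt n_def in simp)
  from has_sum_enum[OF has_sum_infsum[OF this]]
  have s1: "summable (\<lambda>j. jbr (enum j) powr (- ((s - w) * t)))" by (rule sums_summable)
  have "summable (\<lambda>j. col_norm K j powr t)"
  proof (rule summable_comparison_test'[OF summable_mult[OF s1, of "W powr t"], of 0])
    fix j
    have "col_norm K j powr t \<le> (W * colbd (enum j)) powr t"
      using t0 by (intro powr_mono2 K_col col_norm_K_nonneg) auto
    also have "\<dots> = W powr t * colbd (enum j) powr t"
      using W_nonneg colbd_nonneg by (simp add: powr_mult)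
    also have "colbd (enum j) powr t = jbr (enum j) powr (- ((s - w) * t))"
      unfolding colbd_def powr_powr by (simp only: minus_mult_left)
    finally show "norm (col_norm K j powr t) \<le> W powr t * jbr (enum j) powr (- ((s - w) * t))" by simp
  qed
  then have "l1_decay K t" using l1_K t t0 by unfold_locales auto
  then show ?thesis by blast
qed

lemma seq_bounded: "f \<in> space \<Longrightarrow> seq f \<in> bounded_seqs"
  by (rule bounded_seqsI[of _ "N f"]) (simp add: seq_def norm_fhat_le_N)

lemma fhat_seq: "fhat f \<xi> = seq f (inv_into UNIV enum \<xi>)"
  by (simp add: seq_def surj_f_inv_f[OF bij_is_surj[OF bij_enum]])

lemma N_eq_0_iff_seq: "f \<in> space \<Longrightarrow> N f = 0 \<longleftrightarrow> seq f = (\<lambda>_. 0)"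
  unfolding N_eq_0_iff fhat_seq by (auto simp: fun_eq_iff inv_f_f[OF inj_enum]) (metis fhat_seq seq_def)

lemma mat_app_K:
  assumes "v \<in> bounded_seqs"
  shows "mat_app K v i = (\<Sum>\<^sub>\<infinity>\<xi>. coef (enum i) \<xi> * v (inv_into UNIV enum \<xi>))"
proof -
  obtain M where "\<And>i. norm (v i) \<le> M" using bounded_seqsE[OF assms] by metis
  then have "(\<lambda>\<xi>. norm (coef (enum i) \<xi> * v (inv_into UNIV enum \<xi>))) summable_on UNIV"
    by (rule row_summable[of _ "\<lambda>_. M"]) (intro summable_on_cmult_right colbd_summable)
  from has_sum_enum[OF has_sum_infsum[OF abs_summable_summable[OF this]]]
  show ?thesis by (simp add: mat_app_def K_def sums_iff inv_f_f[OF inj_enum])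
qed

lemma mat_app_seq:
  assumes "f \<in> space" shows "mat_app K (seq f) = seq (pdo a f)"
  by (simp add: fun_eq_iff mat_app_K[OF seq_bounded[OF assms]] seq_def[of "pdo a f"] fhat_pdo[OF assms] fhat_seq[symmetric])

definition weighted_seq :: "(nat \<Rightarrow> complex) \<Rightarrow> bool" where
  "weighted_seq v \<longleftrightarrow> (\<lambda>\<xi>. jbr \<xi> powr w * norm (v (inv_into UNIV enum \<xi>))) summable_on UNIV"

lemma mat_app_weighted:
  assumes "v \<in> bounded_seqs" shows "weighted_seq (mat_app K v)"
proof -
  obtain M where "\<And>i. norm (v i) \<le> M" using bounded_seqsE[OF assms] by metis
  then have "(\<lambda>\<eta>. jbr \<eta> powr w * norm (\<Sum>\<^sub>\<infinity>\<xi>. coef \<eta> \<xi> * v (inv_into UNIV enum \<xi>))) summable_on UNIV"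
    by (rule image_weighted[of _ "\<lambda>_. M"]) (intro summable_on_cmult_right colbd_summable)
  then show ?thesis
    unfolding weighted_seq_def mat_app_K[OF assms] by (simp add: surj_f_inv_f[OF bij_is_surj[OF bij_enum]])
qed

lemma weighted_seq_lincomb:
  assumes "weighted_seq u" "weighted_seq v" shows "weighted_seq (\<lambda>i. b * u i + c * v i)"
  unfolding weighted_seq_def
proof (rule summable_on_comparison_test)
  show "(\<lambda>\<xi>. norm b * (jbr \<xi> powr w * norm (u (inv_into UNIV enum \<xi>))) + norm c * (jbr \<xi> powr w * norm (v (inv_into UNIV enum \<xi>)))) summable_on UNIV"
    using assms unfolding weighted_seq_def by (intro summable_on_add summable_on_cmult_right)
  show "jbr \<xi> powr w * norm (b * u (inv_into UNIV enum \<xi>) + c * v (inv_into UNIV enum \<xi>))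
    \<le> norm b * (jbr \<xi> powr w * norm (u (inv_into UNIV enum \<xi>))) + norm c * (jbr \<xi> powr w * norm (v (inv_into UNIV enum \<xi>)))" for \<xi>
  proof -
    have "norm (b * u (inv_into UNIV enum \<xi>) + c * v (inv_into UNIV enum \<xi>)) \<le> norm b * norm (u (inv_into UNIV enum \<xi>)) + norm c * norm (v (inv_into UNIV enum \<xi>))"
      using norm_triangle_ineq[of "b * u (inv_into UNIV enum \<xi>)" "c * v (inv_into UNIV enum \<xi>)"] by (simp add: norm_mult)
    then have "jbr \<xi> powr w * norm (b * u (inv_into UNIV enum \<xi>) + c * v (inv_into UNIV enum \<xi>))
       \<le> jbr \<xi> powr w * (norm b * norm (u (inv_into UNIV enum \<xi>)) + norm c * norm (v (inv_into UNIV enum \<xi>)))"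
      by (rule mult_left_mono) simp
    then show ?thesis by (simp add: algebra_simps)
  qed
qed simp

lemma weighted_seq_synthesis:
  assumes "weighted_seq v"
  obtains u where "u \<in> space" "seq u = v"
proof -
  obtain u where "u \<in> space" "\<And>\<xi>. fhat u \<xi> = v (inv_into UNIV enum \<xi>)"
    using synthesis[OF assms[unfolded weighted_seq_def]] by blast
  then show ?thesis using that[of u] by (simp add: fun_eq_iff seq_def inv_f_f[OF inj_enum])
qed

text \<open>For nonzero z, v = (A v - (A - z) v) / z. The first term is weighted summable for every
  bounded \<open>v\<close>, the second by induction on the order of the generalised
  eigenvector.\<close>

lemma gen_eigenspace_weighted:
  assumes z: "z \<noteq> 0" and v: "v \<in> gen_eigenspace K z"
  shows "weighted_seq v"
proof -
  have zero: "weighted_seq (\<lambda>_. 0)" by (simp add: weighted_seq_def)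
  have "weighted_seq v" if "v \<in> bounded_seqs" "(shift K z ^^ n) v = (\<lambda>_. 0)" for n v
    using that
  proof (induction n arbitrary: v)
    case (Suc n)
    have "weighted_seq (shift K z v)"
      using Suc.IH[of "shift K z v"] Suc.prems shift_bounded[OF l1_K] by (simp add: funpow_swap1)
    then have "weighted_seq (\<lambda>i. (1 / z) * mat_app K v i + (- 1 / z) * shift K z v i)"
      by (intro weighted_seq_lincomb mat_app_weighted Suc.prems)
    moreover have "(\<lambda>i. (1 / z) * mat_app K v i + (- 1 / z) * shift K z v i) = v"
      using z by (simp add: shift_def fun_eq_iff field_simps)
    ultimately show ?case by simp
  qed (simp add: zero)
  then show ?thesis using v by (auto simp: gen_eigenspace_def)
qed

lemma seq_shift:
  assumes f: "f \<in> space"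
  shows "(\<lambda>x. pdo a f x - z * f x) \<in> space" "seq (\<lambda>x. pdo a f x - z * f x) = shift K z (seq f)"
proof -
  have eq: "(\<lambda>x. pdo a f x - z * f x) = (\<lambda>x. pdo a f x + (- z) * f x)" by simp
  note zf = space_cmult[OF f, of "- z"]
  show "(\<lambda>x. pdo a f x - z * f x) \<in> space"
    unfolding eq by (rule space_add[OF pdo_in_space[OF f] zf])
  have "fhat (\<lambda>x. pdo a f x + (- z) * f x) \<xi> = fhat (pdo a f) \<xi> + (- z) * fhat f \<xi>" for \<xi>
    using fhat_add[OF space_integrable[OF pdo_in_space[OF f]] space_integrable[OF zf]] fhat_cmult by metis
  then show "seq (\<lambda>x. pdo a f x - z * f x) = shift K z (seq f)"
    unfolding eq by (simp add: fun_eq_iff shift_def mat_app_seq[OF f]) (simp add: seq_def)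
qed

lemma seq_shift_pow:
  assumes f: "f \<in> space"
  shows "((\<lambda>v x. pdo a v x - z * v x) ^^ k) f \<in> space \<and>
    seq (((\<lambda>v x. pdo a v x - z * v x) ^^ k) f) = (shift K z ^^ k) (seq f)"
  by (induction k) (auto simp: f seq_shift)

lemma gen_eigvec_iff:
  "gen_eigvec space N (pdo a) z u \<longleftrightarrow> u \<in> space \<and> seq u \<in> gen_eigenspace K z"
proof (cases "u \<in> space")
  case True
  have "N (((\<lambda>v x. pdo a v x - z * v x) ^^ k) u) = 0 \<longleftrightarrow> (shift K z ^^ k) (seq u) = (\<lambda>_. 0)" for k
    using seq_shift_pow[OF True, where z = z and k = k] N_eq_0_iff_seq by simp
  then show ?thesis using True seq_bounded[OF True] by (simp add: gen_eigvec_def gen_eigenspace_def)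
qed (simp add: gen_eigvec_def)

lemma eigenvalue_iff:
  assumes z: "z \<noteq> 0"
  shows "eigenvalue_on space N (pdo a) z \<longleftrightarrow> matrix_eigenvalue K z"
proof -
  have key: "N (\<lambda>x. pdo a u x - z * u x) = 0 \<longleftrightarrow> mat_app K (seq u) = (\<lambda>i. z * seq u i)" if "u \<in> space" for u
    using N_eq_0_iff_seq[OF seq_shift(1)[OF that]] by (simp add: seq_shift(2)[OF that] shift_def fun_eq_iff)
  show ?thesis
  proof
    assume "eigenvalue_on space N (pdo a) z"
    then obtain u where "u \<in> space" "N u \<noteq> 0" "N (\<lambda>x. pdo a u x - z * u x) = 0"
      by (auto simp: eigenvalue_on_def)
    then show "matrix_eigenvalue K z"
      unfolding matrix_eigenvalue_def using key N_eq_0_iff_seq seq_bounded by (intro bexI[of _ "seq u"]) auto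
  next
    assume "matrix_eigenvalue K z"
    then obtain v where v: "v \<in> bounded_seqs" "v \<noteq> (\<lambda>_. 0)" "mat_app K v = (\<lambda>i. z * v i)"
      by (auto simp: matrix_eigenvalue_def)
    then have "v \<in> gen_eigenspace K z"
      by (auto simp: gen_eigenspace_def shift_def intro!: exI[of _ 1])
    then obtain u where "u \<in> space" "seq u = v"
      using weighted_seq_synthesis[OF gen_eigenspace_weighted[OF z]] by blast
    then show "eigenvalue_on space N (pdo a) z"
      unfolding eigenvalue_on_def using v key[of u] N_eq_0_iff_seq[of u] by (intro bexI[of _ u]) auto
  qed
qed

text \<open>For every \<open>n\<close> the two predicates under \<open>GREATEST\<close> are
  equivalent: taking coefficients carries independent families one way, and synthesis carries them
  back.\<close>

lemma alg_mult_eq: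
  assumes z: "z \<noteq> 0" and d: "fin_dim (gen_eigenspace K z) d"
  shows "alg_mult space N (pdo a) z = d"
proof -
  have seq_sum: "seq (\<lambda>x. \<Sum>i<n. c i * v i x) = (\<lambda>j. \<Sum>i<n. c i * seq (v i) j)" "(\<lambda>x. \<Sum>i<n. c i * v i x) \<in> space"
    if "\<And>i. i < n \<Longrightarrow> v i \<in> space" for n and c :: "nat \<Rightarrow> complex" and v
    using that fhat_sum[of "{..<n}" v c] space_integrable space_sum[of "{..<n}" v c] by (auto simp: seq_def)
  have "(\<exists>v :: nat \<Rightarrow> real ^ 'n \<Rightarrow> complex. (\<forall>i<n. gen_eigvec space N (pdo a) z (v i)) \<and>
      (\<forall>c :: nat \<Rightarrow> complex. N (\<lambda>x. \<Sum>i<n. c i * v i x) = 0 \<longrightarrow> (\<forall>i<n. c i = 0))) \<longleftrightarrow>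
    (\<exists>v :: nat \<Rightarrow> nat \<Rightarrow> complex. (\<forall>i<n. v i \<in> gen_eigenspace K z) \<and>
      (\<forall>c :: nat \<Rightarrow> complex. (\<lambda>x. \<Sum>i<n. c i * v i x) = (\<lambda>_. 0) \<longrightarrow> (\<forall>i<n. c i = 0)))" (is "?L n \<longleftrightarrow> ?R n") for n
  proof
    assume "?L n"
    then obtain v where v: "\<And>i. i < n \<Longrightarrow> gen_eigvec space N (pdo a) z (v i)"
      and ind: "\<And>c. N (\<lambda>x. \<Sum>i<n. c i * v i x) = 0 \<Longrightarrow> \<forall>i<n. c i = 0" by blast
    have vs: "v i \<in> space" "seq (v i) \<in> gen_eigenspace K z" if "i < n" for i
      using v[OF that] by (auto simp: gen_eigvec_iff)
    show "?R n"
    proof (intro exI[of _ "\<lambda>i. seq (v i)"] conjI allI impI)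
      fix c i assume "(\<lambda>x. \<Sum>i<n. c i * seq (v i) x) = (\<lambda>_. 0)" "i < n"
      then have "N (\<lambda>x. \<Sum>i<n. c i * v i x) = 0"
        using N_eq_0_iff_seq[OF seq_sum(2)[of n v c]] seq_sum(1)[of n v c] vs by simp
      then show "c i = 0" using ind \<open>i < n\<close> by blast
    qed (use vs in blast)
  next
    assume "?R n"
    then obtain v where v: "\<And>i. i < n \<Longrightarrow> v i \<in> gen_eigenspace K z"
      and ind: "\<And>c. (\<lambda>x. \<Sum>i<n. c i * v i x) = (\<lambda>_. 0) \<Longrightarrow> \<forall>i<n. c i = 0" by blast
    have "\<exists>u. u \<in> space \<and> seq u = v i" if "i < n" for i
      using weighted_seq_synthesis[OF gen_eigenspace_weighted[OF z v[OF that]]] by blast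
    then obtain u where u: "\<And>i. i < n \<Longrightarrow> u i \<in> space" "\<And>i. i < n \<Longrightarrow> seq (u i) = v i" by metis
    show "?L n"
    proof (intro exI[of _ u] conjI allI impI)
      fix i assume "i < n"
      then show "gen_eigvec space N (pdo a) z (u i)" using u v by (simp add: gen_eigvec_iff)
    next
      fix c i assume *: "N (\<lambda>x. \<Sum>i<n. c i * u i x) = 0" "i < n"
      have "(\<lambda>j. \<Sum>i<n. c i * seq (u i) j) = (\<lambda>_. 0)"
        using N_eq_0_iff_seq[OF seq_sum(2)[of n u c]] seq_sum(1)[of n u c] u(1) *(1) by simp
      then have "(\<lambda>j. \<Sum>i<n. c i * v i j) = (\<lambda>_. 0)" using u(2) by simp
      then show "c i = 0" using ind *(2) by blast
    qed
  qed
  then show ?thesis unfolding alg_mult_def using fin_dim_Greatest[OF d] by simp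
qed

lemma eigenvalue_sum_pdo:
  "((\<lambda>z. of_nat (alg_mult space N (pdo a) z) * z) has_sum (\<Sum>i. K i i))
     {z. z \<noteq> 0 \<and> eigenvalue_on space N (pdo a) z}"
proof -
  obtain t where "l1_decay K t" using decay_K by blast
  then interpret l1_decay K t .
  have "{z. z \<noteq> 0 \<and> eigenvalue_on space N (pdo a) z} = {z. z \<noteq> 0 \<and> matrix_eigenvalue K z}"
    using eigenvalue_iff by blast
  moreover have "of_nat (alg_mult space N (pdo a) z) * z = of_nat (mult z) * z" for z :: complex
    using alg_mult_eq[OF _ fin_dim_mult[of z]] by (cases "z = 0") auto
  ultimately show ?thesis using eigenvalue_sum by (simp only:)
qed

end

section \<open>Nuclearity and the trace\<close>

context pdo_besov
begin

lemma partial_remainder: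
  assumes u: "u \<in> space" and y: "\<And>j. y j \<in> space"
  shows "(\<lambda>x. pdo a u x - (\<Sum>j<k. c j * y j x)) \<in> space"
    and "fhat (\<lambda>x. pdo a u x - (\<Sum>j<k. c j * y j x)) \<eta> = fhat (pdo a u) \<eta> - (\<Sum>j<k. c j * fhat (y j) \<eta>)"
proof -
  have eq: "(\<lambda>x. pdo a u x - (\<Sum>j<k. c j * y j x)) = (\<lambda>x. pdo a u x + (-1) * (\<Sum>j<k. c j * y j x))" by simp
  have s: "(\<lambda>x. \<Sum>j<k. c j * y j x) \<in> space" by (rule space_sum[OF y])
  note s' = space_cmult[OF s, of "-1"]
  show "(\<lambda>x. pdo a u x - (\<Sum>j<k. c j * y j x)) \<in> space"
    unfolding eq by (rule space_add[OF pdo_in_space[OF u] s'])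
  have "fhat (\<lambda>x. pdo a u x + (-1) * (\<Sum>j<k. c j * y j x)) \<eta> = fhat (pdo a u) \<eta> + (-1) * fhat (\<lambda>x. \<Sum>j<k. c j * y j x) \<eta>"
    by (subst fhat_add[OF space_integrable[OF pdo_in_space[OF u]] space_integrable[OF s']]) (simp only: fhat_cmult)
  also have "fhat (\<lambda>x. \<Sum>j<k. c j * y j x) \<eta> = (\<Sum>j<k. c j * fhat (y j) \<eta>)"
    by (rule fhat_sum) (rule space_integrable[OF y])
  finally show "fhat (\<lambda>x. pdo a u x - (\<Sum>j<k. c j * y j x)) \<eta> = fhat (pdo a u) \<eta> - (\<Sum>j<k. c j * fhat (y j) \<eta>)"
    unfolding eq by simp
qed

text \<open>A coefficient functional has dual norm at most 1, so the column norms bound the nuclear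
  series. The remainder after \<open>k\<close> terms is the matrix applied to the coefficients
  outside the first \<open>k\<close> frequencies, hence it is small in norm.\<close>

theorem nuclear_pdo:
  "nuclear_repr space N (pdo a) (\<lambda>j u. fhat u (enum j)) (\<lambda>j. column_fun (enum j))"
  unfolding nuclear_repr_def
proof (intro conjI allI ballI)
  show "bounded_linear_functional space N (\<lambda>u. fhat u (enum j))" for j by (rule coefficient_functional)
  show "column_fun (enum j) \<in> space" for j by (rule column_fun_in_space)
  have N_col0: "0 \<le> N (column_fun \<xi>)" for \<xi>
    using norm_fhat_le_N[OF column_fun_in_space, of \<xi> 0] norm_ge_zero order.trans by blast
  show "summable (\<lambda>j. dual_norm space N (\<lambda>u. fhat u (enum j)) * N (column_fun (enum j)))"
  proof (rule summable_comparison_test'[OF summable_mult[OF colbd_enum_summable, of W], of 0])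
    fix j
    note dn = dual_norm_props[OF coefficient_functional[of "enum j"]]
    have "dual_norm space N (\<lambda>u. fhat u (enum j)) \<le> 1"
      by (rule dn(3)) (simp_all add: norm_fhat_le_N)
    then have "dual_norm space N (\<lambda>u. fhat u (enum j)) * N (column_fun (enum j)) \<le> 1 * (W * colbd (enum j))"
      using N_col0 N_column_fun_le by (intro mult_mono) auto
    then show "norm (dual_norm space N (\<lambda>u. fhat u (enum j)) * N (column_fun (enum j))) \<le> W * colbd (enum j)"
      using dn(1) N_col0 by simp
  qed
  fix u assume u: "u \<in> space"
  show "pdo a u \<in> space" by (rule pdo_in_space[OF u])
  define R where "R k x = pdo a u x - (\<Sum>j<k. fhat u (enum j) * column_fun (enum j) x)" for k x
  have R: "R k \<in> space" "fhat (R k) \<eta> = fhat (pdo a u) \<eta> - (\<Sum>j<k. fhat u (enum j) * coef \<eta> (enum j))" for k \<eta>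
    using partial_remainder[OF u, of "\<lambda>j. column_fun (enum j)" "\<lambda>j. fhat u (enum j)" k, OF column_fun_in_space]
    unfolding R_def[abs_def] by (simp_all add: fhat_column_fun)
  have NR0: "0 \<le> N (R k)" for k
    using norm_fhat_le_N[OF R(1), of k 0] norm_ge_zero order.trans by blast
  define tail where "tail k = suminf (\<lambda>j. colbd (enum j)) - (\<Sum>j<k. colbd (enum j))" for k
  have le: "N (R k) \<le> W * (N u * tail k)" for k
  proof -
    let ?S = "enum ` {..<k}"
    define c where "c \<xi> = (if \<xi> \<in> ?S then 0 else fhat u \<xi>)" for \<xi>
    define b where "b \<xi> = (if \<xi> \<in> ?S then 0 else N u)" for \<xi>
    have Nu0: "0 \<le> N u" using norm_fhat_le_N[OF u, of 0] norm_ge_zero order.trans by blast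
    have cb: "norm (c \<xi>) \<le> b \<xi>" for \<xi> by (simp add: c_def b_def norm_fhat_le_N[OF u])
    have bs: "((\<lambda>\<xi>. b \<xi> * colbd \<xi>) has_sum (N u * tail k)) UNIV"
    proof -
      have "(colbd has_sum (suminf (\<lambda>j. colbd (enum j)))) UNIV"
        using has_sum_infsum[OF colbd_summable] has_sum_enum sums_unique by metis
      then have 1: "((\<lambda>\<xi>. N u * colbd \<xi>) has_sum (N u * suminf (\<lambda>j. colbd (enum j)))) UNIV"
        by (rule has_sum_cmult_right)
      have "(\<Sum>\<xi>\<in>?S. N u * colbd \<xi>) = N u * (\<Sum>j<k. colbd (enum j))"
        by (subst sum.reindex) (auto simp: sum_distrib_left intro: inj_on_subset[OF inj_enum])
      then have 2: "((\<lambda>\<xi>. if \<xi> \<in> ?S then N u * colbd \<xi> else 0) has_sum (N u * (\<Sum>j<k. colbd (enum j)))) UNIV"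
        by (intro has_sum_finite_neutralI[of ?S]) auto
      have "((\<lambda>\<xi>. N u * colbd \<xi> - (if \<xi> \<in> ?S then N u * colbd \<xi> else 0)) has_sum (N u * suminf (\<lambda>j. colbd (enum j)) - N u * (\<Sum>j<k. colbd (enum j)))) UNIV"
        by (rule has_sum_diff[OF 1 2])
      moreover have "(\<lambda>\<xi>. N u * colbd \<xi> - (if \<xi> \<in> ?S then N u * colbd \<xi> else 0)) = (\<lambda>\<xi>. b \<xi> * colbd \<xi>)"
        by (auto simp: b_def fun_eq_iff)
      ultimately show ?thesis by (simp add: tail_def right_diff_distrib)
    qed
    have fR: "fhat (R k) \<eta> = (\<Sum>\<^sub>\<infinity>\<xi>. coef \<eta> \<xi> * c \<xi>)" for \<eta>
    proof -
      have 1: "((\<lambda>\<xi>. coef \<eta> \<xi> * fhat u \<xi>) has_sum fhat (pdo a u) \<eta>) UNIV"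
        by (rule pdo_props(3)[OF space_integrable[OF u]])
      have "(\<Sum>\<xi>\<in>?S. coef \<eta> \<xi> * fhat u \<xi>) = (\<Sum>j<k. fhat u (enum j) * coef \<eta> (enum j))"
        by (subst sum.reindex) (auto simp: mult.commute intro: inj_on_subset[OF inj_enum])
      then have 2: "((\<lambda>\<xi>. if \<xi> \<in> ?S then coef \<eta> \<xi> * fhat u \<xi> else 0) has_sum (\<Sum>j<k. fhat u (enum j) * coef \<eta> (enum j))) UNIV"
        by (intro has_sum_finite_neutralI[of ?S]) auto
      have "((\<lambda>\<xi>. coef \<eta> \<xi> * fhat u \<xi> - (if \<xi> \<in> ?S then coef \<eta> \<xi> * fhat u \<xi> else 0)) has_sum fhat (R k) \<eta>) UNIV"
        unfolding R(2) by (rule has_sum_diff[OF 1 2])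
      moreover have "(\<lambda>\<xi>. coef \<eta> \<xi> * fhat u \<xi> - (if \<xi> \<in> ?S then coef \<eta> \<xi> * fhat u \<xi> else 0)) = (\<lambda>\<xi>. coef \<eta> \<xi> * c \<xi>)"
        by (auto simp: c_def fun_eq_iff)
      ultimately show ?thesis by (simp add: infsumI)
    qed
    note iw = image_weighted[of c b, OF cb has_sum_imp_summable[OF bs]]
    have "N (R k) \<le> (\<Sum>\<^sub>\<infinity>\<eta>. jbr \<eta> powr w * norm (fhat (R k) \<eta>))"
      by (rule weighted_summable(2)) (simp only: fR iw)
    also have "\<dots> \<le> W * (\<Sum>\<^sub>\<infinity>\<xi>. b \<xi> * colbd \<xi>)" unfolding fR by (rule iw(2))
    finally show ?thesis using infsumI[OF bs] by simp
  qed
  have "tail \<longlonglongrightarrow> suminf (\<lambda>j. colbd (enum j)) - suminf (\<lambda>j. colbd (enum j))"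
    unfolding tail_def[abs_def] by (intro tendsto_intros summable_LIMSEQ colbd_enum_summable)
  then have "(\<lambda>k. W * (N u * tail k)) \<longlonglongrightarrow> W * (N u * 0)" by (intro tendsto_intros) simp
  then have lim: "(\<lambda>k. W * (N u * tail k)) \<longlonglongrightarrow> 0" by simp
  have "(\<lambda>k. N (R k)) \<longlonglongrightarrow> 0"
    by (rule tendsto_sandwich[OF always_eventually[OF allI[OF NR0]] always_eventually[OF allI[OF le]] tendsto_const lim])
  then show "(\<lambda>k. N (\<lambda>x. pdo a u x - (\<Sum>j<k. fhat u (enum j) * column_fun (enum j) x))) \<longlonglongrightarrow> 0"
    unfolding R_def[abs_def] .
qed

lemma coef_diag_summable: "(\<lambda>\<xi>. coef \<xi> \<xi>) summable_on UNIV"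
proof (rule abs_summable_summable, rule summable_on_comparison_test)
  show "(\<lambda>\<xi>. W * colbd \<xi>) summable_on UNIV" by (intro summable_on_cmult_right colbd_summable)
qed (auto simp: norm_coef_le)

lemma coef_diag_has_sum: "((\<lambda>\<xi>. coef \<xi> \<xi>) has_sum (\<Sum>i. K i i)) UNIV"
proof -
  note h = has_sum_infsum[OF coef_diag_summable]
  have "(\<lambda>i. K i i) sums (\<Sum>\<^sub>\<infinity>\<xi>. coef \<xi> \<xi>)" unfolding K_def by (rule has_sum_enum[OF h])
  then show ?thesis using h by (simp add: sums_iff)
qed

lemma coef_diag: "coef \<xi> \<xi> = integral unit_cube (\<lambda>x. a x \<xi>)"
  by (simp add: coef_def fhat_def dotZ_def)

lemma filterlim_low: "filterlim low (finite_subsets_at_top UNIV) sequentially"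
  unfolding filterlim_finite_subsets_at_top
proof (intro allI impI)
  fix X :: "(int ^ 'n) set" assume "finite X \<and> X \<subseteq> UNIV"
  then have fin: "finite X" by simp
  obtain l where l: "\<And>\<xi> :: int ^ 'n. \<xi> \<in> dyadic (l \<xi>)" using dyadic_cover by metis
  obtain M0 where M0: "\<forall>\<xi>\<in>X. l \<xi> < M0"
    using finite_nat_set_iff_bounded[of "l ` X"] fin by auto
  have "X \<subseteq> low M" if "M0 \<le> M" for M
  proof
    fix \<xi> assume "\<xi> \<in> X"
    then have "l \<xi> \<in> {..<M}" using M0 that by fastforce
    then show "\<xi> \<in> low M" unfolding low_def using l by (rule UN_I)
  qed
  then show "\<forall>\<^sub>F M in sequentially. finite (low M) \<and> X \<subseteq> low M \<and> low M \<subseteq> UNIV"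
    unfolding eventually_sequentially using finite_low by blast
qed

text \<open>Independence of the trace from the representation rests on an approximation property,
  provided by the low-pass operators. A functional on a truncated \<open>y j\<close> is a finite
  combination of its values on characters; summed over \<open>j\<close> this gives a finite part of
  the diagonal, and the limit in \<open>M\<close> is taken by dominated convergence.\<close>

theorem nuclear_trace:
  assumes repr: "nuclear_repr space N (pdo a) e y"
  shows "(\<lambda>j. e j (y j)) sums (\<Sum>i. K i i)"
proof -
  have e: "bounded_linear_functional space N (e j)" and y: "y j \<in> space" for j
    using repr by (auto simp: nuclear_repr_def)
  define B where "B j = dual_norm space N (e j) * N (y j)" for j
  have B: "summable B" using repr unfolding nuclear_repr_def B_def[abs_def] by blast
  note dn = dual_norm_props[OF e]
  \<comment> \<open>The representation is applied to \<open>character \<xi>\<close> and tested with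
    the coefficient at \<xi>.\<close>
  have diag: "(\<lambda>j. fhat (y j) \<xi> * e j (character \<xi>)) sums coef \<xi> \<xi>" for \<xi>
  proof -
    let ?R = "\<lambda>k x. pdo a (character \<xi>) x - (\<Sum>j<k. e j (character \<xi>) * y j x)"
    have lim: "(\<lambda>k. N (?R k)) \<longlonglongrightarrow> 0" using repr character_in_space unfolding nuclear_repr_def by blast
    have "(\<Sum>\<^sub>\<infinity>\<eta>. coef \<xi> \<eta> * fhat (character \<xi>) \<eta>) = coef \<xi> \<xi>"
      by (rule infsumI, rule has_sum_finite_neutralI[of "{\<xi>}"]) (auto simp: fhat_character)
    then have R: "fhat (?R k) \<xi> = coef \<xi> \<xi> - (\<Sum>j<k. fhat (y j) \<xi> * e j (character \<xi>))" for k
    proof -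
      have "fhat (?R k) \<xi> = fhat (pdo a (character \<xi>)) \<xi> - (\<Sum>j<k. e j (character \<xi>) * fhat (y j) \<xi>)"
        by (rule partial_remainder(2)[OF character_in_space y])
      also have "fhat (pdo a (character \<xi>)) \<xi> = coef \<xi> \<xi>"
        using \<open>_ = coef \<xi> \<xi>\<close> by (simp only: fhat_pdo[OF character_in_space])
      finally show ?thesis by (simp only: mult.commute)
    qed
    have "norm (fhat (?R k) \<xi>) \<le> N (?R k)" for k
      by (rule norm_fhat_le_N[OF partial_remainder(1)[OF character_in_space y]])
    then have "(\<lambda>k. fhat (?R k) \<xi>) \<longlonglongrightarrow> 0"
      by (rule Lim_null_comparison[OF always_eventually[OF allI] lim])
    then have "(\<lambda>k. coef \<xi> \<xi> - (coef \<xi> \<xi> - (\<Sum>j<k. fhat (y j) \<xi> * e j (character \<xi>)))) \<longlonglongrightarrow> coef \<xi> \<xi> - 0"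
      unfolding R by (intro tendsto_intros)
    then show ?thesis by (simp add: sums_def)
  qed
  define x where "x j = e j (y j)" for j
  define xM where "xM M j = e j (lowpass (y j) M)" for M j
  have xM_sums: "xM M sums (\<Sum>\<xi>\<in>low M. coef \<xi> \<xi>)" for M
  proof -
    have "xM M = (\<lambda>j. \<Sum>\<xi>\<in>low M. fhat (y j) \<xi> * e j (character \<xi>))"
      unfolding xM_def lowpass_def[abs_def] by (rule ext, rule functional_sum[OF e character_in_space])
    then show ?thesis using sums_sum[of "low M" "\<lambda>\<xi> j. fhat (y j) \<xi> * e j (character \<xi>)" "\<lambda>\<xi>. coef \<xi> \<xi>"] diag
      by simp
  qed
  define g where "g j M z = y j z + (-1) * lowpass (y j) M z" for j M z
  note ng = N_minus_lowpass[OF y, folded g_def]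
  have diff: "x j - xM M j = e j (g j M)" for j M
  proof -
    have "e j (g j M) = e j (y j) + e j (\<lambda>z. (-1) * lowpass (y j) M z)"
      unfolding g_def[abs_def] by (rule bounded_linear_functionalD(1)[OF e y space_cmult[OF lowpass_in_space]])
    also have "e j (\<lambda>z. (-1) * lowpass (y j) M z) = (-1) * e j (lowpass (y j) M)"
      by (rule bounded_linear_functionalD(2)[OF e lowpass_in_space])
    finally show ?thesis by (simp add: x_def xM_def)
  qed
  have d_le: "norm (x j - xM M j) \<le> dual_norm space N (e j) * N (g j M)" for j M
    unfolding diff by (rule dn(2)[OF ng(1)])
  \<comment> \<open>The majorant does not depend on \<open>M\<close>, because the complement of the
    truncation is a contraction; Tannery's theorem requires this.\<close>
  have d_le_B: "norm (x j - xM M j) \<le> B j" for j M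
    unfolding B_def by (rule order.trans[OF d_le]) (intro mult_left_mono ng(2) dn(1))
  have d_lim: "(\<lambda>M. x j - xM M j) \<longlonglongrightarrow> 0" for j
  proof -
    have "(\<lambda>M. dual_norm space N (e j) * N (g j M)) \<longlonglongrightarrow> dual_norm space N (e j) * 0"
      by (intro tendsto_intros ng(3))
    then have "(\<lambda>M. dual_norm space N (e j) * N (g j M)) \<longlonglongrightarrow> 0" by simp
    then show ?thesis by (rule Lim_null_comparison[OF always_eventually[OF allI[OF d_le]]])
  qed
  have x_sum: "summable x"
  proof (rule summable_comparison_test'[OF B, of 0])
    show "norm (x j) \<le> B j" for j unfolding x_def B_def by (rule dn(2)[OF y])
  qed
  have "\<forall>\<^sub>F (j, M) in at_top \<times>\<^sub>F sequentially. norm (x j - xM M j) \<le> B j"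
    by (rule always_eventually) (simp add: d_le_B split: prod.split)
  from tannerys_theorem[OF d_lim this B]
  have "(\<lambda>M. \<Sum>j. x j - xM M j) \<longlonglongrightarrow> (\<Sum>j. 0)" by simp
  then have "(\<lambda>M. suminf x - (\<Sum>j. x j - xM M j)) \<longlonglongrightarrow> suminf x - 0"
    by (intro tendsto_intros) simp
  moreover have "suminf x - (\<Sum>j. x j - xM M j) = (\<Sum>\<xi>\<in>low M. coef \<xi> \<xi>)" for M
    unfolding suminf_diff[OF x_sum sums_summable[OF xM_sums], symmetric] sums_unique[OF xM_sums] by simp
  ultimately have "(\<lambda>M. \<Sum>\<xi>\<in>low M. coef \<xi> \<xi>) \<longlonglongrightarrow> suminf x" by simp
  moreover have "(\<lambda>M. \<Sum>\<xi>\<in>low M. coef \<xi> \<xi>) \<longlonglongrightarrow> (\<Sum>i. K i i)"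
    using coef_diag_has_sum unfolding has_sum_def by (rule filterlim_compose[OF _ filterlim_low])
  ultimately have "suminf x = (\<Sum>i. K i i)" by (rule LIMSEQ_unique)
  then show ?thesis using summable_sums[OF x_sum] unfolding x_def by simp
qed

end

text \<open>Quantifying over all nuclear representations makes well-definedness of the nuclear trace
  part of the claim, and \<open>has_sum\<close> frees the eigenvalue sum from any ordering.\<close>

theorem theorem4p5:
  fixes p1 \<alpha> \<rho> \<delta> m w1 :: real and k :: nat
    and a :: "real ^ 'n \<Rightarrow> int ^ 'n \<Rightarrow> complex"
  assumes "1 < p1" "p1 < 2"
    and "\<alpha> = 1 / p1 - 1 / 2"
    and "0 \<le> \<rho>" "\<rho> \<le> 1" "0 \<le> \<delta>" "\<delta> \<le> 1"
    and "real k > real CARD('n) / 2"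
    and "symbol_class m \<rho> \<delta> (2 * k) a"
    and "0 < w1" "w1 = \<alpha> * real CARD('n)" "w1 < 2 * real k - real CARD('n)"
    and "m < - real CARD('n) - w1 - 2 * real k * \<delta>"
  shows "nuclear (besov_space w1 p1 2) (besov_norm w1 p1 2) (pdo a) \<and>
    (\<exists>tr. ((\<lambda>\<xi>. integral unit_cube (\<lambda>x. a x \<xi>)) has_sum tr) UNIV \<and>
      (\<forall>e y. nuclear_repr (besov_space w1 p1 2) (besov_norm w1 p1 2) (pdo a) e y \<longrightarrow>
          (\<lambda>j. e j (y j)) sums tr) \<and>
      ((\<lambda>z. of_nat (alg_mult (besov_space w1 p1 2) (besov_norm w1 p1 2) (pdo a) z) * z)
          has_sum tr)
        {z. z \<noteq> 0 \<and> eigenvalue_on (besov_space w1 p1 2) (besov_norm w1 p1 2) (pdo a) z})"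
proof -
  note sym = \<open>symbol_class m \<rho> \<delta> (2 * k) a\<close>
  \<comment> \<open>The loss 2 k \<delta> is the price of 2 k derivatives of the symbol.\<close>
  define s where "s = - (m + 2 * real k * \<delta>)"
  obtain C1 where C1: "0 \<le> C1"
    "\<And>\<xi> \<zeta>. norm (fhat (\<lambda>x. a x \<xi>) \<zeta>) \<le> C1 * jbr \<zeta> powr (- (2 * real k)) * jbr \<xi> powr (- s)"
    using symbol_coefficient_decay[OF sym \<open>0 \<le> \<delta>\<close>] unfolding s_def by (metis minus_minus)
  have "\<exists>C. \<forall>x \<xi>. norm (pdiffs [] (\<lambda>y. a y \<xi>) x) \<le> C * jbr \<xi> powr (m + \<delta> * real (length []))"
    using sym unfolding symbol_class_def by (metis le0 list.size(3))
  then obtain C2 where C2: "\<And>x \<xi>. norm (a x \<xi>) \<le> C2 * jbr \<xi> powr m" by auto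
  \<comment> \<open>One constant for the decay of the coefficients and for the bound on the
    symbol.\<close>
  define C where "C = max C1 C2"
  have cont: "continuous_on UNIV (\<lambda>x. a x \<xi>)" for \<xi>
  proof -
    have "continuous_on UNIV (pdiffs [] (\<lambda>x. a x \<xi>))" using sym unfolding symbol_class_def smooth_fun_def by blast
    then show ?thesis by simp
  qed
  \<comment> \<open>The two exponent conditions are the assumptions on \<open>w1\<close> and
    \<open>m\<close>: off the diagonal 2 k > n + w1, and in the column index s > n + w1.\<close>
  interpret pdo_besov w1 p1 "TYPE('n)" a C "2 * real k" s
  proof unfold_locales
    show "0 < w1" "1 < p1" by fact+
    show "continuous_on UNIV (\<lambda>x. a x \<xi>)" for \<xi> by (rule cont)
    show "periodic_fun (\<lambda>x. a x \<xi>)" for \<xi> using sym by (simp add: symbol_class_def)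
    show "0 \<le> C" using C1(1) by (simp add: C_def)
    show "norm (fhat (\<lambda>x. a x \<xi>) \<zeta>) \<le> C * jbr \<zeta> powr - (2 * real k) * jbr \<xi> powr - s" for \<xi> \<zeta>
      by (rule order.trans[OF C1(2)]) (intro mult_right_mono; simp add: C_def)
    show "norm (a x \<xi>) \<le> C * jbr \<xi> powr - s" for x \<xi>
    proof -
      have "norm (a x \<xi>) \<le> C * jbr \<xi> powr m"
        by (rule order.trans[OF C2]) (intro mult_right_mono; simp add: C_def)
      also have "\<dots> \<le> C * jbr \<xi> powr - s"
        using C1(1) \<open>0 \<le> \<delta>\<close> jbr_ge_1[of \<xi>] by (intro mult_left_mono powr_mono) (auto simp: C_def s_def)
      finally show ?thesis .
    qed
    show "real CARD('n) + w1 < 2 * real k" using \<open>w1 < 2 * real k - real CARD('n)\<close> by simp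
    show "real CARD('n) + w1 < s" using \<open>m < - real CARD('n) - w1 - 2 * real k * \<delta>\<close> by (simp add: s_def)
  qed
  show ?thesis
    using nuclear_pdo nuclear_trace coef_diag_has_sum eigenvalue_sum_pdo
    unfolding nuclear_def coef_diag by blast
qed

end
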